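(* Let $p,\mu,\kappa:(0,\infty)\to\mathbb{R}$ be smooth functions with $\mu>0$, $\kappa>0$, $p'<0$ and $p''>0$ on $(0,\infty)$. Assume that the end states $(V^\pm,U^\pm)$ (with $V^\pm>0$, $U^\pm\in\mathbb{R}$) and the speed $s\in\mathbb{R}$ define a compressive $2$-shock (forward shock) for the $p$-system $v_t-u_x=0$, $u_t+p(v)_x=0$. Then there exists a unique (up to translations) traveling profile $(V,U)$, i.e. smooth functions $V:\mathbb{R}\to(0,\infty)$, $U:\mathbb{R}\to\mathbb{R}$ solving $$-sV'-U'=0,\qquad -sU'+p(V)'=\Big(\frac{\mu(V)}{V}U'\Big)'-\Big(\kappa(V)V''+\tfrac12\kappa'(V)(V')^2\Big)'$$ with $\lim_{y\to\pm\infty}V(y)=V^\pm$ and $\lim_{y\to\pm\infty}U(y)=U^\pm$. Moreover, this traveling wave is oscillating whenever $$0<\eta(V^+)<\frac{2V^+\sqrt{f'(V^+)}}{|s|},$$ where $\eta(v)=\mu(v)/\sqrt{\kappa(v)}$ and $f'(v)=p'(v)+s^2$.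
   Context: The system under study is $v_t-u_x=0$, $u_t+p(v)_x=\big(\frac{\mu(v)}{v}u_x\big)_x-\big(\kappa(v)v_{xx}+\frac12\kappa'(v)v_x^2\big)_x$; traveling profiles are solutions $(v,u)(x,t)=(V,U)(x-st)$, with $y=x-st$. The triple $(V^\pm,U^\pm,s)$ defines a compressive $2$-shock (forward shock) if the Rankine–Hugoniot conditions $s(V^+-V^-)=U^--U^+$ and $s(U^+-U^-)=p(V^+)-p(V^-)$ hold and, with characteristic speeds $\lambda_1(v)=-\sqrt{-p'(v)}$, $\lambda_2(v)=\sqrt{-p'(v)}$, the Lax conditions $\lambda_2(V^+)<s<\lambda_2(V^-)$, $s>\lambda_1(V^-)$ hold. In particular $s>0$ and $V^+>V^-$. With $f(V)=p(V)+s^2V-C$, $C=s^2V^\pm+p(V^\pm)$, the profile $V$ corresponds to a heteroclinic orbit from $(V^-,0)$ to $(V^+,0)$ of the planar system $V'=Q$, $Q'=-\frac1{\kappa(V)}\big[f(V)+s\frac{\mu(V)}{V}Q+\frac12\kappa'(V)Q^2\big]$. "Oscillating" means that the equilibrium $(V^+,0)$ is a focus of this system, around which the orbit spirals as $y\to+\infty$, so that $V$ is non-monotone. *)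

theory Defs
  imports "HOL-Analysis.Analysis"
begin

(* Intended for open S, where every iterated derivative only depends on f near the point. *)
definition smooth_on :: "real set \<Rightarrow> (real \<Rightarrow> real) \<Rightarrow> bool" where
  "smooth_on S f \<longleftrightarrow> (\<forall>n. \<forall>x\<in>S. (deriv ^^ n) f differentiable (at x))"

definition lambda1 :: "(real \<Rightarrow> real) \<Rightarrow> real \<Rightarrow> real" where
  "lambda1 p v = - sqrt (- deriv p v)"

definition lambda2 :: "(real \<Rightarrow> real) \<Rightarrow> real \<Rightarrow> real" where
  "lambda2 p v = sqrt (- deriv p v)"

(* Throughout, Vm, Um and Vp, Up are the left (y to -infinity) and right (y to +infinity)
   end states. *)
definition compressive_2_shock ::
    "(real \<Rightarrow> real) \<Rightarrow> real \<Rightarrow> real \<Rightarrow> real \<Rightarrow> real \<Rightarrow> real \<Rightarrow> bool" where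
  "compressive_2_shock p Vm Um Vp Up s \<longleftrightarrow>
     s * (Vp - Vm) = Um - Up \<and>
     s * (Up - Um) = p Vp - p Vm \<and>
     lambda2 p Vp < s \<and> s < lambda2 p Vm \<and> s > lambda1 p Vm"

definition traveling_profile ::
    "(real \<Rightarrow> real) \<Rightarrow> (real \<Rightarrow> real) \<Rightarrow> (real \<Rightarrow> real) \<Rightarrow> real \<Rightarrow> real \<Rightarrow> real \<Rightarrow> real \<Rightarrow> real
      \<Rightarrow> (real \<Rightarrow> real) \<Rightarrow> (real \<Rightarrow> real) \<Rightarrow> bool" where
  "traveling_profile p \<mu> \<kappa> Vm Um Vp Up s V U \<longleftrightarrow>
     smooth_on UNIV V \<and> smooth_on UNIV U \<and> (\<forall>y. V y > 0) \<and>
     (\<forall>y. - s * deriv V y - deriv U y = 0) \<and>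
     (\<forall>y. - s * deriv U y + deriv (\<lambda>z. p (V z)) y =
          deriv (\<lambda>z. \<mu> (V z) / V z * deriv U z) y
        - deriv (\<lambda>z. \<kappa> (V z) * deriv (deriv V) z
                     + 1/2 * deriv \<kappa> (V z) * (deriv V z)\<^sup>2) y) \<and>
     (V \<longlongrightarrow> Vm) at_bot \<and> (V \<longlongrightarrow> Vp) at_top \<and>
     (U \<longlongrightarrow> Um) at_bot \<and> (U \<longlongrightarrow> Up) at_top"

definition profile_f :: "(real \<Rightarrow> real) \<Rightarrow> real \<Rightarrow> real \<Rightarrow> real \<Rightarrow> real" where
  "profile_f p s Vp v = p v + s\<^sup>2 * v - (s\<^sup>2 * Vp + p Vp)"

(* The first-order system V' = Q, Q' = ... satisfied by (V, V'); x$1 is V and x$2 is Q. *)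
definition profile_field ::
    "(real \<Rightarrow> real) \<Rightarrow> (real \<Rightarrow> real) \<Rightarrow> (real \<Rightarrow> real) \<Rightarrow> real \<Rightarrow> real \<Rightarrow> real^2 \<Rightarrow> real^2" where
  "profile_field p \<mu> \<kappa> s Vp x =
     vector [x$2,
       - (1 / \<kappa> (x$1)) * (profile_f p s Vp (x$1) + s * (\<mu> (x$1) / x$1) * x$2
                           + 1/2 * deriv \<kappa> (x$1) * (x$2)\<^sup>2)]"

definition heteroclinic_orbit ::
    "(real^2 \<Rightarrow> real^2) \<Rightarrow> real^2 \<Rightarrow> real^2 \<Rightarrow> (real \<Rightarrow> real^2) \<Rightarrow> bool" where
  "heteroclinic_orbit F a b X \<longleftrightarrow>
     a \<noteq> b \<and> F a = 0 \<and> F b = 0 \<and>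
     (\<forall>y. (X has_vector_derivative F (X y)) (at y)) \<and>
     (X \<longlongrightarrow> a) at_bot \<and> (X \<longlongrightarrow> b) at_top"

definition complex_eigenvalue :: "real^2^2 \<Rightarrow> complex \<Rightarrow> bool" where
  "complex_eigenvalue A l \<longleftrightarrow>
     (\<exists>w::complex^2. w \<noteq> 0 \<and> map_matrix of_real A *v w = l *s w)"

definition focus :: "(real^2 \<Rightarrow> real^2) \<Rightarrow> real^2 \<Rightarrow> bool" where
  "focus F a \<longleftrightarrow>
     F a = 0 \<and> F differentiable (at a) \<and>
     (\<forall>l. complex_eigenvalue (jacobian F (at a)) l \<longrightarrow> Im l \<noteq> 0 \<and> Re l \<noteq> 0)"

(* X - a has a continuous polar representation for large y whose radius tends to 0 while the
   angle is unbounded in one direction: by continuity of \<theta>, tending to at_infinity means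
   tending to +infinity or to -infinity. *)
definition spirals_into :: "(real \<Rightarrow> real^2) \<Rightarrow> real^2 \<Rightarrow> bool" where
  "spirals_into X a \<longleftrightarrow>
     (\<exists>y0 r \<theta>. continuous_on {y0..} r \<and> continuous_on {y0..} \<theta> \<and>
        (\<forall>y\<ge>y0. r y > 0 \<and> X y - a = r y *\<^sub>R vector [cos (\<theta> y), sin (\<theta> y)]) \<and>
        (r \<longlongrightarrow> 0) at_top \<and> filterlim \<theta> at_infinity at_top)"

definition oscillating ::
    "(real \<Rightarrow> real) \<Rightarrow> (real \<Rightarrow> real) \<Rightarrow> (real \<Rightarrow> real) \<Rightarrow> real \<Rightarrow> real \<Rightarrow> real
      \<Rightarrow> (real \<Rightarrow> real) \<Rightarrow> bool" where
  "oscillating p \<mu> \<kappa> Vm Vp s V \<longleftrightarrow>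
     (let F = profile_field p \<mu> \<kappa> s Vp; X = (\<lambda>y. vector [V y, deriv V y]) in
       heteroclinic_orbit F (vector [Vm, 0]) (vector [Vp, 0]) X \<and>
       focus F (vector [Vp, 0]) \<and>
       spirals_into X (vector [Vp, 0]) \<and>
       \<not> mono V \<and> \<not> antimono V)"

definition eta :: "(real \<Rightarrow> real) \<Rightarrow> (real \<Rightarrow> real) \<Rightarrow> real \<Rightarrow> real" where
  "eta \<mu> \<kappa> v = \<mu> v / sqrt (\<kappa> v)"

end

theory Submission
  imports Defs
begin

text \<open>One integration of the momentum equation gives
  \<open>\<kappa> V'' + \<kappa>' V'\<^sup>2 / 2 + s (\<mu> / V) V' + f V = C\<close>. In the variable \<open>W = \<Phi> V\<close> with \<open>\<Phi>' = sqrt \<kappa>\<close> the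
  quadratic term disappears and, for \<open>C = 0\<close>, one is left with a Lienard equation
  \<open>W'' + a W * W' + g W = 0\<close> with positive damping \<open>a\<close>; \<open>C = 0\<close> because \<open>W\<close> converges.

  Convexity of \<open>p\<close> and the Lax conditions make \<open>g\<close> negative exactly between its two zeros, the
  images of \<open>Vm\<close> and \<open>Vp\<close>. An orbit leaving the saddle to the right is obtained as a limit of
  orbits that start at the saddle with a small positive speed. Its energy stays below the level of
  the saddle, so it is trapped in the potential well and dissipation drives it to the bottom of the
  well. For uniqueness, compare the speeds of two such orbits as functions of the position.

  In the underdamped case the linearisation at \<open>(Vp, 0)\<close> has non-real eigenvalues, and the polar
  angle of \<open>(V - Vp, V')\<close> eventually decreases at a uniform rate.\<close>

section \<open>Globally Lipschitz differential equations\<close>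

text \<open>The data live on \<open>v > 0\<close> only and are merely locally Lipschitz there, so no
  global solutions are available a priori. The coefficients are therefore frozen outside a compact
  interval \<open>[\<alpha>, \<beta>]\<close>, and the constructed profile never notices: strict
  energy loss keeps it to the right of the saddle \<open>Vm\<close>, and \<open>\<beta>\<close> lies
  so far out that the potential there exceeds its value at \<open>Vm\<close>. For a given profile
  the interval is instead adapted to its range, which stays away from 0 because both limits are
  positive. Even with frozen coefficients the product \<open>a W * w\<close> need not be Lipschitz;
  replacing the speed \<open>w\<close> by \<open>w + A W\<close>, with \<open>A\<close> an
  antiderivative of \<open>a\<close>, leaves a field for which bounded damping suffices. Existence
  and uniqueness of the orbit leaving the saddle are both obtained without linearising there: only
  the sign of \<open>g\<close> to its right enters, and no rate of decay at infinity is ever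
  used.\<close>

lemma antiderivative_exists:
  fixes h :: "real \<Rightarrow> 'a::euclidean_space"
  assumes "continuous_on UNIV h"
  shows "\<exists>H. H x0 = 0 \<and> (\<forall>t. (H has_vector_derivative h t) (at t))"
proof -
  have "isCont h x" for x
    using assms by (simp add: continuous_on_eq_continuous_at)
  then obtain F where F: "\<And>t. (F has_vector_derivative h t) (at t)"
    using einterval_antiderivative[of "-\<infinity>" "\<infinity>" h] by auto
  show ?thesis
    by (rule exI[of _ "\<lambda>t. F t - F x0"]) (auto intro!: derivative_eq_intros F)
qed

lemma real_antiderivative_exists:
  fixes h :: "real \<Rightarrow> real"
  assumes "continuous_on UNIV h"
  shows "\<exists>H. H x0 = 0 \<and> (\<forall>t. (H has_real_derivative h t) (at t))"
  using antiderivative_exists[OF assms, of x0]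
  by (simp add: has_real_derivative_iff_has_vector_derivative)

text \<open>Integrating \<open>exp (K * \<bar>t\<bar>)\<close> gains a factor \<open>1 / K\<close>.
  With \<open>K\<close> twice the Lipschitz constant this gain becomes the contraction factor
  \<open>1/2\<close> of the Picard map.\<close>

lemma norm_antiderivative_exp_le:
  fixes H :: "real \<Rightarrow> 'a::euclidean_space"
  assumes H: "H 0 = 0" "\<And>t. (H has_vector_derivative h t) (at t)"
    and h: "\<And>t. norm (h t) \<le> C * exp (K * \<bar>t\<bar>)" and "K > 0"
  shows "norm (H t) \<le> C / K * exp (K * \<bar>t\<bar>)"
proof -
  have C: "C \<ge> 0"
    using order_trans[OF norm_ge_zero h[of 0]] by simp
  \<comment> \<open>Stated for arbitrary \<open>J\<close> and \<open>j\<close>, so that negative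
    times follow by applying it to the reflected function \<open>H (- t)\<close>.\<close>
  have pos: "norm (J t) \<le> C / K * exp (K * t)"
    if J: "J 0 = 0" "\<And>t. (J has_vector_derivative j t) (at t)"
      and j: "\<And>t. t \<ge> 0 \<Longrightarrow> norm (j t) \<le> C * exp (K * t)" and "t > 0" for J j and t :: real
  proof -
    have "norm (J t - J 0) \<le> C / K * exp (K * t) - C / K * exp (K * 0)"
    proof (rule differentiable_bound_general[where f' = j and \<phi>' = "\<lambda>t. C * exp (K * t)"])
      show "continuous_on {0..t} J"
        using J(2) by (intro continuous_at_imp_continuous_on) (auto intro: has_vector_derivative_continuous)
      show "((\<lambda>t. C / K * exp (K * t)) has_vector_derivative C * exp (K * x)) (at x)" for x
        using \<open>K > 0\<close> by (auto intro!: derivative_eq_intros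
            simp flip: has_real_derivative_iff_has_vector_derivative)
    qed (use that \<open>K > 0\<close> in \<open>auto intro!: continuous_intros\<close>)
    then show ?thesis
      using J(1) C \<open>K > 0\<close> by simp (smt (verit) divide_nonneg_pos)
  qed
  consider "t = 0" | "t > 0" | "t < 0"
    by linarith
  then show ?thesis
  proof cases
    case 1
    then show ?thesis
      using H(1) C \<open>K > 0\<close> by simp
  next
    case 2
    have "norm (h t) \<le> C * exp (K * t)" if "t \<ge> 0" for t
      using h[of t] that by simp
    then show ?thesis
      using pos[OF H] 2 by simp
  next
    case 3
    have "((\<lambda>t. H (- t)) has_vector_derivative - h (- t)) (at t)" for t
    proof -
      have "((\<lambda>t. - t) has_vector_derivative - 1) (at t)"
        by (auto intro!: derivative_eq_intros simp flip: has_real_derivative_iff_has_vector_derivative)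
      then show ?thesis
        using vector_diff_chain_at[of uminus "-1" t H "h (- t)"] H(2) by (simp add: o_def)
    qed
    moreover have "norm (- h (- t)) \<le> C * exp (K * t)" if "t \<ge> 0" for t
      using h[of "-t"] that by simp
    ultimately show ?thesis
      using pos[of "\<lambda>t. H (- t)" "\<lambda>t. - h (- t)" "- t"] 3 H(1) by simp
  qed
qed

text \<open>Picard iteration contracts for the norm weighted by \<open>exp (- 2 * L * \<bar>t\<bar>)\<close>, which gives
  the solution on the whole line at once.\<close>

lemma lipschitz_ode_exists:
  fixes F :: "'a::euclidean_space \<Rightarrow> 'a"
  assumes lip: "\<And>x y. norm (F x - F y) \<le> L * norm (x - y)" and "L > 0"
  shows "\<exists>X. X 0 = x0 \<and> (\<forall>t. (X has_vector_derivative F (X t)) (at t))"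
proof -
  define K where "K = 2 * L"
  have K: "K > 0"
    using \<open>L > 0\<close> by (simp add: K_def)
  have contF: "continuous_on UNIV F"
    by (rule lipschitz_on_continuous_on[of L])
       (use lip \<open>L > 0\<close> in \<open>auto simp: lipschitz_on_def dist_norm\<close>)
  \<comment> \<open>A bounded continuous \<open>\<phi>\<close> encodes a path through its weighted
    distance from \<open>x0\<close>; completeness of the space of such \<open>\<phi>\<close> thus
    covers paths of exponential growth.\<close>
  define path where "path \<phi> t = x0 + exp (K * \<bar>t\<bar>) *\<^sub>R apply_bcontfun \<phi> t" for \<phi> :: "real \<Rightarrow>\<^sub>C 'a" and t
  have "\<exists>H. H 0 = 0 \<and> (\<forall>t. (H has_vector_derivative F (path \<phi> t)) (at t))" for \<phi>
    unfolding path_def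
    by (intro antiderivative_exists continuous_on_compose2[OF contF] continuous_intros) auto
  then obtain H where H0: "\<And>\<phi>. H \<phi> 0 = 0"
      and H: "\<And>\<phi> t. (H \<phi> has_vector_derivative F (path \<phi> t)) (at t)"
    by metis
  have H_le: "norm (H \<phi> t) \<le> (norm (F x0) + L * norm \<phi>) / K * exp (K * \<bar>t\<bar>)" for \<phi> t
  proof (rule norm_antiderivative_exp_le[OF H0 H _ K])
    fix t
    have "norm (F (path \<phi> t)) \<le> norm (F x0) + norm (F (path \<phi> t) - F x0)"
      by (rule norm_triangle_sub)
    also have "norm (F (path \<phi> t) - F x0) \<le> L * norm (path \<phi> t - x0)"
      by (rule lip)
    also have "norm (path \<phi> t - x0) \<le> exp (K * \<bar>t\<bar>) * norm \<phi>"
      by (simp add: path_def norm_bounded)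
    also have "norm (F x0) + L * (exp (K * \<bar>t\<bar>) * norm \<phi>)
        \<le> norm (F x0) * exp (K * \<bar>t\<bar>) + L * (exp (K * \<bar>t\<bar>) * norm \<phi>)"
      using K by (simp add: mult_le_cancel_left1)
    finally show "norm (F (path \<phi> t)) \<le> (norm (F x0) + L * norm \<phi>) * exp (K * \<bar>t\<bar>)"
      using \<open>L > 0\<close> by (simp add: algebra_simps)
  qed
  define op where "op \<phi> = Bcontfun (\<lambda>t. exp (- (K * \<bar>t\<bar>)) *\<^sub>R H \<phi> t)" for \<phi>
  have op: "apply_bcontfun (op \<phi>) t = exp (- (K * \<bar>t\<bar>)) *\<^sub>R H \<phi> t" for \<phi> t
  proof -
    have "continuous_on UNIV (H \<phi>)"
      using H by (intro continuous_at_imp_continuous_on) (auto intro: has_vector_derivative_continuous)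
    then have "(\<lambda>t. exp (- (K * \<bar>t\<bar>)) *\<^sub>R H \<phi> t) \<in> bcontfun"
    proof (intro bcontfun_normI continuous_intros)
      fix t
      have "exp (- (K * \<bar>t\<bar>)) * norm (H \<phi> t)
          \<le> exp (- (K * \<bar>t\<bar>)) * ((norm (F x0) + L * norm \<phi>) / K * exp (K * \<bar>t\<bar>))"
        by (intro mult_left_mono H_le) simp
      also have "\<dots> = (norm (F x0) + L * norm \<phi>) / K"
        by (simp add: exp_minus)
      finally show "norm (exp (- (K * \<bar>t\<bar>)) *\<^sub>R H \<phi> t) \<le> (norm (F x0) + L * norm \<phi>) / K"
        by simp
    qed
    then show ?thesis
      by (simp add: op_def Bcontfun_inverse)
  qed
  have contr: "dist (op \<phi>) (op \<psi>) \<le> 1/2 * dist \<phi> \<psi>" for \<phi> \<psi>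
  proof (rule dist_bound)
    fix t
    have "norm (H \<phi> t - H \<psi> t) \<le> (L * dist \<phi> \<psi>) / K * exp (K * \<bar>t\<bar>)"
    proof (rule norm_antiderivative_exp_le[OF _ _ _ K, where h = "\<lambda>t. F (path \<phi> t) - F (path \<psi> t)"])
      show "((\<lambda>t. H \<phi> t - H \<psi> t) has_vector_derivative F (path \<phi> t) - F (path \<psi> t)) (at t)" for t
        by (intro derivative_intros H)
      fix t
      have "norm (F (path \<phi> t) - F (path \<psi> t)) \<le> L * norm (path \<phi> t - path \<psi> t)"
        by (rule lip)
      also have "norm (path \<phi> t - path \<psi> t) = exp (K * \<bar>t\<bar>) * dist (apply_bcontfun \<phi> t) (apply_bcontfun \<psi> t)"
        by (simp add: path_def dist_norm flip: scaleR_diff_right)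
      also have "L * \<dots> \<le> L * (exp (K * \<bar>t\<bar>) * dist \<phi> \<psi>)"
        using \<open>L > 0\<close> by (intro mult_left_mono dist_bounded) auto
      finally show "norm (F (path \<phi> t) - F (path \<psi> t)) \<le> L * dist \<phi> \<psi> * exp (K * \<bar>t\<bar>)"
        by (simp add: mult_ac)
    qed (simp add: H0)
    then have "exp (- (K * \<bar>t\<bar>)) * norm (H \<phi> t - H \<psi> t)
        \<le> exp (- (K * \<bar>t\<bar>)) * ((L * dist \<phi> \<psi>) / K * exp (K * \<bar>t\<bar>))"
      by (rule mult_left_mono) simp
    also have "\<dots> = 1/2 * dist \<phi> \<psi>"
      using \<open>L > 0\<close> by (simp add: K_def exp_minus field_simps)
    finally show "dist (apply_bcontfun (op \<phi>) t) (apply_bcontfun (op \<psi>) t) \<le> 1/2 * dist \<phi> \<psi>"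
      by (simp add: op dist_norm flip: scaleR_diff_right)
  qed
  then obtain \<phi> where \<phi>: "op \<phi> = \<phi>"
    using banach_fix_type[of "1/2" op] by auto
  have "path \<phi> t = x0 + H \<phi> t" for t
    using op[of \<phi> t] by (simp add: path_def \<phi> exp_minus)
  moreover from this have "path \<phi> = (\<lambda>t. x0 + H \<phi> t)"
    by (simp add: fun_eq_iff)
  moreover have "((\<lambda>t. x0 + H \<phi> t) has_vector_derivative F (path \<phi> t)) (at t)" for t
    using H by (auto intro!: derivative_eq_intros)
  ultimately show ?thesis
    using H0 by (intro exI[of _ "path \<phi>"]) auto
qed

text \<open>Gronwall in both time directions, run on the squared norm \<open>u\<close>, which unlike
  the norm is differentiable wherever the solutions meet. The weights
  \<open>exp (- (2 * L * t))\<close> after \<open>r\<close> and \<open>exp (2 * L * t)\<close>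
  before it make \<open>u\<close> monotone.\<close>

lemma lipschitz_ode_dependence:
  fixes F :: "'a::euclidean_space \<Rightarrow> 'a"
  assumes lip: "\<And>x y. norm (F x - F y) \<le> L * norm (x - y)"
    and X: "\<And>t. (X has_vector_derivative F (X t)) (at t)"
    and Y: "\<And>t. (Y has_vector_derivative F (Y t)) (at t)"
  shows "norm (X t - Y t) \<le> exp (L * \<bar>t - r\<bar>) * norm (X r - Y r)"
proof -
  define D where "D t = X t - Y t" for t
  define u where "u t = D t \<bullet> D t" for t
  have D: "(D has_vector_derivative F (X t) - F (Y t)) (at t)" for t
    unfolding D_def[abs_def] by (intro derivative_intros X Y)
  have u: "(u has_real_derivative 2 * (D t \<bullet> (F (X t) - F (Y t)))) (at t)" for t
    unfolding u_def[abs_def] has_field_derivative_def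
    by (rule has_derivative_eq_rhs[OF has_derivative_inner[OF D[unfolded has_vector_derivative_def]
            D[unfolded has_vector_derivative_def]]])
       (auto simp: fun_eq_iff inner_commute)
  have u': "\<bar>D t \<bullet> (F (X t) - F (Y t))\<bar> \<le> L * u t" for t
  proof -
    have "\<bar>D t \<bullet> (F (X t) - F (Y t))\<bar> \<le> norm (D t) * norm (F (X t) - F (Y t))"
      by (rule Cauchy_Schwarz_ineq2)
    also have "\<dots> \<le> norm (D t) * (L * norm (D t))"
      unfolding D_def by (intro mult_left_mono lip) simp
    finally show ?thesis
      by (simp add: u_def power2_norm_eq_inner[symmetric] power2_eq_square mult_ac)
  qed
  have "u t \<le> exp (2 * L * \<bar>t - r\<bar>) * u r"
  proof (cases "r \<le> t")
    case True
    have "exp (- (2 * L * t)) * u t \<le> exp (- (2 * L * r)) * u r"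
    proof (rule DERIV_nonpos_imp_nonincreasing[OF True])
      fix x
      have "((\<lambda>t. exp (- (2 * L * t)) * u t) has_real_derivative
          exp (- (2 * L * x)) * (2 * (D x \<bullet> (F (X x) - F (Y x)) - L * u x))) (at x)"
        by (auto intro!: derivative_eq_intros u simp: algebra_simps)
      moreover have "exp (- (2 * L * x)) * (2 * (D x \<bullet> (F (X x) - F (Y x)) - L * u x)) \<le> 0"
        using u'[of x] by (intro mult_nonneg_nonpos) auto
      ultimately show "\<exists>y. ((\<lambda>t. exp (- (2 * L * t)) * u t) has_real_derivative y) (at x) \<and> y \<le> 0"
        by blast
    qed
    then show ?thesis
      using True by (simp add: exp_minus field_simps exp_diff)
  next
    case False
    then have "t \<le> r"
      by simp
    have "exp (2 * L * t) * u t \<le> exp (2 * L * r) * u r"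
    proof (rule DERIV_nonneg_imp_nondecreasing[OF \<open>t \<le> r\<close>])
      fix x
      have "((\<lambda>t. exp (2 * L * t) * u t) has_real_derivative
          exp (2 * L * x) * (2 * (D x \<bullet> (F (X x) - F (Y x)) + L * u x))) (at x)"
        by (auto intro!: derivative_eq_intros u simp: algebra_simps)
      moreover have "exp (2 * L * x) * (2 * (D x \<bullet> (F (X x) - F (Y x)) + L * u x)) \<ge> 0"
        using u'[of x] by (intro mult_nonneg_nonneg) auto
      ultimately show "\<exists>y. ((\<lambda>t. exp (2 * L * t) * u t) has_real_derivative y) (at x) \<and> 0 \<le> y"
        by blast
    qed
    then show ?thesis
      using \<open>t \<le> r\<close> by (simp add: field_simps exp_diff)
  qed
  also have "\<dots> = (exp (L * \<bar>t - r\<bar>) * norm (X r - Y r))\<^sup>2"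
    using exp_double[of "L * \<bar>t - r\<bar>"]
    by (simp add: u_def D_def power_mult_distrib power2_norm_eq_inner mult.assoc)
  finally have "(norm (X t - Y t))\<^sup>2 \<le> (exp (L * \<bar>t - r\<bar>) * norm (X r - Y r))\<^sup>2"
    by (simp add: u_def D_def power2_norm_eq_inner)
  then show ?thesis
    by (rule power2_le_imp_le) simp
qed

section \<open>The Lienard equation\<close>

lemma filterlim_shift_at_top: "filterlim (\<lambda>t::real. t + d) at_top at_top"
  using filterlim_tendsto_add_at_top[OF tendsto_const[of d] filterlim_ident] by (simp add: add.commute)

lemma bounded_mono_tendsto:
  fixes W :: "real \<Rightarrow> real"
  assumes mono: "\<And>x y. t0 \<le> x \<Longrightarrow> x \<le> y \<Longrightarrow> W x \<le> W y" and le: "\<And>x. t0 \<le> x \<Longrightarrow> W x \<le> c"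
  shows "\<exists>\<omega>. (W \<longlongrightarrow> \<omega>) at_top \<and> \<omega> \<le> c \<and> (\<forall>x\<ge>t0. W x \<le> \<omega>)"
proof (intro exI conjI)
  define \<omega> where "\<omega> = Sup (W ` {t0..})"
  have bdd: "bdd_above (W ` {t0..})"
    using le by (auto intro!: bdd_aboveI)
  show up: "\<forall>x\<ge>t0. W x \<le> \<omega>"
    unfolding \<omega>_def using bdd by (auto intro!: cSup_upper)
  show "\<omega> \<le> c"
    unfolding \<omega>_def by (intro cSup_least) (auto intro: le)
  show "(W \<longlongrightarrow> \<omega>) at_top"
  proof (rule order_tendstoI)
    fix y assume "y < \<omega>"
    then obtain x where x: "x \<ge> t0" "y < W x"
      unfolding \<omega>_def using less_cSup_iff[OF _ bdd] by auto
    then show "eventually (\<lambda>t. y < W t) at_top"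
      using mono[OF x(1)] by (intro eventually_at_top_linorderI[of x]) fastforce
  next
    fix y assume "\<omega> < y"
    then show "eventually (\<lambda>t. W t < y) at_top"
      using up by (intro eventually_at_top_linorderI[of t0]) fastforce
  qed
qed

text \<open>A convergent function forces the derivatives appearing here to vanish in the limit, by
  the mean value theorem on unit intervals.\<close>

lemma second_order_limit:
  fixes W Z B h :: "real \<Rightarrow> real"
  assumes W: "\<And>t. (W has_real_derivative Z t - B t) (at t)"
    and Z: "\<And>t. (Z has_real_derivative h t) (at t)"
    and lims: "(W \<longlongrightarrow> \<omega>) at_top" "(B \<longlongrightarrow> b) at_top" "(h \<longlongrightarrow> l) at_top"
  shows "l = 0" "(Z \<longlongrightarrow> b) at_top"
proof -
  \<comment> \<open>The mean value theorem yields sample times \<open>\<xi> t\<close> at which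
    \<open>Z - B\<close> equals a unit increment of the convergent \<open>W\<close>, so
    \<open>Z\<close> tends to \<open>b\<close> along them.\<close>
  have "\<exists>\<xi>. t < \<xi> \<and> \<xi> < t + 1 \<and> W (t + 1) - W t = Z \<xi> - B \<xi>" for t
    using MVT2[of t "t + 1" W "\<lambda>t. Z t - B t"] W by auto
  then obtain \<xi> where \<xi>: "\<And>t. t < \<xi> t" "\<And>t. \<xi> t < t + 1" "\<And>t. W (t + 1) - W t = Z (\<xi> t) - B (\<xi> t)"
    by metis
  have \<xi>_top: "filterlim \<xi> at_top at_top"
    by (rule filterlim_at_top_mono[OF filterlim_ident]) (use \<xi>(1) in \<open>auto intro!: always_eventually less_imp_le\<close>)
  have "((\<lambda>t. (W (t + 1) - W t) + B (\<xi> t)) \<longlongrightarrow> (\<omega> - \<omega>) + b) at_top"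
    by (intro tendsto_intros lims filterlim_compose[OF lims(1) filterlim_shift_at_top] filterlim_compose[OF lims(2) \<xi>_top])
  then have Z\<xi>: "((\<lambda>t. Z (\<xi> t)) \<longlongrightarrow> b) at_top"
    by (simp add: \<xi>(3))
  \<comment> \<open>The shift by 2 matters: \<open>\<xi> t\<close> and \<open>\<xi> (t + 2)\<close>
    are at least 1 apart, so the increment of \<open>Z\<close> between them dominates
    \<open>h\<close> at an intermediate time.\<close>
  have "\<exists>\<eta>. t < \<eta> \<and> \<bar>h \<eta>\<bar> \<le> \<bar>Z (\<xi> (t + 2)) - Z (\<xi> t)\<bar>" for t
  proof -
    have gap: "\<xi> t + 1 \<le> \<xi> (t + 2)"
      using \<xi>(2)[of t] \<xi>(1)[of "t + 2"] by linarith
    then obtain \<eta> where \<eta>: "\<xi> t < \<eta>" "Z (\<xi> (t + 2)) - Z (\<xi> t) = (\<xi> (t + 2) - \<xi> t) * h \<eta>"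
      using MVT2[of "\<xi> t" "\<xi> (t + 2)" Z h] Z by auto
    have "1 * \<bar>h \<eta>\<bar> \<le> (\<xi> (t + 2) - \<xi> t) * \<bar>h \<eta>\<bar>"
      using gap by (intro mult_right_mono) auto
    then have "\<bar>h \<eta>\<bar> \<le> \<bar>Z (\<xi> (t + 2)) - Z (\<xi> t)\<bar>"
      using gap by (simp add: \<eta>(2) abs_mult)
    then show ?thesis
      using \<eta>(1) \<xi>(1)[of t] by (intro exI[of _ \<eta>]) auto
  qed
  then obtain \<eta> where \<eta>: "\<And>t. t < \<eta> t" "\<And>t. \<bar>h (\<eta> t)\<bar> \<le> \<bar>Z (\<xi> (t + 2)) - Z (\<xi> t)\<bar>"
    by metis
  have \<eta>_top: "filterlim \<eta> at_top at_top"
    by (rule filterlim_at_top_mono[OF filterlim_ident]) (use \<eta>(1) in \<open>auto intro!: always_eventually less_imp_le\<close>)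
  have "((\<lambda>t. \<bar>Z (\<xi> (t + 2)) - Z (\<xi> t)\<bar>) \<longlongrightarrow> \<bar>b - b\<bar>) at_top"
    by (intro tendsto_intros Z\<xi> filterlim_compose[OF Z\<xi> filterlim_shift_at_top])
  then have "((\<lambda>t. h (\<eta> t)) \<longlongrightarrow> 0) at_top"
    by (intro Lim_null_comparison[where f = "\<lambda>t. h (\<eta> t)"]) (use \<eta>(2) in \<open>auto intro!: always_eventually\<close>)
  then show "l = 0"
    using filterlim_compose[OF lims(3) \<eta>_top] by (intro tendsto_unique[of at_top]) auto
  \<comment> \<open>Between \<open>t\<close> and its sample time \<open>Z\<close> changes by at most
    one value of \<open>\<bar>h\<bar>\<close>, which is now known to vanish in the limit.\<close>
  have "\<exists>\<zeta>. t < \<zeta> \<and> \<bar>Z (\<xi> t) - Z t\<bar> \<le> \<bar>h \<zeta>\<bar>" for t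
  proof -
    obtain \<zeta> where \<zeta>: "t < \<zeta>" "Z (\<xi> t) - Z t = (\<xi> t - t) * h \<zeta>"
      using MVT2[of t "\<xi> t" Z h] Z \<xi>(1) by auto
    have "(\<xi> t - t) * \<bar>h \<zeta>\<bar> \<le> 1 * \<bar>h \<zeta>\<bar>"
      using \<xi>(2)[of t] by (intro mult_right_mono) auto
    then show ?thesis
      using \<zeta> \<xi>(1)[of t] by (intro exI[of _ \<zeta>]) (auto simp: abs_mult)
  qed
  then obtain \<zeta> where \<zeta>: "\<And>t. t < \<zeta> t" "\<And>t. \<bar>Z (\<xi> t) - Z t\<bar> \<le> \<bar>h (\<zeta> t)\<bar>"
    by metis
  have \<zeta>_top: "filterlim \<zeta> at_top at_top"
    by (rule filterlim_at_top_mono[OF filterlim_ident]) (use \<zeta>(1) in \<open>auto intro!: always_eventually less_imp_le\<close>)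
  have "((\<lambda>t. \<bar>h (\<zeta> t)\<bar>) \<longlongrightarrow> \<bar>0\<bar>) at_top"
    using filterlim_compose[OF lims(3) \<zeta>_top] \<open>l = 0\<close> by (intro tendsto_rabs) simp
  then have "((\<lambda>t. Z (\<xi> t) - Z t) \<longlongrightarrow> 0) at_top"
    by (intro Lim_null_comparison[where f = "\<lambda>t. Z (\<xi> t) - Z t"]) (use \<zeta>(2) in \<open>auto intro!: always_eventually\<close>)
  from tendsto_diff[OF Z\<xi> this] show "(Z \<longlongrightarrow> b) at_top"
    by simp
qed

lemma has_real_derivative_mirror:
  assumes "(f has_real_derivative D) (at (- t))"
  shows "((\<lambda>x. f (- x)) has_real_derivative - D) (at (t::real))"
  using DERIV_mirror assms by blast

lemma second_order_limit_at_bot: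
  fixes W Z B h :: "real \<Rightarrow> real"
  assumes W: "\<And>t. (W has_real_derivative Z t - B t) (at t)"
    and Z: "\<And>t. (Z has_real_derivative h t) (at t)"
    and lims: "(W \<longlongrightarrow> \<omega>) at_bot" "(B \<longlongrightarrow> b) at_bot" "(h \<longlongrightarrow> l) at_bot"
  shows "l = 0" "(Z \<longlongrightarrow> b) at_bot"
proof -
  have W': "((\<lambda>t. W (- t)) has_real_derivative (- Z (- t)) - (- B (- t))) (at t)" for t
    using has_real_derivative_mirror[OF W] by simp
  have Z': "((\<lambda>t. - Z (- t)) has_real_derivative h (- t)) (at t)" for t
    using DERIV_minus[OF has_real_derivative_mirror[OF Z]] by simp
  have lims': "((\<lambda>t. W (- t)) \<longlongrightarrow> \<omega>) at_top" "((\<lambda>t. - B (- t)) \<longlongrightarrow> - b) at_top"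
      "((\<lambda>t. h (- t)) \<longlongrightarrow> l) at_top"
    using lims by (auto simp: filterlim_at_bot_mirror tendsto_minus)
  note * = second_order_limit[OF W' Z' lims']
  show "l = 0"
    by (rule *)
  from tendsto_minus[OF *(2)] show "(Z \<longlongrightarrow> b) at_bot"
    by (simp add: filterlim_at_bot_mirror)
qed

text \<open>\<open>m\<close> is the saddle, \<open>q\<close> the bottom of the potential well and \<open>R\<close> a point on its far wall
  above the level of the saddle.\<close>

locale lienard =
  fixes a g A G :: "real \<Rightarrow> real" and L a0 m q R :: real
  assumes A: "\<And>x. (A has_real_derivative a x) (at x)"
    and G: "\<And>x. (G has_real_derivative g x) (at x)"
    and A_m: "A m = 0"
    and a0: "0 < a0" "\<And>x. a0 \<le> a x"
    and a_le: "\<And>x. a x \<le> L"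
    and g_lipschitz: "\<And>x y. \<bar>g x - g y\<bar> \<le> L * \<bar>x - y\<bar>"
    and m_less_q: "m < q"
    and g_m: "g m = 0" and g_q: "g q = 0"
    and g_neg: "\<And>x. m < x \<Longrightarrow> x < q \<Longrightarrow> g x < 0"
    and g_pos: "\<And>x. q < x \<Longrightarrow> g x > 0"
    and R: "q < R" "G m < G R"
begin

definition sol :: "(real \<Rightarrow> real) \<Rightarrow> (real \<Rightarrow> real) \<Rightarrow> bool" where
  "sol W w \<longleftrightarrow> (\<forall>t. (W has_real_derivative w t) (at t) \<and>
     (w has_real_derivative - a (W t) * w t - g (W t)) (at t))"

definition energy :: "(real \<Rightarrow> real) \<Rightarrow> (real \<Rightarrow> real) \<Rightarrow> real \<Rightarrow> real" where
  "energy W w t = (w t)\<^sup>2 / 2 + G (W t)"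

text \<open>Lipschitz constant of the field \<open>plane\<close>: the coordinate \<open>Z\<close>
  contributes 1, the functions \<open>A\<close> and \<open>g\<close> contribute \<open>L\<close>
  each.\<close>

abbreviation K :: real where "K \<equiv> 1 + 2 * L"

text \<open>In the Lienard plane, with \<open>Z = w + A W\<close>, the vector field is globally Lipschitz.\<close>

definition plane :: "real \<times> real \<Rightarrow> real \<times> real" where
  "plane x = (snd x - A (fst x), - g (fst x))"

lemma L_pos: "L > 0"
  using a0 a_le[of 0] by (meson less_le_trans order_trans)

lemma K_pos: "K > 0"
  using L_pos by simp

lemma A_lipschitz: "\<bar>A x - A y\<bar> \<le> L * \<bar>x - y\<bar>"
proof -
  have "\<bar>a x\<bar> \<le> L" for x
    using a0(1) a0(2)[of x] a_le[of x] by simp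
  then show ?thesis
    using field_differentiable_bound[of UNIV A a L x y] A by simp
qed

lemma plane_lipschitz: "norm (plane x - plane y) \<le> K * norm (x - y)"
proof -
  have f: "\<bar>fst x - fst y\<bar> \<le> norm (x - y)" and s: "\<bar>snd x - snd y\<bar> \<le> norm (x - y)"
    using norm_fst_le[of "fst (x - y)" "snd (x - y)"] norm_snd_le[of "snd (x - y)" "fst (x - y)"]
    unfolding prod.collapse by auto
  have "norm (plane x - plane y) \<le> \<bar>(snd x - snd y) - (A (fst x) - A (fst y))\<bar> + \<bar>g (fst x) - g (fst y)\<bar>"
    using norm_Pair_le[of "(snd x - snd y) - (A (fst x) - A (fst y))" "- (g (fst x) - g (fst y))"]
    by (simp add: plane_def algebra_simps)
  also have "\<dots> \<le> \<bar>snd x - snd y\<bar> + 2 * L * \<bar>fst x - fst y\<bar>"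
    using A_lipschitz[of "fst x" "fst y"] g_lipschitz[of "fst x" "fst y"] by linarith
  also have "\<dots> \<le> norm (x - y) + 2 * L * norm (x - y)"
    using f s L_pos by (intro add_mono mult_left_mono) auto
  finally show ?thesis
    by (simp add: algebra_simps)
qed

lemma A_cont: "isCont A x" and G_cont: "isCont G x"
  using A G by (auto intro: DERIV_isCont)

lemma g_cont: "continuous_on S g"
  by (rule lipschitz_on_continuous_on[of L])
     (use g_lipschitz L_pos in \<open>auto simp: lipschitz_on_def dist_real_def\<close>)

lemma solD:
  assumes "sol W w"
  shows "(W has_real_derivative w t) (at t)" "(w has_real_derivative - a (W t) * w t - g (W t)) (at t)"
    "isCont W t" "isCont w t" "continuous_on S W" "continuous_on S w"
  using assms unfolding sol_def
  by (auto intro: DERIV_isCont intro!: continuous_at_imp_continuous_on)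

lemma sol_Z:
  assumes "sol W w"
  shows "((\<lambda>t. w t + A (W t)) has_real_derivative - g (W t)) (at t)"
  using DERIV_add[OF solD(2)[OF assms] DERIV_chain2[OF A solD(1)[OF assms]]] by simp

lemma sol_plane:
  assumes "sol W w"
  shows "((\<lambda>t. (W t, w t + A (W t))) has_vector_derivative plane (W t, w t + A (W t))) (at t)"
  unfolding plane_def
  using solD(1)[OF assms, of t] sol_Z[OF assms, of t]
  by (auto intro!: has_vector_derivative_Pair simp: has_real_derivative_iff_has_vector_derivative)

lemma sol_exists: "\<exists>W w. sol W w \<and> W 0 = x \<and> w 0 = y"
proof -
  obtain X where X0: "X 0 = (x, y + A x)" and X: "\<And>t. (X has_vector_derivative plane (X t)) (at t)"
    using lipschitz_ode_exists[of plane K "(x, y + A x)"] plane_lipschitz K_pos by blast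
  define W where "W t = fst (X t)" for t
  define w where "w t = snd (X t) - A (W t)" for t
  have W: "(W has_real_derivative w t) (at t)" for t
    using bounded_linear.has_vector_derivative[OF bounded_linear_fst X[of t]]
    by (simp add: W_def[abs_def] w_def plane_def has_real_derivative_iff_has_vector_derivative)
  have "((\<lambda>t. snd (X t)) has_real_derivative - g (W t)) (at t)" for t
    using bounded_linear.has_vector_derivative[OF bounded_linear_snd X[of t]]
    by (simp add: W_def plane_def has_real_derivative_iff_has_vector_derivative)
  from DERIV_diff[OF this DERIV_chain2[OF A W]]
  have "(w has_real_derivative - a (W t) * w t - g (W t)) (at t)" for t
    unfolding w_def[abs_def] by (rule DERIV_cong) (simp add: w_def)
  then have "sol W w"
    using W by (simp add: sol_def)
  then show ?thesis
    using X0 by (intro exI[of _ W] exI[of _ w]) (simp add: W_def w_def)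
qed

lemma sol_dependence:
  assumes "sol W w" "sol V v"
  shows "norm (W t - V t, (w t + A (W t)) - (v t + A (V t)))
    \<le> exp (K * \<bar>t - r\<bar>) * norm (W r - V r, (w r + A (W r)) - (v r + A (V r)))"
  using lipschitz_ode_dependence[OF plane_lipschitz sol_plane[OF assms(1)] sol_plane[OF assms(2)]]
  by simp

lemma sol_unique:
  assumes "sol W w" "sol V v" "W r = V r" "w r = v r"
  shows "W t = V t" "w t = v t"
  using sol_dependence[OF assms(1,2), of t r] assms(3,4) by (auto simp: prod_eq_iff)

lemma sol_shift:
  assumes "sol W w"
  shows "sol (\<lambda>t. W (t + c)) (\<lambda>t. w (t + c))"
  using assms unfolding sol_def by (auto simp flip: DERIV_shift)

lemma sol_const: "g x = 0 \<Longrightarrow> sol (\<lambda>_. x) (\<lambda>_. 0)"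
  by (simp add: sol_def)

text \<open>\<open>second_order_limit\<close> with \<open>Z = w + A W\<close> and
  \<open>B = A W\<close>: convergence of the position alone forces an equilibrium and a vanishing
  speed, without any bound on \<open>w\<close>.\<close>

lemma sol_limit_at_top:
  assumes "sol W w" "(W \<longlongrightarrow> \<omega>) at_top"
  shows "g \<omega> = 0" "(w \<longlongrightarrow> 0) at_top"
proof -
  have A_lim: "((\<lambda>t. A (W t)) \<longlongrightarrow> A \<omega>) at_top"
    by (rule isCont_tendsto_compose[OF A_cont assms(2)])
  have "isCont g \<omega>"
    using g_cont[of UNIV] by (simp add: continuous_on_eq_continuous_at)
  then have "((\<lambda>t. - g (W t)) \<longlongrightarrow> - g \<omega>) at_top"
    by (intro tendsto_minus isCont_tendsto_compose[OF _ assms(2)])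
  note * = second_order_limit[OF _ sol_Z[OF assms(1)] assms(2) A_lim this]
  show "g \<omega> = 0"
    using * solD(1)[OF assms(1)] by simp
  have "((\<lambda>t. w t + A (W t)) \<longlongrightarrow> A \<omega>) at_top"
    using * solD(1)[OF assms(1)] by simp
  from tendsto_diff[OF this A_lim] show "(w \<longlongrightarrow> 0) at_top"
    by simp
qed

lemma sol_limit_at_bot:
  assumes "sol W w" "(W \<longlongrightarrow> \<omega>) at_bot"
  shows "g \<omega> = 0" "(w \<longlongrightarrow> 0) at_bot"
proof -
  have A_lim: "((\<lambda>t. A (W t)) \<longlongrightarrow> A \<omega>) at_bot"
    by (rule isCont_tendsto_compose[OF A_cont assms(2)])
  have "isCont g \<omega>"
    using g_cont[of UNIV] by (simp add: continuous_on_eq_continuous_at)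
  then have "((\<lambda>t. - g (W t)) \<longlongrightarrow> - g \<omega>) at_bot"
    by (intro tendsto_minus isCont_tendsto_compose[OF _ assms(2)])
  note * = second_order_limit_at_bot[OF _ sol_Z[OF assms(1)] assms(2) A_lim this]
  show "g \<omega> = 0"
    using * solD(1)[OF assms(1)] by simp
  have "((\<lambda>t. w t + A (W t)) \<longlongrightarrow> A \<omega>) at_bot"
    using * solD(1)[OF assms(1)] by simp
  from tendsto_diff[OF this A_lim] show "(w \<longlongrightarrow> 0) at_bot"
    by simp
qed

section \<open>Dissipation of energy and the motion between the two equilibria\<close>

lemma energy_deriv:
  assumes "sol W w"
  shows "(energy W w has_real_derivative - a (W t) * (w t)\<^sup>2) (at t)"
  unfolding energy_def[abs_def]
  by (auto intro!: derivative_eq_intros DERIV_chain2[OF G] solD[OF assms]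
      simp: field_simps power2_eq_square)

lemma energy_antimono:
  assumes "sol W w" "r \<le> t"
  shows "energy W w t \<le> energy W w r"
proof (rule DERIV_nonpos_imp_nonincreasing[OF assms(2)])
  fix x
  have "- a (W x) * (w x)\<^sup>2 \<le> 0"
    using a0(1) a0(2)[of "W x"] by simp
  then show "\<exists>y. (energy W w has_real_derivative y) (at x) \<and> y \<le> 0"
    using energy_deriv[OF assms(1)] by blast
qed

text \<open>At a first zero \<open>u\<close> of the speed the position would lie strictly between
  \<open>m\<close> and \<open>q\<close>, where \<open>g < 0\<close>. The acceleration is then
  positive, so the speed would already have been negative just before \<open>u\<close>.\<close>

lemma speed_stays_pos:
  assumes S: "sol W w" and w: "w r > 0" and "r \<le> t" and q: "\<And>x. r \<le> x \<Longrightarrow> x \<le> t \<Longrightarrow> W x < q"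
    and "m \<le> W r"
  shows "w t > 0"
proof (rule ccontr)
  assume "\<not> w t > 0"
  define S where "S = {r..t} \<inter> w -` {..0}"
  have "closed S"
    unfolding S_def by (intro continuous_closed_preimage solD(6)[OF S]) auto
  moreover have "t \<in> S"
    using \<open>\<not> w t > 0\<close> \<open>r \<le> t\<close> by (simp add: S_def)
  moreover have bdd: "bdd_below S"
    by (rule bdd_belowI[of _ r]) (simp add: S_def)
  ultimately have "Inf S \<in> S"
    by (intro closed_contains_Inf) auto
  define u where "u = Inf S"
  have u: "r \<le> u" "u \<le> t" "w u \<le> 0"
    using \<open>Inf S \<in> S\<close> by (auto simp: S_def u_def)
  have before: "w x > 0" if "r \<le> x" "x < u" for x
  proof (rule ccontr)
    assume "\<not> w x > 0"
    then have "x \<in> S"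
      using that u(2) by (simp add: S_def)
    then show False
      using cInf_lower[OF _ bdd] that(2) by (fastforce simp: u_def)
  qed
  have "r < u"
    using u w by (cases "r = u") auto
  obtain z where z: "r \<le> z" "z \<le> u" "w z = 0"
    using IVT2'[of w u 0 r] u w solD(6)[OF S] by auto
  then have "w u = 0"
    using before[of z] by (cases "z = u") auto
  have "W r < W u"
    by (rule DERIV_pos_imp_increasing_open[OF \<open>r < u\<close>])
       (use before solD(1)[OF S] solD(5)[OF S] in \<open>auto intro!: exI[of _ "w _"]\<close>)
  then have "g (W u) < 0"
    using \<open>m \<le> W r\<close> q[of u] u by (intro g_neg) auto
  then have "- a (W u) * w u - g (W u) > 0"
    using \<open>w u = 0\<close> by simp
  from DERIV_pos_inc_left[OF solD(2)[OF S] this] obtain d where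
    d: "d > 0" "\<And>h. 0 < h \<Longrightarrow> h < d \<Longrightarrow> w (u - h) < w u"
    by blast
  define h where "h = min (d / 2) ((u - r) / 2)"
  have "w (u - h) < 0"
    using d \<open>r < u\<close> \<open>w u = 0\<close> by (auto simp: h_def)
  moreover have "r \<le> u - h" "u - h < u"
    using d(1) \<open>r < u\<close> by (auto simp: h_def min_def field_simps)
  ultimately show False
    using before[of "u - h"] by simp
qed

text \<open>An orbit staying below \<open>c\<close> would be increasing and bounded, hence converge
  to an equilibrium strictly between \<open>m\<close> and \<open>q\<close>, and there is none. The
  weak bounds on \<open>{0..T}\<close> are recorded because they survive a passage to the
  limit.\<close>

lemma reaches:
  assumes S: "sol W w" and "W 0 = m" "w 0 > 0" "m < c" "c < q"
  shows "\<exists>T>0. W T = c \<and> (\<forall>t\<in>{0..T}. m \<le> W t \<and> W t \<le> c \<and> 0 \<le> w t)"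
proof -
  have pos: "w t > 0" if "t \<ge> 0" "\<And>x. 0 \<le> x \<Longrightarrow> x \<le> t \<Longrightarrow> W x < q" for t
    by (rule speed_stays_pos[OF S \<open>w 0 > 0\<close>]) (use that assms in auto)
  have "\<exists>T\<ge>0. W T = c"
  proof (rule ccontr)
    assume *: "\<not> (\<exists>T\<ge>0. W T = c)"
    have less: "W t < c" if "t \<ge> 0" for t
    proof (rule ccontr)
      assume "\<not> W t < c"
      then show False
        using IVT'[of W 0 c t] * that assms solD(5)[OF S] by auto
    qed
    have w: "w t > 0" if "t \<ge> 0" for t
      using pos[OF that] less \<open>c < q\<close> by (meson less_trans)
    have incr: "W x < W y" if "0 \<le> x" "x < y" for x y
      by (rule DERIV_pos_imp_increasing_open[OF that(2)])
         (use that w solD(1)[OF S] solD(5)[OF S] in \<open>auto intro!: exI[of _ "w _"]\<close>)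
    have "\<exists>\<omega>. (W \<longlongrightarrow> \<omega>) at_top \<and> \<omega> \<le> c \<and> (\<forall>x\<ge>0. W x \<le> \<omega>)"
      using incr less by (intro bounded_mono_tendsto) (auto simp: le_less)
    then obtain \<omega> where \<omega>: "(W \<longlongrightarrow> \<omega>) at_top" "\<omega> \<le> c" "W 1 \<le> \<omega>"
      by (auto dest: spec[of _ 1])
    have "g \<omega> < 0"
      using incr[of 0 1] \<omega> assms by (intro g_neg) auto
    then show False
      using sol_limit_at_top(1)[OF S \<omega>(1)] by simp
  qed
  define S' where "S' = {0..} \<inter> W -` {c}"
  have "closed S'" "S' \<noteq> {}"
    unfolding S'_def using \<open>\<exists>T\<ge>0. W T = c\<close>
    by (auto intro!: continuous_closed_preimage solD(5)[OF S])
  moreover have bdd: "bdd_below S'"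
    by (rule bdd_belowI[of _ 0]) (simp add: S'_def)
  ultimately have "Inf S' \<in> S'"
    by (intro closed_contains_Inf)
  define T where "T = Inf S'"
  have T: "T \<ge> 0" "W T = c"
    using \<open>Inf S' \<in> S'\<close> by (auto simp: T_def S'_def)
  then have "T > 0"
    using assms by (cases "T = 0") auto
  have less: "W t < c" if t: "0 \<le> t" "t < T" for t
  proof (rule ccontr)
    assume "\<not> W t < c"
    then obtain z where "0 \<le> z" "z \<le> t" "W z = c"
      using IVT'[of W 0 c t] t assms solD(5)[OF S] by auto
    then show False
      using cInf_lower[OF _ bdd, of z] t by (simp add: T_def S'_def)
  qed
  have le: "W t \<le> c" if "0 \<le> t" "t \<le> T" for t
    using less[of t] that T by (cases "t = T") auto
  have w: "w t > 0" if "0 \<le> t" "t \<le> T" for t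
  proof (rule pos[OF that(1)])
    show "W x < q" if "0 \<le> x" "x \<le> t" for x
      using le[of x] that \<open>t \<le> T\<close> \<open>c < q\<close> by simp
  qed
  have ge: "m \<le> W t" if "0 \<le> t" "t \<le> T" for t
    unfolding \<open>W 0 = m\<close>[symmetric] using that w solD(1)[OF S]
    by (intro DERIV_nonneg_imp_nondecreasing[of 0 t W]) (auto intro!: exI[of _ "w _"] less_imp_le)
  show ?thesis
    using \<open>T > 0\<close> T(2) le w ge by (intro exI[of _ T]) (auto intro: less_imp_le)
qed

text \<open>Solutions started at \<open>(m, 1 / n)\<close> reach a fixed \<open>c\<close> between \<open>m\<close> and \<open>q\<close>, and Lipschitz
  dependence on the initial data forces the time this takes to infinity. Shifting the arrival time
  to \<open>0\<close>, a subsequence converges to a solution whose past stays in \<open>[m, c]\<close>.\<close>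

lemma unstable_solution_exists: "\<exists>W w. sol W w \<and> (W \<longlongrightarrow> m) at_bot \<and> m < W 0"
proof -
  define c where "c = (m + q) / 2"
  have c: "m < c" "c < q"
    using m_less_q by (auto simp: c_def)
  have "\<exists>V v T. sol V v \<and> V (- T) = m \<and> v (- T) = 1 / real (Suc n) \<and> T > 0 \<and> V 0 = c \<and>
      (\<forall>t\<in>{-T..0}. m \<le> V t \<and> V t \<le> c \<and> 0 \<le> v t)" for n
  proof -
    obtain W w where W: "sol W w" "W 0 = m" "w 0 = 1 / real (Suc n)"
      using sol_exists by blast
    obtain T where T: "T > 0" "W T = c" "\<forall>t\<in>{0..T}. m \<le> W t \<and> W t \<le> c \<and> 0 \<le> w t"
      using reaches[OF W(1,2) _ c] W(3) by auto
    show ?thesis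
      using W T sol_shift[OF W(1), of T]
      by (intro exI[of _ "\<lambda>t. W (t + T)"] exI[of _ "\<lambda>t. w (t + T)"] exI[of _ T]) auto
  qed
  then obtain V v T where V: "\<And>n. sol (V n) (v n)"
      and start: "\<And>n. V n (- T n) = m" "\<And>n. v n (- T n) = 1 / real (Suc n)" "\<And>n. T n > 0"
      and V0: "\<And>n. V n 0 = c"
      and box: "\<And>n t. - T n \<le> t \<Longrightarrow> t \<le> 0 \<Longrightarrow> m \<le> V n t \<and> V n t \<le> c \<and> 0 \<le> v n t"
    by (metis atLeastAtMost_iff)
  \<comment> \<open>The comparison solution is the constant \<open>m\<close>: the distance to it
    grows from \<open>1 / Suc n\<close> at the start to at least \<open>c - m\<close> on
    arrival.\<close>
  have T_large: "(c - m) * real (Suc n) \<le> exp (K * T n)" for n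
  proof -
    have "c - m \<le> norm (V n 0 - m, (v n 0 + A (V n 0)) - (0 + A m))"
      using norm_fst_le[of "V n 0 - m" "(v n 0 + A (V n 0)) - (0 + A m)"] c V0 by simp
    also have "\<dots> \<le> exp (K * \<bar>0 - (- T n)\<bar>)
        * norm (V n (- T n) - m, (v n (- T n) + A (V n (- T n))) - (0 + A m))"
      by (rule sol_dependence[OF V sol_const[OF g_m]])
    also have "\<dots> = exp (K * T n) / real (Suc n)"
      using start[of n] by (simp add: A_m norm_Pair)
    finally show ?thesis
      by (simp add: field_simps)
  qed
  have T_eventually: "eventually (\<lambda>n. t \<le> T n) sequentially" for t
  proof -
    have "eventually (\<lambda>n. exp (K * t) / (c - m) < real n) sequentially"
      using filterlim_real_sequentially by (simp add: filterlim_at_top_dense)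
    then show ?thesis
    proof eventually_elim
      case (elim n)
      have "exp (K * t) < (c - m) * real (Suc n)"
        using elim c by (simp add: field_simps)
      also have "\<dots> \<le> exp (K * T n)"
        by (rule T_large)
      finally show ?case
        using K_pos by simp
    qed
  qed
  \<comment> \<open>All arrival positions equal \<open>c\<close>, so compactness asks only for a
    bound on the arrival speeds. Energy gives it, since the starting speed is at most 1.\<close>
  have "bounded (range (\<lambda>n. v n 0))"
  proof -
    have "(v n 0)\<^sup>2 \<le> 1 + 2 * (G m - G c)" for n
    proof -
      have "energy (V n) (v n) 0 \<le> energy (V n) (v n) (- T n)"
        using start(3)[of n] by (intro energy_antimono V) simp
      then have "(v n 0)\<^sup>2 \<le> (1 / real (Suc n))\<^sup>2 + 2 * (G m - G c)"
        by (simp add: energy_def start V0)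
      moreover have "(1 / real (Suc n))\<^sup>2 \<le> 1"
        by (intro power_le_one) auto
      ultimately show ?thesis
        by linarith
    qed
    then show ?thesis
      by (intro boundedI[of _ "sqrt (1 + 2 * (G m - G c))"]) (auto intro: real_le_rsqrt)
  qed
  then obtain \<omega> r where r: "strict_mono r" "(\<lambda>n. v (r n) 0) \<longlonglongrightarrow> \<omega>"
    using bounded_imp_convergent_subsequence[of "\<lambda>n. v n 0"] by (auto simp: o_def)
  obtain W w where W: "sol W w" "W 0 = c" "w 0 = \<omega>"
    using sol_exists by blast
  have lim: "(\<lambda>n. V (r n) t) \<longlonglongrightarrow> W t" "(\<lambda>n. v (r n) t) \<longlonglongrightarrow> w t" for t
  proof -
    define X where "X n = (V (r n) t - W t, (v (r n) t + A (V (r n) t)) - (w t + A (W t)))" for n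
    have "norm (X n) \<le> exp (K * \<bar>t\<bar>) * \<bar>v (r n) 0 - \<omega>\<bar>" for n
      using sol_dependence[OF V[of "r n"] W(1), of t 0] by (simp add: X_def V0 W norm_Pair)
    then have "eventually (\<lambda>n. norm (X n) \<le> exp (K * \<bar>t\<bar>) * \<bar>v (r n) 0 - \<omega>\<bar>) sequentially"
      by simp
    then have "X \<longlonglongrightarrow> 0"
    proof (rule Lim_null_comparison)
      show "(\<lambda>n. exp (K * \<bar>t\<bar>) * \<bar>v (r n) 0 - \<omega>\<bar>) \<longlonglongrightarrow> 0"
        using tendsto_mult[OF tendsto_const tendsto_rabs[OF tendsto_diff[OF r(2) tendsto_const[of \<omega>]]],
          of "exp (K * \<bar>t\<bar>)"] by simp
    qed
    from tendsto_fst[OF this] tendsto_snd[OF this]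
    have *: "(\<lambda>n. V (r n) t - W t) \<longlonglongrightarrow> 0"
        "(\<lambda>n. (v (r n) t + A (V (r n) t)) - (w t + A (W t))) \<longlonglongrightarrow> 0"
      by (simp_all add: X_def)
    from tendsto_add[OF *(1) tendsto_const[of "W t"]] show Wt: "(\<lambda>n. V (r n) t) \<longlonglongrightarrow> W t"
      by simp
    from tendsto_diff[OF tendsto_add[OF *(2) tendsto_const[of "w t + A (W t)"]]
        isCont_tendsto_compose[OF A_cont Wt]]
    show "(\<lambda>n. v (r n) t) \<longlonglongrightarrow> w t"
      by simp
  qed
  have past: "m \<le> W t \<and> W t \<le> c \<and> 0 \<le> w t" if "t \<le> 0" for t
  proof -
    have "eventually (\<lambda>n. - t \<le> T (r n)) sequentially"
      by (rule eventually_subseq[OF r(1) T_eventually])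
    then have "eventually (\<lambda>n. m \<le> V (r n) t \<and> V (r n) t \<le> c \<and> 0 \<le> v (r n) t) sequentially"
      by eventually_elim (use box that in auto)
    then have "eventually (\<lambda>n. m \<le> V (r n) t) sequentially" "eventually (\<lambda>n. V (r n) t \<le> c) sequentially"
        "eventually (\<lambda>n. 0 \<le> v (r n) t) sequentially"
      by (auto simp: eventually_conj_iff)
    then show ?thesis
      using tendsto_lowerbound[OF lim(1)[of t], of m] tendsto_upperbound[OF lim(1)[of t], of c]
        tendsto_lowerbound[OF lim(2)[of t], of 0] by auto
  qed
  have incr: "W x \<le> W y" if "x \<le> y" "y \<le> 0" for x y
    using that past solD(1)[OF W(1)]
    by (intro DERIV_nonneg_imp_nondecreasing[of x y W]) (auto intro!: exI[of _ "w _"])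
  have "\<exists>\<omega>. ((\<lambda>t. - W (- t)) \<longlongrightarrow> \<omega>) at_top \<and> \<omega> \<le> - m \<and> (\<forall>x\<ge>0. - W (- x) \<le> \<omega>)"
    by (rule bounded_mono_tendsto) (use incr past in auto)
  then obtain \<omega>' where \<omega>': "((\<lambda>t. - W (- t)) \<longlongrightarrow> \<omega>') at_top" "\<omega>' \<le> - m" "- W 0 \<le> \<omega>'"
    by (auto dest: spec[of _ 0])
  have bot: "(W \<longlongrightarrow> - \<omega>') at_bot"
    using tendsto_minus[OF \<omega>'(1)] by (simp add: filterlim_at_bot_mirror)
  \<comment> \<open>The limit in the past lies in \<open>[m, c]\<close> and is a zero of
    \<open>g\<close>, and \<open>m\<close> is the only one there.\<close>
  have "- \<omega>' = m"
    using sol_limit_at_bot(1)[OF W(1) bot] g_neg[of "- \<omega>'"] \<omega>'(2,3) W(2) c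
    by (cases "- \<omega>' = m") auto
  then show ?thesis
    using W bot c by (intro exI[of _ W] exI[of _ w]) auto
qed

section \<open>Trapping in the potential well and convergence to its bottom\<close>

lemma G_le_energy: "G (W t) \<le> energy W w t"
  by (simp add: energy_def)

text \<open>The energy starts from \<open>G m\<close> at minus infinity and never increases. If it
  still had this value at some time, the speed would vanish throughout the past, so \<open>W\<close>
  would rest at \<open>m\<close> and by uniqueness do so forever. Being strictly below
  \<open>G m\<close>, the orbit cannot cross \<open>m\<close>, where the energy is at least
  \<open>G m\<close>.\<close>

lemma trapped:
  assumes S: "sol W w" and bot: "(W \<longlongrightarrow> m) at_bot" and "m < W t0"
  shows "m < W t" "energy W w t < G m"
proof -
  have "((\<lambda>t. (w t)\<^sup>2 / 2 + G (W t)) \<longlongrightarrow> 0\<^sup>2 / 2 + G m) at_bot"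
    by (intro tendsto_intros sol_limit_at_bot(2)[OF S bot] isCont_tendsto_compose[OF G_cont bot]) simp
  then have E_lim: "(energy W w \<longlongrightarrow> G m) at_bot"
    by (simp add: energy_def[abs_def])
  have E_le: "energy W w t \<le> G m" for t
    by (rule tendsto_lowerbound[OF E_lim])
       (auto intro!: eventually_at_bot_linorderI[of t] energy_antimono[OF S])
  have E_less: "energy W w t < G m" for t
  proof (rule ccontr)
    assume "\<not> energy W w t < G m"
    then have E: "energy W w x = G m" if "x \<le> t" for x
      using E_le[of x] energy_antimono[OF S that] by simp
    have w0: "w x = 0" if "x < t" for x
    proof (rule ccontr)
      assume "w x \<noteq> 0"
      then have "- a (W x) * (w x)\<^sup>2 < 0"
        using a0(1) a0(2)[of "W x"] by simp
      from DERIV_neg_dec_right[OF energy_deriv[OF S] this] obtain d where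
        d: "d > 0" "\<And>h. 0 < h \<Longrightarrow> h < d \<Longrightarrow> energy W w (x + h) < energy W w x"
        by blast
      define h where "h = min (d / 2) (t - x)"
      have h: "0 < h" "h < d" "x + h \<le> t"
        using d(1) that by (auto simp: h_def min_def)
      then show False
        using d(2)[of h] E[of x] E[of "x + h"] by simp
    qed
    have W_const: "W x = W (t - 1)" if x: "x < t - 1" for x
    proof -
      obtain z where "x < z" "z < t - 1" "W (t - 1) - W x = (t - 1 - x) * w z"
        using MVT2[OF x, of W w] solD(1)[OF S] by blast
      then show ?thesis
        using w0[of z] by simp
    qed
    have "(W \<longlongrightarrow> W (t - 1)) at_bot"
      using W_const by (intro tendsto_eventually eventually_at_bot_dense[THEN iffD2]) auto
    then have "W (t - 1) = m"
      using bot by (intro tendsto_unique[of at_bot W]) auto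
    then have "W t0 = m"
      using sol_unique(1)[OF S sol_const[OF g_m], of "t - 1" t0] w0[of "t - 1"] by simp
    then show False
      using \<open>m < W t0\<close> by simp
  qed
  then show "energy W w t < G m"
    by simp
  have ne: "W t \<noteq> m" for t
    using E_less[of t] by (auto simp: energy_def)
  show "m < W t"
  proof (rule ccontr)
    assume "\<not> m < W t"
    moreover have "continuous_on S W" for S
      by (rule solD(5)[OF S])
    ultimately have "\<exists>x. W x = m"
      using IVT'[of W t m t0] IVT2'[of W t m t0] \<open>m < W t0\<close> by (cases "t \<le> t0") auto
    then show False
      using ne by blast
  qed
qed

text \<open>Before any time \<open>t\<close> the position was smaller, as it tends to
  \<open>m < W t\<close>. The mean value theorem gives an earlier time of positive speed, and
  \<open>speed_stays_pos\<close> carries the sign to \<open>t\<close>.\<close>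

lemma eventually_speed_pos:
  assumes S: "sol W w" and bot: "(W \<longlongrightarrow> m) at_bot" and gt: "\<And>t. m < W t"
  shows "\<exists>T. \<forall>t\<le>T. w t > 0 \<and> W t < q"
proof -
  obtain T where T: "\<And>t. t \<le> T \<Longrightarrow> W t < q"
    using order_tendstoD(2)[OF bot m_less_q] by (auto simp: eventually_at_bot_linorder)
  have "w t > 0" if t: "t \<le> T" for t
  proof -
    have "eventually (\<lambda>x. W x < W t \<and> x < t) at_bot"
      using order_tendstoD(2)[OF bot gt[of t]] eventually_at_bot_dense[of "\<lambda>x. x < t"]
      by (auto intro: eventually_conj)
    then obtain x where x: "W x < W t" "x < t"
      using eventually_happens'[OF trivial_limit_at_bot_linorder, of "\<lambda>x. W x < W t \<and> x < t"] by auto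
    obtain z where z: "x < z" "z < t" "W t - W x = (t - x) * w z"
      using MVT2[of x t W w] x solD(1)[OF S] by auto
    then have "w z > 0"
      using x by (smt (verit) mult_nonneg_nonpos)
    then show ?thesis
      by (rule speed_stays_pos[OF S]) (use z t T gt[of z] in auto)
  qed
  then show ?thesis
    using T by blast
qed

text \<open>A Barbalat argument: the energy converges, so little is dissipated over short windows,
  and since \<open>w\<close> has bounded derivative it must vanish in the limit. Then
  \<open>g (W t)\<close> vanishes too. The energy lost by time 0 excludes a neighbourhood of
  \<open>m\<close>, which leaves only the zero \<open>q\<close>.\<close>

lemma converges:
  assumes S: "sol W w" and gt: "\<And>t. m < W t" and E_less: "\<And>t. energy W w t < G m"
  shows "W t < R" "(W \<longlongrightarrow> q) at_top"
proof -
  have G_W: "G (W t) < G m" for t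
    by (rule le_less_trans[OF G_le_energy E_less])
  have W_R: "W t < R" for t
  proof (rule ccontr)
    assume *: "\<not> W t < R"
    have "G R \<le> G (W t)"
    proof (rule DERIV_nonneg_imp_nondecreasing[of R "W t" G])
      show "\<exists>y. (G has_real_derivative y) (at x) \<and> 0 \<le> y" if "R \<le> x" for x
        using G[of x] g_pos[of x] that R(1) by (intro exI[of _ "g x"]) auto
    qed (use * in auto)
    then show False
      using R(2) G_W[of t] by simp
  qed
  then show "W t < R"
    by simp
  have "continuous_on {m..R} G"
    using G_cont by (intro continuous_at_imp_continuous_on) auto
  then obtain x0 where x0: "\<And>x. m \<le> x \<Longrightarrow> x \<le> R \<Longrightarrow> G x0 \<le> G x"
    using continuous_attains_inf[of "{m..R}" G] m_less_q R(1) by fastforce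
  then have G_ge: "G x0 \<le> G (W t)" for t
    using gt[of t] W_R[of t] by simp
  define M where "M = sqrt (2 * (G m - G x0))"
  have w_le: "\<bar>w t\<bar> \<le> M" for t
    unfolding M_def using E_less[of t] G_ge[of t]
    by (intro real_le_rsqrt) (simp add: energy_def)
  have M: "M \<ge> 0"
    using w_le[of 0] by simp
  define P where "P = L * M + L * (R - m) + 1"
  have P: "P > 0"
    using M L_pos m_less_q R(1) by (auto simp: P_def intro!: add_nonneg_pos)
  have w': "\<bar>- a (W t) * w t - g (W t)\<bar> \<le> P" for t
  proof -
    have "\<bar>a (W t) * w t\<bar> \<le> L * M"
      using a0(1) a0(2)[of "W t"] a_le[of "W t"] w_le[of t] L_pos
      unfolding abs_mult by (intro mult_mono) auto
    moreover have "\<bar>g (W t)\<bar> \<le> L * \<bar>W t - m\<bar>"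
      using g_lipschitz[of "W t" m] g_m by simp
    moreover have "L * \<bar>W t - m\<bar> \<le> L * (R - m)"
      using L_pos gt[of t] W_R[of t] by (intro mult_left_mono) auto
    ultimately show ?thesis
      unfolding P_def by linarith
  qed
  have E_ge: "G x0 \<le> energy W w t" for t
    by (rule order_trans[OF G_ge[of t] G_le_energy[of W t w]])
  have "\<exists>e. ((\<lambda>t. - energy W w t) \<longlongrightarrow> e) at_top \<and> e \<le> - G x0 \<and> (\<forall>x\<ge>0. - energy W w x \<le> e)"
    by (rule bounded_mono_tendsto) (use energy_antimono[OF S] E_ge in auto)
  then obtain e where e: "((\<lambda>t. - energy W w t) \<longlongrightarrow> e) at_top"
    by blast
  have w_small: "eventually (\<lambda>t. \<bar>w t\<bar> < \<epsilon>) at_top" if "\<epsilon> > 0" for \<epsilon>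
  proof -
    \<comment> \<open>Over a window of this length \<open>w\<close> varies by at most
      \<open>\<epsilon> / 2\<close>, so one time in it with speed below
      \<open>\<epsilon> / 2\<close> is enough.\<close>
    define d where "d = \<epsilon> / (2 * P)"
    have d: "d > 0"
      using that P by (simp add: d_def)
    have "((\<lambda>t. - energy W w (t + d) - - energy W w t) \<longlongrightarrow> e - e) at_top"
      by (intro tendsto_diff e filterlim_compose[OF e filterlim_shift_at_top])
    moreover have "e - e < d * (a0 * (\<epsilon> / 2)\<^sup>2)"
      using d a0(1) that by simp
    ultimately have "eventually (\<lambda>t. - energy W w (t + d) - - energy W w t < d * (a0 * (\<epsilon> / 2)\<^sup>2)) at_top"
      by (rule order_tendstoD(2))
    then show ?thesis
    proof eventually_elim
      case (elim t)
      obtain z where z: "t < z" "z < t + d" "energy W w (t + d) - energy W w t = (t + d - t) * (- a (W z) * (w z)\<^sup>2)"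
        using MVT2[of t "t + d" "energy W w" "\<lambda>z. - a (W z) * (w z)\<^sup>2"] energy_deriv[OF S] d by auto
      have "a0 * (w z)\<^sup>2 \<le> a (W z) * (w z)\<^sup>2"
        using a0(2) by (rule mult_right_mono) simp
      also have "d * (a (W z) * (w z)\<^sup>2) < d * (a0 * (\<epsilon> / 2)\<^sup>2)"
        using elim z(3) by simp
      then have "a (W z) * (w z)\<^sup>2 < a0 * (\<epsilon> / 2)\<^sup>2"
        using d by simp
      finally have "(w z)\<^sup>2 < (\<epsilon> / 2)\<^sup>2"
        using a0(1) by simp
      then have wz: "\<bar>w z\<bar> < \<epsilon> / 2"
        using that by (simp add: abs_square_less_1 flip: abs_le_square_iff not_le)
      obtain y where y: "w z - w t = (z - t) * (- a (W y) * w y - g (W y))"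
        using MVT2[of t z w "\<lambda>y. - a (W y) * w y - g (W y)"] z solD(2)[OF S] by auto
      have "\<bar>w z - w t\<bar> \<le> d * P"
        unfolding y abs_mult using z d w'[of y] by (intro mult_mono) auto
      also have "d * P = \<epsilon> / 2"
        using P by (simp add: d_def)
      finally show ?case
        using wz by linarith
    qed
  qed
  have g_small: "eventually (\<lambda>t. \<bar>g (W t)\<bar> < \<epsilon>) at_top" if "\<epsilon> > 0" for \<epsilon>
  proof -
    \<comment> \<open>At an intermediate time \<open>z\<close>, \<open>g\<close> is bounded by
      \<open>2 * \<delta>\<close> from the increment of \<open>w\<close> plus
      \<open>L * \<delta>\<close> from the damping. Going back from \<open>z\<close> to
      \<open>t\<close> costs another \<open>L * \<delta>\<close>, in total
      \<open>\<epsilon> / 2\<close>.\<close>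
    define \<delta> where "\<delta> = \<epsilon> / (2 * (2 + 2 * L))"
    have \<delta>: "\<delta> > 0"
      using that L_pos by (simp add: \<delta>_def)
    obtain T where T: "\<And>t. t \<ge> T \<Longrightarrow> \<bar>w t\<bar> < \<delta>"
      using w_small[OF \<delta>] by (auto simp: eventually_at_top_linorder)
    have "\<bar>g (W t)\<bar> < \<epsilon>" if t: "t \<ge> T" for t
    proof -
      obtain z where z: "t < z" "z < t + 1" "w (t + 1) - w t = (t + 1 - t) * (- a (W z) * w z - g (W z))"
        using MVT2[of t "t + 1" w "\<lambda>y. - a (W y) * w y - g (W y)"] solD(2)[OF S] by auto
      obtain y where y: "t < y" "W z - W t = (z - t) * w y"
        using MVT2[of t z W w] z solD(1)[OF S] by auto
      have "\<bar>a (W z) * w z\<bar> \<le> L * \<delta>"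
        using a0(1) a0(2)[of "W z"] a_le[of "W z"] T[of z] z t L_pos
        unfolding abs_mult by (intro mult_mono) auto
      then have gz: "\<bar>g (W z)\<bar> \<le> \<delta> + \<delta> + L * \<delta>"
        using z(3) T[of t] T[of "t + 1"] t by (simp add: abs_le_iff) linarith
      have "\<bar>W z - W t\<bar> \<le> 1 * \<delta>"
        unfolding y(2) abs_mult using z y T[of y] t by (intro mult_mono) auto
      then have "L * \<bar>W z - W t\<bar> \<le> L * \<delta>"
        using L_pos by (intro mult_left_mono) auto
      then have "\<bar>g (W t)\<bar> \<le> (2 + 2 * L) * \<delta>"
        using g_lipschitz[of "W z" "W t"] gz by (simp add: algebra_simps)
      also have "\<dots> = \<epsilon> / 2"
        using L_pos by (simp add: \<delta>_def field_simps)
      finally show ?thesis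
        using that \<open>\<epsilon> > 0\<close> by simp
    qed
    then show ?thesis
      by (auto simp: eventually_at_top_linorder)
  qed
  \<comment> \<open>Near the saddle \<open>G\<close> exceeds the energy at time 0, so the orbit
    cannot return there.\<close>
  obtain \<delta> where \<delta>: "\<delta> > 0" "\<And>x. \<bar>x - m\<bar> < \<delta> \<Longrightarrow> energy W w 0 < G x"
  proof -
    have "eventually (\<lambda>x. energy W w 0 < G x) (nhds m)"
      using G_cont[of m] E_less[of 0] by (intro order_tendstoD(1)) (auto simp: isCont_def tendsto_at_iff_tendsto_nhds)
    then show ?thesis
      using that by (auto simp: eventually_nhds_metric dist_real_def)
  qed
  have W_ge: "m + \<delta> \<le> W t" if "t \<ge> 0" for t
  proof (rule ccontr)
    assume "\<not> m + \<delta> \<le> W t"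
    then have "energy W w 0 < G (W t)"
      using gt[of t] by (intro \<delta>(2)) auto
    then show False
      using energy_antimono[OF S that] G_le_energy[of W t w] by linarith
  qed
  show "(W \<longlongrightarrow> q) at_top"
  proof (rule tendstoI)
    fix \<epsilon> :: real assume "\<epsilon> > 0"
    \<comment> \<open>On this compact set \<open>\<bar>g\<bar>\<close> has a positive lower bound,
      so a small \<open>g (W t)\<close> forces \<open>W t\<close> close to \<open>q\<close>.\<close>
    define C where "C = {m + \<delta>..R} - ball q \<epsilon>"
    have "compact C"
      unfolding C_def by (intro compact_diff) auto
    have "\<exists>\<gamma>>0. \<forall>x\<in>C. \<gamma> \<le> \<bar>g x\<bar>"
    proof (cases "C = {}")
      case False
      obtain x where x: "x \<in> C" "\<And>y. y \<in> C \<Longrightarrow> \<bar>g x\<bar> \<le> \<bar>g y\<bar>"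
        using continuous_attains_inf[OF \<open>compact C\<close> False, of "\<lambda>x. \<bar>g x\<bar>"] g_cont[of C]
        by (auto intro: continuous_on_rabs)
      have "g x \<noteq> 0"
        using x(1) \<open>\<epsilon> > 0\<close> \<delta>(1) g_neg[of x] g_pos[of x] by (cases x q rule: linorder_cases) (auto simp: C_def)
      then show ?thesis
        using x(2) by (intro exI[of _ "\<bar>g x\<bar>"]) auto
    qed (auto intro: exI[of _ 1])
    then obtain \<gamma> where \<gamma>: "\<gamma> > 0" "\<And>x. x \<in> C \<Longrightarrow> \<gamma> \<le> \<bar>g x\<bar>"
      by blast
    show "eventually (\<lambda>t. dist (W t) q < \<epsilon>) at_top"
      using g_small[OF \<gamma>(1)] eventually_ge_at_top[of 0]
    proof eventually_elim
      case (elim t)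
      then have "W t \<notin> C"
        using \<gamma>(2)[of "W t"] by auto
      then show ?case
        using W_ge[of t] W_R[of t] elim by (auto simp: C_def dist_commute)
    qed
  qed
qed

theorem connecting_solution_exists:
  "\<exists>W w. sol W w \<and> (W \<longlongrightarrow> m) at_bot \<and> (W \<longlongrightarrow> q) at_top \<and> (\<forall>t. m < W t \<and> W t < R)"
proof -
  obtain W w where W: "sol W w" "(W \<longlongrightarrow> m) at_bot" "m < W 0"
    using unstable_solution_exists by blast
  note tr = trapped[OF W]
  show ?thesis
    using W tr converges[OF W(1) tr] by blast
qed

text \<open>Along the unstable manifold both speeds are functions of the position, and the square of
  their difference decreases as the position grows because \<open>g < 0\<close>; it vanishes at \<open>m\<close>.\<close>

theorem connecting_solution_unique:
  assumes S: "sol W1 w1" "sol W2 w2" and bot: "(W1 \<longlongrightarrow> m) at_bot" "(W2 \<longlongrightarrow> m) at_bot"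
    and top: "(W1 \<longlongrightarrow> q) at_top" "(W2 \<longlongrightarrow> q) at_top"
  shows "\<exists>c. \<forall>t. W2 t = W1 (t + c)"
proof -
  have start: "\<exists>t0. m < W t0" if "(W \<longlongrightarrow> q) at_top" for W :: "real \<Rightarrow> real"
    using eventually_happens'[OF trivial_limit_at_top_linorder order_tendstoD(1)[OF that m_less_q]] .
  have gt: "m < W1 t" "m < W2 t" for t
    using trapped(1)[OF S(1) bot(1)] start[OF top(1)] trapped(1)[OF S(2) bot(2)] start[OF top(2)]
    by auto
  obtain T1 where T1: "\<And>t. t \<le> T1 \<Longrightarrow> w1 t > 0 \<and> W1 t < q"
    using eventually_speed_pos[OF S(1) bot(1)] gt by blast
  obtain T2 where T2: "\<And>t. t \<le> T2 \<Longrightarrow> w2 t > 0 \<and> W2 t < q"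
    using eventually_speed_pos[OF S(2) bot(2)] gt by blast
  have incr2: "W2 x < W2 y" if "x < y" "y \<le> T2" for x y
    by (rule DERIV_pos_imp_increasing_open[OF that(1)])
       (use that T2 solD(1)[OF S(2)] solD(5)[OF S(2)] in \<open>auto intro!: exI[of _ "w2 _"]\<close>)
  have inj: "inj_on W2 {..T2}"
    by (rule linorder_inj_onI) (use incr2 in force)+
  \<comment> \<open>On the ray \<open>t \<le> T2\<close> the second orbit moves strictly to the
    right, so \<open>\<tau>\<close> is its passage time through a given position.\<close>
  define \<tau> where "\<tau> = inv_into {..T2} W2"
  have \<tau>: "\<tau> (W2 x) = x" if "x \<le> T2" for x
    unfolding \<tau>_def using inj that by (intro inv_into_f_f) auto
  have onto: "\<exists>x<T2. W2 x = y" if y: "m < y" "y < W2 T2" for y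
  proof -
    have "eventually (\<lambda>x. W2 x < y \<and> x < T2) at_bot"
      using order_tendstoD(2)[OF bot(2) y(1)] eventually_at_bot_dense[of "\<lambda>x. x < T2"]
      by (auto intro: eventually_conj)
    then obtain x where x: "W2 x < y" "x < T2"
      using eventually_happens'[OF trivial_limit_at_bot_linorder, of "\<lambda>x. W2 x < y \<and> x < T2"] by auto
    then obtain z where "x \<le> z" "z \<le> T2" "W2 z = y"
      using IVT'[of W2 x y T2] y solD(5)[OF S(2)] by auto
    then show ?thesis
      using y by (intro exI[of _ z]) (auto simp: le_less)
  qed
  have \<tau>_deriv: "(\<tau> has_real_derivative inverse (w2 x)) (at (W2 x))" if "x < T2" for x
    unfolding has_field_derivative_def
  proof (rule has_derivative_inverse_strong[of "{..<T2}" x W2 \<tau>])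
    show "(W2 has_derivative (*) (w2 x)) (at x)"
      using solD(1)[OF S(2)] by (simp add: has_field_derivative_def)
    show "(*) (w2 x) \<circ> (*) (inverse (w2 x)) = id"
      using T2[of x] that by (auto simp: fun_eq_iff)
  qed (use that \<tau> solD(5)[OF S(2)] in auto)
  obtain T where T: "T \<le> T1" "\<And>t. t \<le> T \<Longrightarrow> W1 t < W2 T2"
  proof -
    obtain T where "\<And>t. t \<le> T \<Longrightarrow> W1 t < W2 T2"
      using order_tendstoD(2)[OF bot(1) gt(2)[of T2]] by (auto simp: eventually_at_bot_linorder)
    then show ?thesis
      using that[of "min T T1"] by auto
  qed
  \<comment> \<open>The time at which the second orbit is where the first one is at time
    \<open>t\<close>.\<close>
  define \<sigma> where "\<sigma> t = \<tau> (W1 t)" for t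
  have \<sigma>: "\<sigma> t < T2" "W2 (\<sigma> t) = W1 t" if t: "t \<le> T" for t
  proof -
    obtain x where "x < T2" "W2 x = W1 t"
      using onto[OF gt(1) T(2)[OF t]] by blast
    then show "\<sigma> t < T2" "W2 (\<sigma> t) = W1 t"
      using \<tau>[of x] by (simp_all add: \<sigma>_def)
  qed
  have \<sigma>_deriv: "(\<sigma> has_real_derivative w1 t / w2 (\<sigma> t)) (at t)" if "t \<le> T" for t
    using DERIV_chain2[OF \<tau>_deriv[OF \<sigma>(1)[OF that], unfolded \<sigma>(2)[OF that]] solD(1)[OF S(1)]]
    by (simp add: \<sigma>_def[abs_def] divide_inverse_commute)
  define d where "d t = w1 t - w2 (\<sigma> t)" for t
  \<comment> \<open>Since \<open>\<sigma>\<close> has derivative \<open>w1 / w2\<close>, the damping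
    cancels: \<open>- a * w1 - g + (a * w2 + g) * w1 / w2 = g * (w1 - w2) / w2\<close>.\<close>
  have d_deriv: "(d has_real_derivative g (W1 t) * d t / w2 (\<sigma> t)) (at t)" if "t \<le> T" for t
    unfolding d_def[abs_def]
    by (rule DERIV_cong[OF DERIV_diff[OF solD(2)[OF S(1)] DERIV_chain2[OF solD(2)[OF S(2)] \<sigma>_deriv[OF that]]]])
       (use T2[of "\<sigma> t"] \<sigma>[OF that] in \<open>simp add: field_simps\<close>)
  \<comment> \<open>Ensures that the second speed, taken at the time \<open>\<sigma> t\<close>, also
    vanishes as \<open>t\<close> goes to minus infinity.\<close>
  have \<sigma>_bot: "filterlim \<sigma> at_bot at_bot"
    unfolding filterlim_at_bot_dense
  proof
    fix Z
    have "eventually (\<lambda>t. W1 t < W2 (min Z T2)) at_bot"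
      by (rule order_tendstoD(2)[OF bot(1) gt(2)])
    then show "eventually (\<lambda>t. \<sigma> t < Z) at_bot"
      using eventually_le_at_bot[of T]
    proof eventually_elim
      case (elim t)
      show ?case
      proof (rule ccontr)
        assume "\<not> \<sigma> t < Z"
        then have "W2 (min Z T2) \<le> W2 (\<sigma> t)"
          using incr2[of "min Z T2" "\<sigma> t"] \<sigma>(1)[OF elim(2)] by (cases "min Z T2 = \<sigma> t") auto
        then show False
          using elim \<sigma>(2) by simp
      qed
    qed
  qed
  have "(d \<longlongrightarrow> 0 - 0) at_bot"
    unfolding d_def[abs_def]
    by (intro tendsto_diff sol_limit_at_bot(2)[OF S(1) bot(1)]
        filterlim_compose[OF sol_limit_at_bot(2)[OF S(2) bot(2)] \<sigma>_bot])
  then have lim: "((\<lambda>t. (d t)\<^sup>2) \<longlongrightarrow> (0 - 0)\<^sup>2) at_bot"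
    by (rule tendsto_power)
  have d_ge: "(d T)\<^sup>2 \<le> (d t)\<^sup>2" if "t \<le> T" for t
  proof (rule DERIV_nonpos_imp_nonincreasing[OF that])
    fix x assume x: "t \<le> x" "x \<le> T"
    have "((\<lambda>t. (d t)\<^sup>2) has_real_derivative 2 * (d x)\<^sup>2 * (g (W1 x) / w2 (\<sigma> x))) (at x)"
      by (auto intro!: derivative_eq_intros d_deriv x simp: power2_eq_square)
    moreover have "g (W1 x) / w2 (\<sigma> x) \<le> 0"
      using g_neg[of "W1 x"] gt T1[of x] T(1) T2[of "\<sigma> x"] \<sigma>(1)[of x] x
      by (intro divide_nonpos_pos) auto
    then have "2 * (d x)\<^sup>2 * (g (W1 x) / w2 (\<sigma> x)) \<le> 0"
      by (intro mult_nonneg_nonpos) auto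
    ultimately show "\<exists>y. ((\<lambda>t. (d t)\<^sup>2) has_real_derivative y) (at x) \<and> y \<le> 0"
      by blast
  qed
  have "(d T)\<^sup>2 \<le> (0 - 0)\<^sup>2"
    by (rule tendsto_lowerbound[OF lim]) (use d_ge in \<open>auto intro!: eventually_at_bot_linorderI[of T]\<close>)
  \<comment> \<open>Position and speed now agree at \<open>T\<close> and \<open>\<sigma> T\<close>,
    so the initial value problem identifies the orbits up to this time shift.\<close>
  then have "w2 (\<sigma> T) = w1 T"
    by (simp add: d_def)
  then have "W2 t = W1 (t + (T - \<sigma> T))" for t
    using sol_unique(1)[OF S(2) sol_shift[OF S(1), of "T - \<sigma> T"], of "\<sigma> T"] \<sigma>(2)[of T] by simp
  then show ?thesis
    by blast
qed

end

section \<open>Smoothness\<close>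

text \<open>Smoothness graded by order, so that a differential equation can gain one derivative at a
  time by induction.\<close>

definition times_differentiable :: "nat \<Rightarrow> (real \<Rightarrow> real) \<Rightarrow> bool" where
  "times_differentiable n f \<longleftrightarrow> (\<forall>k<n. \<forall>x. (deriv ^^ k) f differentiable (at x))"

lemma times_differentiable_0 [simp]: "times_differentiable 0 f"
  by (simp add: times_differentiable_def)

lemma times_differentiable_Suc:
  "times_differentiable (Suc n) f \<longleftrightarrow> (\<forall>x. f differentiable (at x)) \<and> times_differentiable n (deriv f)"
  unfolding times_differentiable_def
  by (simp add: All_less_Suc2 funpow_Suc_right del: funpow.simps)

lemma smooth_on_UNIV_iff: "smooth_on UNIV f \<longleftrightarrow> (\<forall>n. times_differentiable n f)"
  by (auto simp: smooth_on_def times_differentiable_def)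

lemma times_differentiable_Suc_I:
  assumes "\<And>x. (f has_real_derivative f' x) (at x)" "times_differentiable n f'"
  shows "times_differentiable (Suc n) f"
proof -
  have "deriv f = f'"
    using assms(1) by (auto intro: DERIV_imp_deriv)
  then show ?thesis
    using assms by (auto simp: times_differentiable_Suc real_differentiable_def)
qed

lemma times_differentiable_Suc_D:
  assumes "times_differentiable (Suc n) f"
  shows "(f has_real_derivative deriv f x) (at x)" "times_differentiable n (deriv f)" "times_differentiable n f"
proof -
  show "(f has_real_derivative deriv f x) (at x)" "times_differentiable n (deriv f)"
    using assms by (auto simp: times_differentiable_Suc DERIV_deriv_iff_real_differentiable)
  show "times_differentiable n f"
    using assms by (simp add: times_differentiable_def)
qed

lemma times_differentiable_const: "times_differentiable n (\<lambda>_. c)"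
  by (induction n arbitrary: c) (auto intro: times_differentiable_Suc_I[where f' = "\<lambda>_. 0"])

lemma times_differentiable_add:
  "times_differentiable n f \<Longrightarrow> times_differentiable n g \<Longrightarrow> times_differentiable n (\<lambda>x. f x + g x)"
proof (induction n arbitrary: f g)
  case (Suc n)
  note D = times_differentiable_Suc_D[OF Suc.prems(1)] times_differentiable_Suc_D[OF Suc.prems(2)]
  show ?case
    by (rule times_differentiable_Suc_I[OF DERIV_add[OF D(1,4)] Suc.IH[OF D(2,5)]])
qed simp

lemma times_differentiable_mult:
  "times_differentiable n f \<Longrightarrow> times_differentiable n g \<Longrightarrow> times_differentiable n (\<lambda>x. f x * g x)"
proof (induction n arbitrary: f g)
  case (Suc n)
  note D = times_differentiable_Suc_D[OF Suc.prems(1)] times_differentiable_Suc_D[OF Suc.prems(2)]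
  show ?case
    by (rule times_differentiable_Suc_I[OF DERIV_mult[OF D(1,4)]])
       (intro times_differentiable_add Suc.IH D)
qed simp

lemma times_differentiable_inverse:
  "times_differentiable n f \<Longrightarrow> (\<And>x. f x \<noteq> 0) \<Longrightarrow> times_differentiable n (\<lambda>x. inverse (f x))"
proof (induction n)
  case (Suc n)
  note D = times_differentiable_Suc_D[OF Suc.prems(1)]
  show ?case
  proof (rule times_differentiable_Suc_I)
    show "((\<lambda>x. inverse (f x)) has_real_derivative (- 1) * (deriv f x * (inverse (f x) * inverse (f x)))) (at x)" for x
      by (rule DERIV_cong[OF DERIV_inverse_fun[OF D(1) Suc.prems(2)]]) (simp add: mult.commute)
    show "times_differentiable n (\<lambda>x. (- 1) * (deriv f x * (inverse (f x) * inverse (f x))))"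
      by (intro times_differentiable_mult times_differentiable_const D Suc.IH Suc.prems(2))
  qed
qed simp

lemma smooth_on_has_derivative: "smooth_on S f \<Longrightarrow> x \<in> S \<Longrightarrow> (f has_real_derivative deriv f x) (at x)"
  unfolding smooth_on_def DERIV_deriv_iff_real_differentiable
  by (metis funpow_0)

lemma smooth_on_deriv: "smooth_on S f \<Longrightarrow> smooth_on S (deriv f)"
  unfolding smooth_on_def by (metis comp_apply funpow_Suc_right)

lemma smooth_on_continuous_on: "smooth_on S f \<Longrightarrow> T \<subseteq> S \<Longrightarrow> continuous_on T f"
  by (intro continuous_at_imp_continuous_on ballI DERIV_isCont) (blast intro: smooth_on_has_derivative)

lemma times_differentiable_compose:
  "smooth_on {0<..} h \<Longrightarrow> times_differentiable n f \<Longrightarrow> (\<And>x. f x > 0) \<Longrightarrow> times_differentiable n (\<lambda>x. h (f x))"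
proof (induction n arbitrary: h)
  case (Suc n)
  note D = times_differentiable_Suc_D[OF Suc.prems(2)]
  show ?case
  proof (rule times_differentiable_Suc_I)
    show "((\<lambda>x. h (f x)) has_real_derivative deriv h (f x) * deriv f x) (at x)" for x
      using Suc.prems by (intro DERIV_chain2[OF _ D(1)] smooth_on_has_derivative) auto
    show "times_differentiable n (\<lambda>x. deriv h (f x) * deriv f x)"
      by (intro times_differentiable_mult D Suc.IH smooth_on_deriv Suc.prems)
  qed
qed simp

section \<open>Viscous-capillary profiles as solutions of a Lienard equation\<close>

text \<open>The positive limits control the two tails and compactness controls the middle. The
  positive lower bound is what allows a cut-off interval inside \<open>v > 0\<close> that contains
  the whole profile.\<close>

lemma continuous_positive_range:
  fixes V :: "real \<Rightarrow> real"
  assumes cont: "continuous_on UNIV V" and pos: "\<And>y. V y > 0"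
    and lims: "(V \<longlongrightarrow> b) at_bot" "(V \<longlongrightarrow> t) at_top" "b > 0" "t > 0"
  shows "\<exists>\<alpha> \<beta>. 0 < \<alpha> \<and> (\<forall>y. \<alpha> \<le> V y \<and> V y \<le> \<beta>)"
proof -
  have "eventually (\<lambda>y. b / 2 < V y \<and> V y < b + 1) at_bot" "eventually (\<lambda>y. t / 2 < V y \<and> V y < t + 1) at_top"
    using lims(3,4)
    by (intro eventually_conj order_tendstoD(1)[OF lims(1)] order_tendstoD(2)[OF lims(1)]
        order_tendstoD(1)[OF lims(2)] order_tendstoD(2)[OF lims(2)]; simp)+
  then obtain y1 y2 where y1: "\<And>y. y \<le> y1 \<Longrightarrow> b / 2 < V y \<and> V y < b + 1"
      and y2: "\<And>y. y \<ge> y2 \<Longrightarrow> t / 2 < V y \<and> V y < t + 1"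
    by (auto simp: eventually_at_bot_linorder eventually_at_top_linorder)
  define J where "J = {min y1 y2..max y1 y2}"
  have J: "compact J" "J \<noteq> {}" "continuous_on J V"
    using cont by (auto simp: J_def min_def max_def intro: continuous_on_subset)
  obtain z1 where z1: "\<And>y. y \<in> J \<Longrightarrow> V z1 \<le> V y"
    using continuous_attains_inf[OF J] by blast
  obtain z2 where z2: "\<And>y. y \<in> J \<Longrightarrow> V y \<le> V z2"
    using continuous_attains_sup[OF J] by blast
  define \<alpha> where "\<alpha> = min (V z1) (min (b / 2) (t / 2))"
  define \<beta> where "\<beta> = max (V z2) (max (b + 1) (t + 1))"
  have "\<alpha> \<le> V y \<and> V y \<le> \<beta>" for y
  proof -
    consider "y \<le> y1" | "y \<ge> y2" | "y \<in> J"
      unfolding J_def by fastforce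
    then show ?thesis
      by cases (use y1[of y] y2[of y] z1[of y] z2[of y] in \<open>auto simp: \<alpha>_def \<beta>_def\<close>)
  qed
  moreover have "\<alpha> > 0"
    using pos lims(3,4) by (simp add: \<alpha>_def)
  ultimately show ?thesis
    by blast
qed

section \<open>The shock conditions and the shape of \<open>f\<close>\<close>

locale compressive_shock =
  fixes p \<mu> \<kappa> :: "real \<Rightarrow> real" and Vm Um Vp Up s :: real
  assumes smooth: "smooth_on {0<..} p" "smooth_on {0<..} \<mu>" "smooth_on {0<..} \<kappa>"
    and \<mu>_pos: "\<And>v. v > 0 \<Longrightarrow> \<mu> v > 0"
    and \<kappa>_pos: "\<And>v. v > 0 \<Longrightarrow> \<kappa> v > 0"
    and p'_neg: "\<And>v. v > 0 \<Longrightarrow> deriv p v < 0"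
    and p''_pos: "\<And>v. v > 0 \<Longrightarrow> deriv (deriv p) v > 0"
    and Vm_pos: "Vm > 0" and Vp_pos: "Vp > 0"
    and shock: "compressive_2_shock p Vm Um Vp Up s"
begin

abbreviation f :: "real \<Rightarrow> real" where "f \<equiv> profile_f p s Vp"

lemma p_deriv: "v > 0 \<Longrightarrow> (p has_real_derivative deriv p v) (at v)"
  and p'_deriv: "v > 0 \<Longrightarrow> (deriv p has_real_derivative deriv (deriv p) v) (at v)"
  and \<mu>_deriv: "v > 0 \<Longrightarrow> (\<mu> has_real_derivative deriv \<mu> v) (at v)"
  and \<kappa>_deriv: "v > 0 \<Longrightarrow> (\<kappa> has_real_derivative deriv \<kappa> v) (at v)"
  using smooth by (auto intro!: smooth_on_has_derivative intro: smooth_on_deriv)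

lemma p'_mono:
  assumes "0 < x" "x < y"
  shows "deriv p x < deriv p y"
proof (rule DERIV_pos_imp_increasing[OF assms(2)])
  fix z assume "x \<le> z" "z \<le> y"
  then show "\<exists>d. (deriv p has_real_derivative d) (at z) \<and> 0 < d"
    using p'_deriv[of z] p''_pos[of z] assms(1) by auto
qed

lemma s_pos: "s > 0" and Lax: "- deriv p Vp < s\<^sup>2" "s\<^sup>2 < - deriv p Vm"
proof -
  have *: "sqrt (- deriv p Vp) < s" "s < sqrt (- deriv p Vm)"
    using shock by (auto simp: compressive_2_shock_def lambda2_def)
  have "sqrt (- deriv p Vp) > 0"
    using p'_neg[OF Vp_pos] by simp
  then show "s > 0"
    using *(1) by linarith
  then have "(sqrt (- deriv p Vp))\<^sup>2 < s\<^sup>2" "s\<^sup>2 < (sqrt (- deriv p Vm))\<^sup>2"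
    using * p'_neg[OF Vp_pos] by (intro power_strict_mono; simp)+
  then show "- deriv p Vp < s\<^sup>2" "s\<^sup>2 < - deriv p Vm"
    using p'_neg[OF Vp_pos] p'_neg[OF Vm_pos] by auto
qed

text \<open>The Lax conditions make \<open>p' + s\<^sup>2\<close> negative at \<open>Vm\<close> and
  positive at \<open>Vp\<close>, and \<open>p'\<close> is increasing.\<close>

lemma Vm_less_Vp: "Vm < Vp"
proof (rule ccontr)
  assume "\<not> Vm < Vp"
  then have "deriv p Vp \<le> deriv p Vm"
    using p'_mono[OF Vp_pos, of Vm] by (cases "Vm = Vp") auto
  then show False
    using Lax by linarith
qed

lemma f_deriv: "v > 0 \<Longrightarrow> (f has_real_derivative deriv p v + s\<^sup>2) (at v)"
  unfolding profile_f_def[abs_def] by (auto intro!: derivative_eq_intros p_deriv)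

lemma f_Vp: "f Vp = 0" and f_Vm: "f Vm = 0"
proof -
  show "f Vp = 0"
    by (simp add: profile_f_def)
  have "p Vp - p Vm = - (s * (s * (Vp - Vm)))"
    using shock unfolding compressive_2_shock_def by (metis minus_diff_eq mult_minus_right)
  then show "f Vm = 0"
    by (simp add: profile_f_def power2_eq_square algebra_simps)
qed

text \<open>Strict convexity: a value \<open>f v \<ge> 0\<close> would give a slope
  \<open>\<ge> 0\<close> somewhere to the left of \<open>v\<close> and a slope
  \<open>\<le> 0\<close> to its right, against the strict growth of \<open>p'\<close>.\<close>

lemma f_neg:
  assumes "Vm < v" "v < Vp"
  shows "f v < 0"
proof (rule ccontr)
  assume "\<not> f v < 0"
  obtain x where x: "Vm < x" "x < v" "f v - f Vm = (v - Vm) * (deriv p x + s\<^sup>2)"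
    using MVT2[OF assms(1), of f "\<lambda>x. deriv p x + s\<^sup>2"] f_deriv Vm_pos by auto
  obtain y where y: "v < y" "y < Vp" "f Vp - f v = (Vp - v) * (deriv p y + s\<^sup>2)"
    using MVT2[OF assms(2), of f "\<lambda>x. deriv p x + s\<^sup>2"] f_deriv assms Vm_pos by auto
  have "deriv p x < deriv p y"
    using x y Vm_pos by (intro p'_mono) auto
  moreover have "0 \<le> deriv p x + s\<^sup>2"
    using x(3) assms f_Vm \<open>\<not> f v < 0\<close> by (smt (verit) mult_pos_neg)
  moreover have "deriv p y + s\<^sup>2 \<le> 0"
    using y(3) assms f_Vp \<open>\<not> f v < 0\<close> by (smt (verit) mult_pos_pos)
  ultimately show False
    by linarith
qed

lemma f_strict_mono:
  assumes "Vp \<le> x" "x < y"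
  shows "f x < f y"
proof (rule DERIV_pos_imp_increasing[OF assms(2)])
  fix z assume z: "x \<le> z" "z \<le> y"
  have "deriv p Vp \<le> deriv p z"
    using p'_mono[OF Vp_pos, of z] z assms by (cases "z = Vp") auto
  then show "\<exists>d. (f has_real_derivative d) (at z) \<and> 0 < d"
    using f_deriv[of z] z assms Vp_pos Lax by (intro exI[of _ "deriv p z + s\<^sup>2"]) auto
qed

lemma f_pos: "Vp < v \<Longrightarrow> f v > 0"
  using f_strict_mono[of Vp v] f_Vp by simp

lemma f_continuous_on: "T \<subseteq> {0<..} \<Longrightarrow> continuous_on T f"
  by (intro continuous_at_imp_continuous_on ballI DERIV_isCont) (blast intro: f_deriv)

lemma potential_exists:
  "\<exists>F \<beta>0. (\<forall>v>0. (F has_real_derivative f v) (at v)) \<and> Vp < \<beta>0 \<and> (\<forall>\<beta>\<ge>\<beta>0. F Vm < F \<beta>)"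
proof -
  have "isCont f x" if "0 < x" for x
    using f_deriv[OF that] by (rule DERIV_isCont)
  then obtain F where F: "\<And>v. v > 0 \<Longrightarrow> (F has_real_derivative f v) (at v)"
    using einterval_antiderivative[of 0 \<infinity> f]
    by (auto simp: has_real_derivative_iff_has_vector_derivative zero_ereal_def)
  define v1 where "v1 = Vp + 1"
  have v1: "v1 > 0" "f v1 > 0" "Vp < v1"
    using Vp_pos f_pos by (auto simp: v1_def)
  \<comment> \<open>Solves \<open>F v1 + (\<beta> - v1) * f v1 > F Vm\<close>, a lower bound for
    \<open>F \<beta>\<close> since \<open>f \<ge> f v1\<close> beyond \<open>v1\<close>. The final 1
    makes both this inequality and \<open>v1 < \<beta>\<close> strict.\<close>
  define \<beta>0 where "\<beta>0 = v1 + max 0 ((F Vm - F v1) / f v1) + 1"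
  have "F Vm < F \<beta>" if "\<beta>0 \<le> \<beta>" for \<beta>
  proof -
    have "v1 < \<beta>"
      using that by (simp add: \<beta>0_def)
    then obtain z where z: "v1 < z" "F \<beta> - F v1 = (\<beta> - v1) * f z"
      using MVT2[of v1 \<beta> F f] F v1(1) by auto
    have "(F Vm - F v1) / f v1 < \<beta> - v1"
      using that unfolding \<beta>0_def by linarith
    then have "F Vm - F v1 < (\<beta> - v1) * f v1"
      using v1(2) by (simp add: pos_divide_less_eq)
    also have "\<dots> \<le> (\<beta> - v1) * f z"
      using f_strict_mono[of v1 z] z v1 \<open>v1 < \<beta>\<close> by (intro mult_left_mono) auto
    finally show ?thesis
      using z(2) by simp
  qed
  moreover have "Vp < \<beta>0"
    using v1 by (simp add: \<beta>0_def)
  ultimately show ?thesis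
    using F by blast
qed

end

section \<open>The chart that turns profiles into Lienard solutions\<close>

definition clip :: "real \<Rightarrow> real \<Rightarrow> real \<Rightarrow> real" where
  "clip \<alpha> \<beta> v = max \<alpha> (min \<beta> v)"

lemma clip_mem: "\<alpha> \<le> \<beta> \<Longrightarrow> clip \<alpha> \<beta> v \<in> {\<alpha>..\<beta>}"
  by (auto simp: clip_def)

lemma clip_id: "\<alpha> \<le> v \<Longrightarrow> v \<le> \<beta> \<Longrightarrow> clip \<alpha> \<beta> v = v"
  by (simp add: clip_def)

lemma clip_lipschitz: "\<bar>clip \<alpha> \<beta> x - clip \<alpha> \<beta> y\<bar> \<le> \<bar>x - y\<bar>"
  by (simp add: clip_def max_def min_def)

lemma continuous_on_clip:
  assumes "\<alpha> \<le> \<beta>" "continuous_on {\<alpha>..\<beta>} h"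
  shows "continuous_on UNIV (\<lambda>v. h (clip \<alpha> \<beta> v))"
proof (rule continuous_on_compose2[OF assms(2)])
  show "continuous_on UNIV (clip \<alpha> \<beta>)"
    unfolding clip_def[abs_def] by (intro continuous_intros)
qed (use clip_mem[OF assms(1)] in auto)

lemma positive_bounds:
  fixes h :: "real \<Rightarrow> real"
  assumes "\<alpha> \<le> \<beta>" "continuous_on {\<alpha>..\<beta>} h" "\<And>v. v \<in> {\<alpha>..\<beta>} \<Longrightarrow> h v > 0"
  shows "\<exists>l u. 0 < l \<and> (\<forall>v\<in>{\<alpha>..\<beta>}. l \<le> h v \<and> h v \<le> u)"
proof -
  have ne: "{\<alpha>..\<beta>} \<noteq> {}"
    using assms(1) by simp
  obtain x where "x \<in> {\<alpha>..\<beta>}" "\<And>v. v \<in> {\<alpha>..\<beta>} \<Longrightarrow> h x \<le> h v"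
    using continuous_attains_inf[OF compact_Icc ne assms(2)] by blast
  moreover obtain y where "\<And>v. v \<in> {\<alpha>..\<beta>} \<Longrightarrow> h v \<le> h y"
    using continuous_attains_sup[OF compact_Icc ne assms(2)] by blast
  ultimately show ?thesis
    using assms(3) by blast
qed

text \<open>A derivative bounded below by \<open>l > 0\<close> gives linear growth in both
  directions, hence surjectivity onto the whole line.\<close>

lemma expanding_bijection:
  fixes \<Phi> k :: "real \<Rightarrow> real"
  assumes \<Phi>: "\<And>v. (\<Phi> has_real_derivative k v) (at v)" and k: "l > 0" "\<And>v. l \<le> k v"
  shows "\<exists>\<Psi>. (\<forall>v. \<Psi> (\<Phi> v) = v) \<and> (\<forall>x. \<Phi> (\<Psi> x) = x) \<and>
    (\<forall>x. (\<Psi> has_real_derivative inverse (k (\<Psi> x))) (at x)) \<and> strict_mono \<Phi>"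
proof -
  have mono: "\<Phi> x < \<Phi> y" if "x < y" for x y
  proof (rule DERIV_pos_imp_increasing[OF that])
    show "\<exists>d. (\<Phi> has_real_derivative d) (at z) \<and> 0 < d" for z
      using \<Phi>[of z] less_le_trans[OF k(1) k(2)] by blast
  qed
  then have sm: "strict_mono \<Phi>"
    by (simp add: strict_mono_def)
  have cont: "continuous_on S \<Phi>" for S
    using \<Phi> by (intro continuous_at_imp_continuous_on) (auto intro: DERIV_isCont)
  have grow: "l * (y - x) \<le> \<Phi> y - \<Phi> x" if xy: "x < y" for x y
  proof -
    obtain z where "\<Phi> y - \<Phi> x = (y - x) * k z"
      using MVT2[OF xy, of \<Phi> k] \<Phi> by blast
    then show ?thesis
      using k(2)[of z] xy by (simp add: mult.commute mult_left_mono)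
  qed
  have surj: "\<exists>v. \<Phi> v = x" for x
  proof -
    define r where "r = \<bar>x - \<Phi> 0\<bar> / l + 1"
    have "r > 0"
      unfolding r_def using k(1) by (intro add_nonneg_pos) auto
    moreover have "l * r \<ge> \<bar>x - \<Phi> 0\<bar>"
      using k(1) by (simp add: r_def algebra_simps)
    ultimately have r: "r > 0" "l * r \<ge> \<bar>x - \<Phi> 0\<bar>" .
    then have "\<Phi> (- r) \<le> x" "x \<le> \<Phi> r"
      using grow[of 0 r] grow[of "- r" 0] by auto
    then show ?thesis
      using IVT'[of \<Phi> "- r" x r] r cont by auto
  qed
  define \<Psi> where "\<Psi> = inv \<Phi>"
  have \<Psi>: "\<Psi> (\<Phi> v) = v" "\<Phi> (\<Psi> x) = x" for v x
    using strict_mono_imp_inj_on[OF sm] surj[of x] unfolding \<Psi>_def by (metis inv_f_f f_inv_into_f rangeI)+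
  have "(\<Psi> has_real_derivative inverse (k v)) (at (\<Phi> v))" for v
    unfolding has_field_derivative_def
  proof (rule has_derivative_inverse_strong[of UNIV v \<Phi> \<Psi>])
    show "(\<Phi> has_derivative (*) (k v)) (at v)"
      using \<Phi> by (simp add: has_field_derivative_def)
    show "(*) (k v) \<circ> (*) (inverse (k v)) = id"
      using k(1) k(2)[of v] by (auto simp: fun_eq_iff)
  qed (use \<Psi> cont in auto)
  from this[of "\<Psi> _"] show ?thesis
    using \<Psi> sm by (intro exI[of _ \<Psi>]) auto
qed

context compressive_shock begin

text \<open>Off \<open>[\<alpha>, \<beta>]\<close> all coefficients are frozen, which makes them globally Lipschitz.\<close>

lemma lienard_chart:
  assumes \<alpha>: "0 < \<alpha>" "\<alpha> < Vm" and \<beta>: "Vp < \<beta>"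
    and F: "\<And>v. v > 0 \<Longrightarrow> (F has_real_derivative f v) (at v)" "F Vm < F \<beta>"
  obtains \<Phi> \<Psi> a g A G L a0 where "lienard a g A G L a0 (\<Phi> Vm) (\<Phi> Vp) (\<Phi> \<beta>)"
    and "\<And>v. \<Psi> (\<Phi> v) = v" "\<And>x. \<Phi> (\<Psi> x) = x" "strict_mono \<Phi>" "\<And>x. isCont \<Psi> x"
    and "\<And>v. \<alpha> \<le> v \<Longrightarrow> v \<le> \<beta> \<Longrightarrow> (\<Phi> has_real_derivative sqrt (\<kappa> v)) (at v)"
    and "\<And>v. \<alpha> \<le> v \<Longrightarrow> v \<le> \<beta> \<Longrightarrow> (\<Psi> has_real_derivative inverse (sqrt (\<kappa> v))) (at (\<Phi> v))"
    and "\<And>v. \<alpha> \<le> v \<Longrightarrow> v \<le> \<beta> \<Longrightarrow> a (\<Phi> v) = s * \<mu> v / (v * \<kappa> v)"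
    and "\<And>v. \<alpha> \<le> v \<Longrightarrow> v \<le> \<beta> \<Longrightarrow> g (\<Phi> v) = f v / sqrt (\<kappa> v)"
proof -
  let ?I = "{\<alpha>..\<beta>}"
  let ?c = "clip \<alpha> \<beta>"
  have \<alpha>\<beta>: "\<alpha> \<le> \<beta>"
    using \<alpha> \<beta> Vm_less_Vp by simp
  have c: "?c v \<in> ?I" for v
    by (rule clip_mem[OF \<alpha>\<beta>])
  have c_pos: "?c v > 0" for v
    using c[of v] \<alpha>(1) by auto
  have I: "?I \<subseteq> {0<..}"
    using \<alpha> by auto
  have cont: "continuous_on ?I p" "continuous_on ?I \<mu>" "continuous_on ?I \<kappa>"
      "continuous_on ?I (deriv p)" "continuous_on ?I (deriv \<kappa>)"
    using smooth by (auto intro!: smooth_on_continuous_on[OF _ I] intro: smooth_on_deriv)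
  define k where "k v = sqrt (\<kappa> v)" for v
  have k_pos: "k v > 0" if "v > 0" for v
    using \<kappa>_pos[OF that] by (simp add: k_def)
  have k_cont: "continuous_on ?I k"
    unfolding k_def[abs_def] by (intro continuous_intros cont)
  have "k v > 0" if "v \<in> ?I" for v
    using that I by (intro k_pos) auto
  then obtain l where l: "l > 0" "\<And>v. v \<in> ?I \<Longrightarrow> l \<le> k v"
    using positive_bounds[OF \<alpha>\<beta> k_cont] by blast
  \<comment> \<open>Freezing the integrand makes \<open>\<Phi>\<close> affine outside
    \<open>[\<alpha>, \<beta>]\<close>, so it is a chart of the whole line although
    \<open>\<kappa>\<close> is controlled only on \<open>v > 0\<close>.\<close>
  obtain \<Phi> where \<Phi>: "\<And>v. (\<Phi> has_real_derivative k (?c v)) (at v)"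
    using real_antiderivative_exists[OF continuous_on_clip[OF \<alpha>\<beta> k_cont]] by blast
  obtain \<Psi> where \<Psi>: "\<And>v. \<Psi> (\<Phi> v) = v" "\<And>x. \<Phi> (\<Psi> x) = x"
      "\<And>x. (\<Psi> has_real_derivative inverse (k (?c (\<Psi> x)))) (at x)" and sm: "strict_mono \<Phi>"
    using expanding_bijection[OF \<Phi> l(1)] l(2) c by blast
  have \<Psi>_cont: "isCont \<Psi> x" for x
    using \<Psi>(3) by (rule DERIV_isCont)
  have \<Psi>_lipschitz: "\<bar>\<Psi> x - \<Psi> y\<bar> \<le> inverse l * \<bar>x - y\<bar>" for x y
  proof -
    have "\<bar>inverse (k (?c (\<Psi> z)))\<bar> \<le> inverse l" for z
      using l(1) l(2)[OF c[of "\<Psi> z"]] by (simp add: le_imp_inverse_le)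
    then show ?thesis
      using field_differentiable_bound[of UNIV \<Psi> "\<lambda>x. inverse (k (?c (\<Psi> x)))" "inverse l" x y] \<Psi>(3)
      by simp
  qed
  \<comment> \<open>Divided by \<open>sqrt \<kappa>\<close>, the viscous term
    \<open>s * (\<mu> / v) * V'\<close> is \<open>b\<close> times the new speed
    \<open>sqrt \<kappa> * V'\<close>.\<close>
  define b where "b v = s * \<mu> v / (v * \<kappa> v)" for v
  have "continuous_on ?I b"
    unfolding b_def[abs_def] using I \<kappa>_pos by (intro continuous_intros cont) (force simp: subset_iff)
  moreover have "b v > 0" if "v \<in> ?I" for v
    using that I s_pos \<mu>_pos[of v] \<kappa>_pos[of v] by (auto simp: b_def)
  ultimately obtain a0 a1 where a01: "a0 > 0" "\<And>v. v \<in> ?I \<Longrightarrow> a0 \<le> b v \<and> b v \<le> a1"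
      and b_cont: "continuous_on ?I b"
    using positive_bounds[OF \<alpha>\<beta>] by blast
  define a where "a x = b (?c (\<Psi> x))" for x
  have \<Psi>_cont_on: "continuous_on UNIV \<Psi>"
    using \<Psi>_cont by (intro continuous_at_imp_continuous_on) auto
  have "continuous_on UNIV a"
    unfolding a_def[abs_def]
    by (rule continuous_on_compose2[OF continuous_on_clip[OF \<alpha>\<beta> b_cont] \<Psi>_cont_on]) auto
  then obtain A where A: "A (\<Phi> Vm) = 0" "\<And>x. (A has_real_derivative a x) (at x)"
    using real_antiderivative_exists by blast
  define h where "h v = f v / k v" for v
  define h' where "h' v = ((deriv p v + s\<^sup>2) * k v - f v * (inverse (k v) / 2 * deriv \<kappa> v)) / (k v * k v)" for v
  have h: "(h has_real_derivative h' v) (at v)" if "v \<in> ?I" for v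
  proof -
    have v: "v > 0"
      using that I by auto
    have "(k has_real_derivative inverse (k v) / 2 * deriv \<kappa> v) (at v)"
      unfolding k_def[abs_def] by (rule DERIV_chain2[OF DERIV_real_sqrt[OF \<kappa>_pos[OF v]] \<kappa>_deriv[OF v]])
    then show ?thesis
      unfolding h_def[abs_def] h'_def using k_pos[OF v] by (intro DERIV_divide f_deriv v) auto
  qed
  have "continuous_on ?I h'"
    unfolding h'_def[abs_def] using I k_pos
    by (intro continuous_intros cont k_cont f_continuous_on) (force simp: subset_iff)+
  from continuous_on_norm[OF this] have "compact ((\<lambda>v. norm (h' v)) ` ?I)"
    by (rule compact_continuous_image) simp
  then obtain B where B: "B > 0" "\<And>v. v \<in> ?I \<Longrightarrow> \<bar>h' v\<bar> \<le> B"
    by (auto dest!: compact_imp_bounded simp: bounded_pos)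
  have h_lipschitz: "\<bar>h x - h y\<bar> \<le> B * \<bar>x - y\<bar>" if "x \<in> ?I" "y \<in> ?I" for x y
    using field_differentiable_bound[of ?I h h' B x y] that B(2) h
    by (auto intro: has_field_derivative_at_within)
  define g where "g x = h (?c (\<Psi> x))" for x
  have g_lipschitz: "\<bar>g x - g y\<bar> \<le> (B * inverse l) * \<bar>x - y\<bar>" for x y
  proof -
    have "\<bar>g x - g y\<bar> \<le> B * \<bar>?c (\<Psi> x) - ?c (\<Psi> y)\<bar>"
      unfolding g_def by (intro h_lipschitz c)
    also have "\<dots> \<le> B * (inverse l * \<bar>x - y\<bar>)"
      using B(1) order_trans[OF clip_lipschitz \<Psi>_lipschitz] by (intro mult_left_mono) auto
    finally show ?thesis
      by simp
  qed
  have "continuous_on ?I h"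
    by (intro continuous_at_imp_continuous_on ballI DERIV_isCont[OF h])
  then have "continuous_on UNIV g"
    unfolding g_def[abs_def]
    by (intro continuous_on_compose2[OF continuous_on_clip[OF \<alpha>\<beta>] \<Psi>_cont_on]) auto
  then obtain G where G: "\<And>x. (G has_real_derivative g x) (at x)"
    using real_antiderivative_exists by blast
  have g\<Phi>: "g (\<Phi> v) = f v / sqrt (\<kappa> v)" if "\<alpha> \<le> v" "v \<le> \<beta>" for v
    using clip_id[OF that] by (simp add: g_def \<Psi>(1) h_def k_def)
  \<comment> \<open>On \<open>[Vm, \<beta>]\<close> the derivative of \<open>G (\<Phi> v)\<close> is
    \<open>f / sqrt \<kappa> * sqrt \<kappa> = f\<close>, so it differs from \<open>F\<close> by a
    constant and inherits the height of the wall.\<close>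
  have G_less: "G (\<Phi> Vm) < G (\<Phi> \<beta>)"
  proof -
    have "((\<lambda>v. G (\<Phi> v) - F v) has_real_derivative 0) (at v within {Vm..\<beta>})" if "v \<in> {Vm..\<beta>}" for v
    proof -
      have v: "\<alpha> \<le> v" "v \<le> \<beta>" "v > 0"
        using that \<alpha> Vm_pos by auto
      have "((\<lambda>v. G (\<Phi> v) - F v) has_real_derivative g (\<Phi> v) * k (?c v) - f v) (at v)"
        by (intro DERIV_diff DERIV_chain2[OF G \<Phi>] F(1) v)
      moreover have "g (\<Phi> v) * k (?c v) - f v = 0"
        using k_pos[OF v(3)] by (simp add: g\<Phi>[OF v(1,2)] clip_id[OF v(1,2)] k_def)
      ultimately show ?thesis
        by (metis has_field_derivative_at_within)
    qed
    from has_field_derivative_zero_constant[OF convex_real_interval(5) this]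
    obtain e where "\<forall>v\<in>{Vm..\<beta>}. G (\<Phi> v) - F v = e"
      by blast
    then have "G (\<Phi> \<beta>) - F \<beta> = G (\<Phi> Vm) - F Vm"
      using Vm_less_Vp \<beta> by simp
    then show ?thesis
      using F(2) by simp
  qed
  define L where "L = max a1 (B * inverse l)"
  have pull: "\<Phi> v < x \<longleftrightarrow> v < \<Psi> x" "x < \<Phi> v \<longleftrightarrow> \<Psi> x < v" for v x
    using strict_mono_less[OF sm, of v "\<Psi> x"] strict_mono_less[OF sm, of "\<Psi> x" v] by (simp_all add: \<Psi>(2))
  have lien: "lienard a g A G L a0 (\<Phi> Vm) (\<Phi> Vp) (\<Phi> \<beta>)"
  proof
    show "a0 \<le> a x" "a x \<le> L" for x
      using a01(2)[OF c[of "\<Psi> x"]] by (auto simp: a_def L_def)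
    show "\<bar>g x - g y\<bar> \<le> L * \<bar>x - y\<bar>" for x y
      using order_trans[OF g_lipschitz[of x y]] by (simp add: L_def mult_right_mono)
    show "\<Phi> Vm < \<Phi> Vp" "\<Phi> Vp < \<Phi> \<beta>"
      using sm Vm_less_Vp \<beta> by (auto simp: strict_mono_def)
    show "g (\<Phi> Vm) = 0" "g (\<Phi> Vp) = 0"
      using \<alpha> \<beta> Vm_less_Vp by (auto simp: g\<Phi> f_Vm f_Vp)
    show "g x < 0" if "\<Phi> Vm < x" "x < \<Phi> Vp" for x
    proof -
      have x: "Vm < \<Psi> x" "\<Psi> x < Vp"
        using that by (auto simp: pull)
      then have "g x = f (\<Psi> x) / k (\<Psi> x)"
        using g\<Phi>[of "\<Psi> x"] \<alpha> \<beta> by (simp add: \<Psi>(2) k_def)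
      then show ?thesis
        using f_neg[OF x] k_pos[of "\<Psi> x"] x Vm_pos by (simp add: divide_neg_pos)
    qed
    show "g x > 0" if "\<Phi> Vp < x" for x
    proof -
      \<comment> \<open>Beyond \<open>\<beta>\<close> the force is frozen at its value in
        \<open>\<beta>\<close>, which is positive because \<open>\<beta> > Vp\<close>.\<close>
      have "Vp < ?c (\<Psi> x)"
        using that \<beta> by (auto simp: pull clip_def)
      then show ?thesis
        using f_pos[of "?c (\<Psi> x)"] k_pos[OF c_pos] by (simp add: g_def h_def)
    qed
  qed (use A G a01 G_less in auto)
  show ?thesis
  proof (rule that[OF lien \<Psi>(1,2) sm \<Psi>_cont])
    show "(\<Phi> has_real_derivative sqrt (\<kappa> v)) (at v)" if "\<alpha> \<le> v" "v \<le> \<beta>" for v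
      using \<Phi>[of v] clip_id[OF that] by (simp add: k_def)
    show "(\<Psi> has_real_derivative inverse (sqrt (\<kappa> v))) (at (\<Phi> v))" if "\<alpha> \<le> v" "v \<le> \<beta>" for v
      using \<Psi>(3)[of "\<Phi> v"] clip_id[OF that] by (simp add: k_def \<Psi>(1))
    show "a (\<Phi> v) = s * \<mu> v / (v * \<kappa> v)" if "\<alpha> \<le> v" "v \<le> \<beta>" for v
      using clip_id[OF that] by (simp add: a_def b_def \<Psi>(1))
  qed (use g\<Phi> in auto)
qed

section \<open>The first-order system, smoothness and the integrated equations\<close>

definition rhs :: "real \<Rightarrow> real \<Rightarrow> real" where
  "rhs v q = - (1 / \<kappa> v) * (f v + s * (\<mu> v / v) * q + 1/2 * deriv \<kappa> v * q\<^sup>2)"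

definition profile_sol :: "(real \<Rightarrow> real) \<Rightarrow> (real \<Rightarrow> real) \<Rightarrow> bool" where
  "profile_sol V Q \<longleftrightarrow> (\<forall>y. V y > 0 \<and> (V has_real_derivative Q y) (at y) \<and>
     (Q has_real_derivative rhs (V y) (Q y)) (at y))"

lemma profile_solD:
  assumes "profile_sol V Q"
  shows "V y > 0" "(V has_real_derivative Q y) (at y)" "(Q has_real_derivative rhs (V y) (Q y)) (at y)"
  using assms by (auto simp: profile_sol_def)

text \<open>The reason for \<open>\<Phi>' = sqrt \<kappa>\<close>: differentiating the factor
  \<open>sqrt \<kappa>\<close> produces exactly the half of \<open>\<kappa>'\<close> that the
  capillary term carries.\<close>

lemma scaled_speed_deriv:
  assumes "V y > 0" "(V has_real_derivative Q y) (at y)" "(Q has_real_derivative Q') (at y)"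
  shows "((\<lambda>y. sqrt (\<kappa> (V y)) * Q y) has_real_derivative
    (\<kappa> (V y) * Q' + 1/2 * deriv \<kappa> (V y) * (Q y)\<^sup>2) / sqrt (\<kappa> (V y))) (at y)"
proof -
  have k: "\<kappa> (V y) > 0"
    by (rule \<kappa>_pos[OF assms(1)])
  have "((\<lambda>y. sqrt (\<kappa> (V y))) has_real_derivative inverse (sqrt (\<kappa> (V y))) / 2 * (deriv \<kappa> (V y) * Q y)) (at y)"
    by (rule DERIV_chain2[OF DERIV_real_sqrt[OF k] DERIV_chain2[OF \<kappa>_deriv[OF assms(1)] assms(2)]])
  from DERIV_mult[OF this assms(3)] show ?thesis
  proof (rule DERIV_cong)
    define r where "r = sqrt (\<kappa> (V y))"
    have r: "r > 0" "\<kappa> (V y) = r * r"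
      using k by (auto simp: r_def)
    show "inverse (sqrt (\<kappa> (V y))) / 2 * (deriv \<kappa> (V y) * Q y) * Q y + Q' * sqrt (\<kappa> (V y)) =
        (\<kappa> (V y) * Q' + 1/2 * deriv \<kappa> (V y) * (Q y)\<^sup>2) / sqrt (\<kappa> (V y))"
      unfolding r_def[symmetric] unfolding r(2) using r(1) by (simp add: field_simps power2_eq_square)
  qed
qed

lemmas times_differentiable_coefficients =
  times_differentiable_compose[OF smooth(1)] times_differentiable_compose[OF smooth(2)]
  times_differentiable_compose[OF smooth(3)] times_differentiable_compose[OF smooth_on_deriv[OF smooth(3)]]

text \<open>Bootstrapping: \<open>n\<close> derivatives of \<open>V\<close> and \<open>Q\<close>
  pass to the right-hand sides of the system, which yields order \<open>n + 1\<close> for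
  both.\<close>

lemma profile_sol_times_differentiable:
  assumes "profile_sol V Q"
  shows "times_differentiable n V \<and> times_differentiable n Q"
proof (induction n)
  case (Suc n)
  note P = profile_solD[OF assms]
  have pos: "V y \<noteq> 0" "\<kappa> (V y) \<noteq> 0" for y
    using P(1)[of y] \<kappa>_pos[OF P(1)[of y]] by auto
  note td = times_differentiable_add times_differentiable_mult times_differentiable_const
    times_differentiable_inverse times_differentiable_coefficients pos P(1)
    Suc.IH[THEN conjunct1] Suc.IH[THEN conjunct2]
  \<comment> \<open>Only sums, products and \<open>inverse\<close> remain, the shapes for which
    closure rules are at hand.\<close>
  have "rhs v q = - 1 * inverse (\<kappa> v) * (p v + s\<^sup>2 * v + - (s\<^sup>2 * Vp + p Vp)
      + s * (\<mu> v * inverse v) * q + 1/2 * deriv \<kappa> v * (q * q))" for v q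
    by (simp add: rhs_def profile_f_def power2_eq_square divide_simps)
  then have "times_differentiable n (\<lambda>y. rhs (V y) (Q y))"
    by (simp only:) (intro td)
  then show ?case
    using times_differentiable_Suc_I[OF P(2)] times_differentiable_Suc_I[OF P(3)] Suc.IH by blast
qed simp

text \<open>The first equation makes \<open>U + s * V\<close> constant. The left end state fixes the
  constant, and the first Rankine-Hugoniot condition then gives the limit \<open>Up\<close> on the
  right.\<close>

lemma traveling_profile_of_sol:
  assumes S: "profile_sol V Q" and lims: "(V \<longlongrightarrow> Vm) at_bot" "(V \<longlongrightarrow> Vp) at_top"
  shows "traveling_profile p \<mu> \<kappa> Vm Um Vp Up s V (\<lambda>y. Um + s * Vm + (- s) * V y)"
proof -
  note P = profile_solD[OF S]
  define U where "U y = Um + s * Vm + (- s) * V y" for y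
  have td: "times_differentiable n V" "times_differentiable n U" for n
    unfolding U_def[abs_def]
    by (intro times_differentiable_add times_differentiable_mult times_differentiable_const
        profile_sol_times_differentiable[OF S, THEN conjunct1])+
  have V': "deriv V = Q" and Q': "deriv Q = (\<lambda>y. rhs (V y) (Q y))"
    using DERIV_imp_deriv[OF P(2)] DERIV_imp_deriv[OF P(3)] by (auto simp: fun_eq_iff)
  have U': "(U has_real_derivative - s * Q y) (at y)" for y
    unfolding U_def[abs_def] by (auto intro!: derivative_eq_intros P(2))
  then have dU: "deriv U = (\<lambda>y. - s * Q y)"
    using DERIV_imp_deriv by (auto simp: fun_eq_iff)
  define h where "h y = \<mu> (V y) / V y * deriv U y" for y
  have \<kappa>Q: "\<kappa> (V y) * deriv Q y + 1/2 * deriv \<kappa> (V y) * (Q y)\<^sup>2 = h y - (p (V y) + s\<^sup>2 * V y - (s\<^sup>2 * Vp + p Vp))" for y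
    using \<kappa>_pos[OF P(1)[of y]] by (simp add: h_def dU Q' rhs_def profile_f_def algebra_simps)
  \<comment> \<open>Only differentiability of the viscous flux \<open>h\<close> matters: after
    substituting the profile equation its derivative occurs twice in the momentum equation, with
    opposite signs.\<close>
  have h_deriv: "(h has_real_derivative deriv h y) (at y)" for y
  proof -
    have "times_differentiable (Suc 0) (\<lambda>y. (\<mu> (V y) * inverse (V y)) * deriv U y)"
      by (intro times_differentiable_mult times_differentiable_coefficients times_differentiable_inverse
          td times_differentiable_Suc_D(2)[OF td(2)] P(1) less_imp_neq[OF P(1), symmetric])
    then show ?thesis
      using times_differentiable_Suc_D(1) by (simp add: h_def[abs_def] divide_inverse)
  qed
  have p_deriv': "((\<lambda>z. p (V z)) has_real_derivative deriv p (V y) * Q y) (at y)" for y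
    by (rule DERIV_chain2[OF p_deriv[OF P(1)] P(2)])
  have eq: "- s * deriv U y + deriv (\<lambda>z. p (V z)) y = deriv (\<lambda>z. \<mu> (V z) / V z * deriv U z) y
      - deriv (\<lambda>z. \<kappa> (V z) * deriv (deriv V) z + 1/2 * deriv \<kappa> (V z) * (deriv V z)\<^sup>2) y" for y
  proof -
    have "((\<lambda>z. h z - (p (V z) + s\<^sup>2 * V z - (s\<^sup>2 * Vp + p Vp)))
        has_real_derivative deriv h y - (deriv p (V y) * Q y + s\<^sup>2 * Q y)) (at y)"
      by (auto intro!: derivative_eq_intros h_deriv p_deriv' P(2))
    moreover have "(\<lambda>z. \<kappa> (V z) * deriv (deriv V) z + 1/2 * deriv \<kappa> (V z) * (deriv V z)\<^sup>2)
        = (\<lambda>z. h z - (p (V z) + s\<^sup>2 * V z - (s\<^sup>2 * Vp + p Vp)))"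
      unfolding V' \<kappa>Q ..
    ultimately have "deriv (\<lambda>z. \<kappa> (V z) * deriv (deriv V) z + 1/2 * deriv \<kappa> (V z) * (deriv V z)\<^sup>2) y
        = deriv h y - (deriv p (V y) * Q y + s\<^sup>2 * Q y)"
      by (simp only: DERIV_imp_deriv)
    then show ?thesis
      using DERIV_imp_deriv[OF p_deriv'[of y]]
      unfolding h_def[abs_def, symmetric] by (simp add: dU power2_eq_square)
  qed
  have "(U \<longlongrightarrow> Um + s * Vm + (- s) * Vm) at_bot" "(U \<longlongrightarrow> Um + s * Vm + (- s) * Vp) at_top"
    unfolding U_def[abs_def] by (intro tendsto_intros lims)+
  moreover have "Um + s * Vm + (- s) * Vp = Up"
    using shock by (simp add: compressive_2_shock_def algebra_simps)
  ultimately have "traveling_profile p \<mu> \<kappa> Vm Um Vp Up s V U"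
    unfolding traveling_profile_def using td P(1) lims eq
    by (auto simp: smooth_on_UNIV_iff V' dU)
  then show ?thesis
    by (simp add: U_def[abs_def])
qed

text \<open>Both equations are exact derivatives. The constant \<open>C\<close> cannot be read off
  at infinity yet, because \<open>traveling_profile\<close> prescribes no limits for the derivatives
  of \<open>V\<close>.\<close>

lemma traveling_profile_integrated:
  assumes T: "traveling_profile p \<mu> \<kappa> Vm Um Vp Up s V U"
  shows "U y = Um + s * Vm - s * V y"
    and "\<exists>C. \<forall>y. \<kappa> (V y) * deriv (deriv V) y + 1/2 * deriv \<kappa> (V y) * (deriv V y)\<^sup>2
      + s * (\<mu> (V y) / V y) * deriv V y + f (V y) = C"
proof -
  have td: "times_differentiable n V" "times_differentiable n U" for n
    using T by (auto simp: traveling_profile_def smooth_on_UNIV_iff)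
  note D = times_differentiable_Suc_D
  have pos: "V y > 0" for y
    using T by (simp add: traveling_profile_def)
  then have nz: "V y \<noteq> 0" for y
    by (metis less_irrefl)
  have V': "(V has_real_derivative deriv V y) (at y)" and U': "(U has_real_derivative deriv U y) (at y)" for y
    by (rule D(1)[OF td(1)[of "Suc 0"]], rule D(1)[OF td(2)[of "Suc 0"]])
  have dU: "deriv U y = - s * deriv V y" for y
    using T by (simp add: traveling_profile_def algebra_simps)
  define H1 where "H1 y = p (V y)" for y
  define H2 where "H2 y = \<mu> (V y) / V y * deriv U y" for y
  define H3 where "H3 y = \<kappa> (V y) * deriv (deriv V) y + 1/2 * deriv \<kappa> (V y) * (deriv V y)\<^sup>2" for y
  note td_intros = times_differentiable_add times_differentiable_mult times_differentiable_const
    times_differentiable_inverse times_differentiable_coefficients pos nz td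
    D(2)[OF td(1)] D(2)[OF td(2)] D(2)[OF D(2)[OF td(1)]]
  have "times_differentiable (Suc 0) (\<lambda>y. p (V y))"
      "times_differentiable (Suc 0) (\<lambda>y. \<mu> (V y) * inverse (V y) * deriv U y)"
      "times_differentiable (Suc 0) (\<lambda>y. \<kappa> (V y) * deriv (deriv V) y + 1/2 * deriv \<kappa> (V y) * (deriv V y * deriv V y))"
    by (intro td_intros)+
  moreover have "H1 = (\<lambda>y. p (V y))" "H2 = (\<lambda>y. \<mu> (V y) * inverse (V y) * deriv U y)"
      "H3 = (\<lambda>y. \<kappa> (V y) * deriv (deriv V) y + 1/2 * deriv \<kappa> (V y) * (deriv V y * deriv V y))"
    by (simp_all add: fun_eq_iff H1_def H2_def H3_def power2_eq_square divide_inverse[of "\<mu> _"])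
  ultimately have H: "(H1 has_real_derivative deriv H1 y) (at y)"
      "(H2 has_real_derivative deriv H2 y) (at y)" "(H3 has_real_derivative deriv H3 y) (at y)" for y
    using D(1) by (simp_all only:)
  have momentum: "- s * deriv U y + deriv H1 y = deriv H2 y - deriv H3 y" for y
    using T unfolding traveling_profile_def H1_def[abs_def] H2_def[abs_def] H3_def[abs_def] by blast
  have "((\<lambda>y. - s * U y + H1 y - H2 y + H3 y) has_real_derivative 0) (at y)" for y
    by (rule DERIV_cong[OF DERIV_add[OF DERIV_diff[OF DERIV_add[OF DERIV_cmult[OF U'] H(1)] H(2)] H(3)]])
      (use momentum[of y] in simp)
  then obtain C where C: "\<And>y. - s * U y + H1 y - H2 y + H3 y = C"
    using DERIV_isconst_all[of "\<lambda>y. - s * U y + H1 y - H2 y + H3 y"] by blast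
  have "((\<lambda>y. U y + s * V y) has_real_derivative 0) (at y)" for y
    by (auto intro!: derivative_eq_intros U' V' simp: dU)
  then have "U y + s * V y = U 0 + s * V 0" for y
    using DERIV_isconst_all[of "\<lambda>y. U y + s * V y"] by blast
  moreover have "((\<lambda>y. U y + s * V y) \<longlongrightarrow> Um + s * Vm) at_bot"
    using T by (intro tendsto_intros) (auto simp: traveling_profile_def)
  ultimately have "U y + s * V y = Um + s * Vm" for y
    using tendsto_unique[OF trivial_limit_at_bot_linorder, of "\<lambda>y. U y + s * V y"] tendsto_const
    by (metis (no_types, lifting) ext)
  then show U: "U y = Um + s * Vm - s * V y" for y
    by (simp add: algebra_simps)
  have "H3 y + s * (\<mu> (V y) / V y) * deriv V y + f (V y)
      = C + s * (Um + s * Vm) - (s\<^sup>2 * Vp + p Vp)" for y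
    using C[of y] by (simp add: U H1_def H2_def dU profile_f_def power2_eq_square algebra_simps)
  then show "\<exists>C. \<forall>y. \<kappa> (V y) * deriv (deriv V) y + 1/2 * deriv \<kappa> (V y) * (deriv V y)\<^sup>2
      + s * (\<mu> (V y) / V y) * deriv V y + f (V y) = C"
    by (auto simp: H3_def)
qed

end

text \<open>Joins the shock data to one particular cut-off. The interval is a parameter because
  uniqueness has to adapt it to the profiles at hand.\<close>

locale shock_chart = compressive_shock p \<mu> \<kappa> Vm Um Vp Up s
    + lienard a g A G L a0 "\<Phi> Vm" "\<Phi> Vp" "\<Phi> \<beta>"
  for p \<mu> \<kappa> Vm Um Vp Up s a g A G L a0 \<Phi> \<Psi> \<alpha> \<beta> +
  assumes \<alpha>: "0 < \<alpha>" "\<alpha> < Vm" and \<beta>: "Vp < \<beta>"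
    and \<Psi>_\<Phi>: "\<And>v. \<Psi> (\<Phi> v) = v" and \<Phi>_\<Psi>: "\<And>x. \<Phi> (\<Psi> x) = x"
    and \<Phi>_mono: "strict_mono \<Phi>" and \<Psi>_cont: "\<And>x. isCont \<Psi> x"
    and \<Phi>_deriv: "\<And>v. \<alpha> \<le> v \<Longrightarrow> v \<le> \<beta> \<Longrightarrow> (\<Phi> has_real_derivative sqrt (\<kappa> v)) (at v)"
    and \<Psi>_deriv: "\<And>v. \<alpha> \<le> v \<Longrightarrow> v \<le> \<beta> \<Longrightarrow> (\<Psi> has_real_derivative inverse (sqrt (\<kappa> v))) (at (\<Phi> v))"
    and a_\<Phi>: "\<And>v. \<alpha> \<le> v \<Longrightarrow> v \<le> \<beta> \<Longrightarrow> a (\<Phi> v) = s * \<mu> v / (v * \<kappa> v)"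
    and g_\<Phi>: "\<And>v. \<alpha> \<le> v \<Longrightarrow> v \<le> \<beta> \<Longrightarrow> g (\<Phi> v) = f v / sqrt (\<kappa> v)"
begin

text \<open>\<open>C\<close> is kept general: the formulas serve the system itself, where
  \<open>C = 0\<close>, and also the integrated equation, whose constant is still unknown.\<close>

lemma chart_deriv:
  assumes "\<alpha> \<le> V y" "V y \<le> \<beta>" "(V has_real_derivative Q y) (at y)" "(Q has_real_derivative Q') (at y)"
    and Q': "\<kappa> (V y) * Q' + 1/2 * deriv \<kappa> (V y) * (Q y)\<^sup>2 + s * (\<mu> (V y) / V y) * Q y + f (V y) = C"
  shows "((\<lambda>y. \<Phi> (V y)) has_real_derivative sqrt (\<kappa> (V y)) * Q y) (at y)"
    and "((\<lambda>y. sqrt (\<kappa> (V y)) * Q y) has_real_derivative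
      C / sqrt (\<kappa> (V y)) - a (\<Phi> (V y)) * (sqrt (\<kappa> (V y)) * Q y) - g (\<Phi> (V y))) (at y)"
proof -
  show "((\<lambda>y. \<Phi> (V y)) has_real_derivative sqrt (\<kappa> (V y)) * Q y) (at y)"
    by (rule DERIV_chain2[OF \<Phi>_deriv[OF assms(1,2)] assms(3)])
  have v: "V y > 0"
    using assms(1) \<alpha>(1) by simp
  have k: "\<kappa> (V y) > 0"
    by (rule \<kappa>_pos[OF v])
  have "a (\<Phi> (V y)) * (sqrt (\<kappa> (V y)) * Q y) = s * (\<mu> (V y) / V y) * Q y / sqrt (\<kappa> (V y))"
  proof -
    have "a (\<Phi> (V y)) * (sqrt (\<kappa> (V y)) * Q y) = s * (\<mu> (V y) / V y) * Q y * (sqrt (\<kappa> (V y)) / \<kappa> (V y))"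
      by (simp add: a_\<Phi>[OF assms(1,2)])
    also have "sqrt (\<kappa> (V y)) / \<kappa> (V y) = 1 / sqrt (\<kappa> (V y))"
      using k by (simp add: sqrt_divide_self_eq inverse_eq_divide)
    finally show ?thesis
      by simp
  qed
  moreover have "\<kappa> (V y) * Q' + 1/2 * deriv \<kappa> (V y) * (Q y)\<^sup>2 = C - s * (\<mu> (V y) / V y) * Q y - f (V y)"
    using Q' by linarith
  ultimately have "(\<kappa> (V y) * Q' + 1/2 * deriv \<kappa> (V y) * (Q y)\<^sup>2) / sqrt (\<kappa> (V y))
      = C / sqrt (\<kappa> (V y)) - a (\<Phi> (V y)) * (sqrt (\<kappa> (V y)) * Q y) - g (\<Phi> (V y))"
    by (simp only: g_\<Phi>[OF assms(1,2)] diff_divide_distrib)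
  then show "((\<lambda>y. sqrt (\<kappa> (V y)) * Q y) has_real_derivative
      C / sqrt (\<kappa> (V y)) - a (\<Phi> (V y)) * (sqrt (\<kappa> (V y)) * Q y) - g (\<Phi> (V y))) (at y)"
    using scaled_speed_deriv[OF v assms(3,4)] by simp
qed

lemma sol_of_profile:
  assumes S: "profile_sol V Q" and range: "\<And>y. \<alpha> \<le> V y \<and> V y \<le> \<beta>"
  shows "sol (\<lambda>y. \<Phi> (V y)) (\<lambda>y. sqrt (\<kappa> (V y)) * Q y)"
  unfolding sol_def
proof (intro allI conjI)
  fix y
  have "\<kappa> (V y) * rhs (V y) (Q y) + 1/2 * deriv \<kappa> (V y) * (Q y)\<^sup>2 + s * (\<mu> (V y) / V y) * Q y + f (V y) = 0"
    using \<kappa>_pos[OF profile_solD(1)[OF S, of y]] by (simp add: rhs_def algebra_simps)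
  note D = chart_deriv[OF _ _ profile_solD(2,3)[OF S] this]
  show "((\<lambda>y. \<Phi> (V y)) has_real_derivative sqrt (\<kappa> (V y)) * Q y) (at y)"
    using D(1) range by blast
  show "((\<lambda>y. sqrt (\<kappa> (V y)) * Q y) has_real_derivative
      - a (\<Phi> (V y)) * (sqrt (\<kappa> (V y)) * Q y) - g (\<Phi> (V y))) (at y)"
    using D(2) range by simp
qed

lemma profile_of_sol:
  assumes S: "sol W w" and range: "\<And>y. \<Phi> \<alpha> \<le> W y \<and> W y \<le> \<Phi> \<beta>"
  shows "profile_sol (\<lambda>y. \<Psi> (W y)) (\<lambda>y. w y / sqrt (\<kappa> (\<Psi> (W y))))"
  unfolding profile_sol_def
proof (intro allI conjI)
  fix y
  define V where "V y = \<Psi> (W y)" for y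
  have W: "W y = \<Phi> (V y)" for y
    by (simp add: V_def \<Phi>_\<Psi>)
  have V: "\<alpha> \<le> V y" "V y \<le> \<beta>" for y
    using range[of y] strict_mono_less_eq[OF \<Phi>_mono] by (auto simp: W)
  show pos: "\<Psi> (W y) > 0" for y
    using V(1)[of y] \<alpha>(1) by (simp add: V_def)
  have k: "\<kappa> (V y) > 0" for y
    using pos \<kappa>_pos by (simp add: V_def)
  define Q where "Q y = w y / sqrt (\<kappa> (V y))" for y
  have V': "(V has_real_derivative Q y) (at y)" for y
  proof -
    have "(\<Psi> has_real_derivative inverse (sqrt (\<kappa> (V y)))) (at (W y))"
      using \<Psi>_deriv[OF V[of y]] by (simp add: W)
    from DERIV_chain2[OF this solD(1)[OF S]] show ?thesis
      by (simp add: V_def[abs_def] Q_def divide_inverse_commute)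
  qed
  then show "((\<lambda>y. \<Psi> (W y)) has_real_derivative w y / sqrt (\<kappa> (\<Psi> (W y)))) (at y)"
    by (simp add: V_def[abs_def] Q_def)
  have s': "((\<lambda>y. sqrt (\<kappa> (V y))) has_real_derivative inverse (sqrt (\<kappa> (V y))) / 2 * (deriv \<kappa> (V y) * Q y)) (at y)"
    using pos by (intro DERIV_chain2[OF DERIV_real_sqrt[OF k] DERIV_chain2[OF \<kappa>_deriv V']]) (simp add: V_def)
  have "(Q has_real_derivative rhs (V y) (Q y)) (at y)"
    unfolding Q_def[abs_def]
  proof (rule DERIV_cong[OF DERIV_divide[OF solD(2)[OF S] s']])
    show "sqrt (\<kappa> (V y)) \<noteq> 0"
      using k[of y] by simp
    define k' where "k' = sqrt (\<kappa> (V y))"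
    have k': "k' > 0" "\<kappa> (V y) = k' * k'"
      using k[of y] by (auto simp: k'_def)
    have w: "w y = k' * Q y"
      using k'(1) unfolding Q_def k'_def by simp
    have v: "V y > 0"
      using pos by (simp add: V_def)
    have "a (W y) = s * \<mu> (V y) / (V y * (k' * k'))" "g (W y) = f (V y) / k'"
      unfolding W a_\<Phi>[OF V] g_\<Phi>[OF V] k'_def using k[of y] by simp_all
    then show "((- a (W y) * w y - g (W y)) * sqrt (\<kappa> (V y)) -
        w y * (inverse (sqrt (\<kappa> (V y))) / 2 * (deriv \<kappa> (V y) * Q y))) / (sqrt (\<kappa> (V y)) * sqrt (\<kappa> (V y)))
        = rhs (V y) (w y / sqrt (\<kappa> (V y)))"
      using k' v unfolding rhs_def k'_def[symmetric] w
      by (simp add: field_simps power2_eq_square)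
  qed
  then show "((\<lambda>y. w y / sqrt (\<kappa> (\<Psi> (W y)))) has_real_derivative
      rhs (\<Psi> (W y)) (w y / sqrt (\<kappa> (\<Psi> (W y))))) (at y)"
    by (simp add: V_def Q_def[abs_def])
qed

text \<open>In the chart the derivative of \<open>w + A W\<close> tends to
  \<open>C / sqrt (\<kappa> Vp)\<close>, as \<open>g\<close> vanishes at \<open>\<Phi> Vp\<close>;
  by \<open>second_order_limit\<close> this limit is 0. Only convergence of \<open>V\<close> is
  used, no decay of \<open>Q\<close>.\<close>

lemma integration_constant_zero:
  assumes range: "\<And>y. \<alpha> \<le> V y \<and> V y \<le> \<beta>"
    and V: "\<And>y. (V has_real_derivative Q y) (at y)" and Q: "\<And>y. (Q has_real_derivative Q' y) (at y)"
    and eq: "\<And>y. \<kappa> (V y) * Q' y + 1/2 * deriv \<kappa> (V y) * (Q y)\<^sup>2 + s * (\<mu> (V y) / V y) * Q y + f (V y) = C"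
    and lim: "(V \<longlongrightarrow> Vp) at_top"
  shows "C = 0"
proof -
  define W where "W y = \<Phi> (V y)" for y
  define w where "w y = sqrt (\<kappa> (V y)) * Q y" for y
  note D = chart_deriv[OF range[THEN conjunct1] range[THEN conjunct2] V Q eq]
  have W': "(W has_real_derivative (w y + A (W y)) - A (W y)) (at y)" for y
    using D(1) by (simp add: W_def[abs_def] w_def)
  have Z': "((\<lambda>y. w y + A (W y)) has_real_derivative C / sqrt (\<kappa> (V y)) - g (W y)) (at y)" for y
    using DERIV_add[OF D(2) DERIV_chain2[OF A D(1)]] by (simp add: W_def[abs_def] w_def[abs_def])
  have Vp: "\<alpha> \<le> Vp" "Vp \<le> \<beta>"
    using \<alpha> \<beta> Vm_less_Vp by auto
  have W_lim: "(W \<longlongrightarrow> \<Phi> Vp) at_top"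
    unfolding W_def by (rule isCont_tendsto_compose[OF DERIV_isCont[OF \<Phi>_deriv[OF Vp]] lim])
  have A_lim: "((\<lambda>y. A (W y)) \<longlongrightarrow> A (\<Phi> Vp)) at_top"
    by (rule isCont_tendsto_compose[OF A_cont W_lim])
  have "isCont g (\<Phi> Vp)"
    using g_cont[of UNIV] by (simp add: continuous_on_eq_continuous_at)
  then have "((\<lambda>y. C / sqrt (\<kappa> (V y)) - g (W y)) \<longlongrightarrow> C / sqrt (\<kappa> Vp) - g (\<Phi> Vp)) at_top"
    using \<kappa>_pos[OF Vp_pos]
    by (intro tendsto_intros isCont_tendsto_compose[OF DERIV_isCont[OF \<kappa>_deriv[OF Vp_pos]] lim]
        isCont_tendsto_compose[OF _ W_lim]) auto
  from second_order_limit(1)[OF W' Z' W_lim A_lim this] show ?thesis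
    using \<kappa>_pos[OF Vp_pos] g_q by simp
qed

end

section \<open>Existence and uniqueness of the profile\<close>

context compressive_shock begin

lemma shock_chart_exists:
  assumes "0 < \<alpha>1"
  obtains a g A G L a0 \<Phi> \<Psi> \<alpha> \<beta> where "shock_chart p \<mu> \<kappa> Vm Um Vp Up s a g A G L a0 \<Phi> \<Psi> \<alpha> \<beta>"
    and "\<alpha> \<le> \<alpha>1" "\<beta>1 \<le> \<beta>"
proof -
  obtain F \<beta>0 where F: "\<And>v. v > 0 \<Longrightarrow> (F has_real_derivative f v) (at v)"
      and \<beta>0: "Vp < \<beta>0" "\<And>\<beta>. \<beta>0 \<le> \<beta> \<Longrightarrow> F Vm < F \<beta>"
    using potential_exists by blast
  define \<alpha> where "\<alpha> = min \<alpha>1 (Vm / 2)"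
  define \<beta> where "\<beta> = max \<beta>0 \<beta>1"
  have \<alpha>: "0 < \<alpha>" "\<alpha> < Vm" and \<beta>: "Vp < \<beta>"
    using assms Vm_pos \<beta>0(1) by (auto simp: \<alpha>_def \<beta>_def min_def)
  have "F Vm < F \<beta>"
    by (rule \<beta>0(2)) (simp add: \<beta>_def)
  have le: "\<alpha> \<le> \<alpha>1" "\<beta>1 \<le> \<beta>"
    by (auto simp: \<alpha>_def \<beta>_def)
  show ?thesis
  proof (rule lienard_chart[OF \<alpha> \<beta> F \<open>F Vm < F \<beta>\<close>], goal_cases)
    case (2 \<Phi> \<Psi> a g A G L a0)
    then have "shock_chart p \<mu> \<kappa> Vm Um Vp Up s a g A G L a0 \<Phi> \<Psi> \<alpha> \<beta>"
      using \<alpha> \<beta> by (intro shock_chart.intro shock_chart_axioms.intro compressive_shock_axioms)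
    then show ?case
      using le by (rule that)
  qed simp
qed

lemma profile_sol_exists:
  "\<exists>V Q. profile_sol V Q \<and> (V \<longlongrightarrow> Vm) at_bot \<and> (V \<longlongrightarrow> Vp) at_top"
proof -
  obtain a g A G L a0 \<Phi> \<Psi> \<alpha> \<beta> where "shock_chart p \<mu> \<kappa> Vm Um Vp Up s a g A G L a0 \<Phi> \<Psi> \<alpha> \<beta>"
    by (rule shock_chart_exists[OF Vm_pos])
  then interpret shock_chart p \<mu> \<kappa> Vm Um Vp Up s a g A G L a0 \<Phi> \<Psi> \<alpha> \<beta> .
  obtain W w where W: "sol W w" "(W \<longlongrightarrow> \<Phi> Vm) at_bot" "(W \<longlongrightarrow> \<Phi> Vp) at_top"
      "\<And>t. \<Phi> Vm < W t \<and> W t < \<Phi> \<beta>"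
    using connecting_solution_exists by blast
  have "\<Phi> \<alpha> < \<Phi> Vm"
    using \<Phi>_mono \<alpha> by (simp add: strict_mono_def)
  then have "profile_sol (\<lambda>y. \<Psi> (W y)) (\<lambda>y. w y / sqrt (\<kappa> (\<Psi> (W y))))"
    by (intro profile_of_sol[OF W(1)]) (meson W(4) less_imp_le less_trans)
  moreover have "((\<lambda>y. \<Psi> (W y)) \<longlongrightarrow> Vm) at_bot" "((\<lambda>y. \<Psi> (W y)) \<longlongrightarrow> Vp) at_top"
    using isCont_tendsto_compose[OF \<Psi>_cont W(2)] isCont_tendsto_compose[OF \<Psi>_cont W(3)]
    by (simp_all add: \<Psi>_\<Phi>)
  ultimately show ?thesis
    by blast
qed

text \<open>The chart is chosen after the profile, around its range; in it the integration constant
  is seen to vanish.\<close>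

lemma traveling_profile_sol:
  assumes T: "traveling_profile p \<mu> \<kappa> Vm Um Vp Up s V U"
  shows "profile_sol V (deriv V)"
proof -
  have td: "times_differentiable n V" for n
    using T by (auto simp: traveling_profile_def smooth_on_UNIV_iff)
  have V': "(V has_real_derivative deriv V y) (at y)"
      and V'': "(deriv V has_real_derivative deriv (deriv V) y) (at y)" for y
    by (rule times_differentiable_Suc_D(1)[OF td[of "Suc 0"]],
        rule times_differentiable_Suc_D(1)[OF times_differentiable_Suc_D(2)[OF td[of "Suc (Suc 0)"]]])
  have pos: "V y > 0" for y
    using T by (simp add: traveling_profile_def)
  have lims: "(V \<longlongrightarrow> Vm) at_bot" "(V \<longlongrightarrow> Vp) at_top"
    using T by (auto simp: traveling_profile_def)
  have "continuous_on UNIV V"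
    by (intro continuous_at_imp_continuous_on ballI DERIV_isCont[OF V'])
  then obtain \<alpha>1 \<beta>1 where range: "0 < \<alpha>1" "\<And>y. \<alpha>1 \<le> V y \<and> V y \<le> \<beta>1"
    using continuous_positive_range[OF _ pos lims Vm_pos Vp_pos] by blast
  obtain a g A G L a0 \<Phi> \<Psi> \<alpha> \<beta> where "shock_chart p \<mu> \<kappa> Vm Um Vp Up s a g A G L a0 \<Phi> \<Psi> \<alpha> \<beta>"
      and \<alpha>\<beta>: "\<alpha> \<le> \<alpha>1" "\<beta>1 \<le> \<beta>"
    by (rule shock_chart_exists[OF range(1)])
  then interpret shock_chart p \<mu> \<kappa> Vm Um Vp Up s a g A G L a0 \<Phi> \<Psi> \<alpha> \<beta>
    by simp
  obtain C where C: "\<And>y. \<kappa> (V y) * deriv (deriv V) y + 1/2 * deriv \<kappa> (V y) * (deriv V y)\<^sup>2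
      + s * (\<mu> (V y) / V y) * deriv V y + f (V y) = C"
    using traveling_profile_integrated(2)[OF T] by blast
  have "C = 0"
    by (rule integration_constant_zero[OF _ V' V'' C lims(2)]) (meson range \<alpha>\<beta> order_trans)
  then have "deriv (deriv V) y = rhs (V y) (deriv V y)" for y
    using C[of y] \<kappa>_pos[OF pos[of y]] by (simp add: rhs_def field_simps)
  then show ?thesis
    using pos V' V'' by (simp add: profile_sol_def)
qed

lemma profile_sol_range:
  assumes "profile_sol V Q" "(V \<longlongrightarrow> Vm) at_bot" "(V \<longlongrightarrow> Vp) at_top"
  shows "\<exists>\<alpha> \<beta>. 0 < \<alpha> \<and> (\<forall>y. \<alpha> \<le> V y \<and> V y \<le> \<beta>)"
proof -
  have "continuous_on UNIV V"
    by (intro continuous_at_imp_continuous_on ballI DERIV_isCont[OF profile_solD(2)[OF assms(1)]])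
  then show ?thesis
    using continuous_positive_range[OF _ profile_solD(1)[OF assms(1)] assms(2,3) Vm_pos Vp_pos] by blast
qed

text \<open>One chart covering both ranges turns the two profiles into solutions of the same Lienard
  equation.\<close>

lemma profile_sol_unique:
  assumes S: "profile_sol V1 Q1" "profile_sol V2 Q2"
    and bot: "(V1 \<longlongrightarrow> Vm) at_bot" "(V2 \<longlongrightarrow> Vm) at_bot"
    and top: "(V1 \<longlongrightarrow> Vp) at_top" "(V2 \<longlongrightarrow> Vp) at_top"
  shows "\<exists>c. \<forall>y. V2 y = V1 (y + c)"
proof -
  obtain \<alpha>1 \<beta>1 where r1: "0 < \<alpha>1" "\<And>y. \<alpha>1 \<le> V1 y \<and> V1 y \<le> \<beta>1"
    using profile_sol_range[OF S(1) bot(1) top(1)] by blast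
  obtain \<alpha>2 \<beta>2 where r2: "0 < \<alpha>2" "\<And>y. \<alpha>2 \<le> V2 y \<and> V2 y \<le> \<beta>2"
    using profile_sol_range[OF S(2) bot(2) top(2)] by blast
  obtain a g A G L a0 \<Phi> \<Psi> \<alpha> \<beta> where "shock_chart p \<mu> \<kappa> Vm Um Vp Up s a g A G L a0 \<Phi> \<Psi> \<alpha> \<beta>"
      and \<alpha>\<beta>: "\<alpha> \<le> min \<alpha>1 \<alpha>2" "max \<beta>1 \<beta>2 \<le> \<beta>"
  proof -
    have "0 < min \<alpha>1 \<alpha>2"
      using r1(1) r2(1) by simp
    then show thesis
      using that by (rule shock_chart_exists)
  qed
  then interpret shock_chart p \<mu> \<kappa> Vm Um Vp Up s a g A G L a0 \<Phi> \<Psi> \<alpha> \<beta>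
    by simp
  have sols: "sol (\<lambda>y. \<Phi> (V1 y)) (\<lambda>y. sqrt (\<kappa> (V1 y)) * Q1 y)" "sol (\<lambda>y. \<Phi> (V2 y)) (\<lambda>y. sqrt (\<kappa> (V2 y)) * Q2 y)"
  proof -
    have "\<alpha> \<le> V1 y \<and> V1 y \<le> \<beta>" "\<alpha> \<le> V2 y \<and> V2 y \<le> \<beta>" for y
      using r1(2)[of y] r2(2)[of y] \<alpha>\<beta> by auto
    then show "sol (\<lambda>y. \<Phi> (V1 y)) (\<lambda>y. sqrt (\<kappa> (V1 y)) * Q1 y)" "sol (\<lambda>y. \<Phi> (V2 y)) (\<lambda>y. sqrt (\<kappa> (V2 y)) * Q2 y)"
      using S by (auto intro!: sol_of_profile)
  qed
  have \<Phi>_cont: "isCont \<Phi> Vm" "isCont \<Phi> Vp"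
    using \<alpha> \<beta> Vm_less_Vp by (auto intro!: DERIV_isCont[OF \<Phi>_deriv])
  obtain c where "\<And>y. \<Phi> (V2 y) = \<Phi> (V1 (y + c))"
    using connecting_solution_unique[OF sols isCont_tendsto_compose[OF \<Phi>_cont(1) bot(1)]
        isCont_tendsto_compose[OF \<Phi>_cont(1) bot(2)] isCont_tendsto_compose[OF \<Phi>_cont(2) top(1)]
        isCont_tendsto_compose[OF \<Phi>_cont(2) top(2)]] by blast
  then have "V2 y = V1 (y + c)" for y
    by (metis \<Psi>_\<Phi>)
  then show ?thesis
    by blast
qed

text \<open>The last claim is what makes a polar angle around \<open>(Vp, 0)\<close> possible: an
  orbit that meets the equilibrium coincides with the constant solution and could not come from
  \<open>Vm\<close>.\<close>

lemma profile_sol_asymptotics: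
  assumes S: "profile_sol V Q" and lims: "(V \<longlongrightarrow> Vm) at_bot" "(V \<longlongrightarrow> Vp) at_top"
  shows "(Q \<longlongrightarrow> 0) at_bot" "(Q \<longlongrightarrow> 0) at_top" "V y \<noteq> Vp \<or> Q y \<noteq> 0"
proof -
  obtain \<alpha>1 \<beta>1 where range: "0 < \<alpha>1" "\<And>y. \<alpha>1 \<le> V y \<and> V y \<le> \<beta>1"
    using profile_sol_range[OF S lims] by blast
  obtain a g A G L a0 \<Phi> \<Psi> \<alpha> \<beta> where "shock_chart p \<mu> \<kappa> Vm Um Vp Up s a g A G L a0 \<Phi> \<Psi> \<alpha> \<beta>"
      and \<alpha>\<beta>: "\<alpha> \<le> \<alpha>1" "\<beta>1 \<le> \<beta>"
    by (rule shock_chart_exists[OF range(1)])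
  then interpret shock_chart p \<mu> \<kappa> Vm Um Vp Up s a g A G L a0 \<Phi> \<Psi> \<alpha> \<beta>
    by simp
  have sol: "sol (\<lambda>y. \<Phi> (V y)) (\<lambda>y. sqrt (\<kappa> (V y)) * Q y)"
    by (rule sol_of_profile[OF S]) (meson range \<alpha>\<beta> order_trans)
  have \<Phi>_cont: "isCont \<Phi> Vm" "isCont \<Phi> Vp"
    using \<alpha> \<beta> Vm_less_Vp by (auto intro!: DERIV_isCont[OF \<Phi>_deriv])
  note W_lims = isCont_tendsto_compose[OF \<Phi>_cont(1) lims(1)] isCont_tendsto_compose[OF \<Phi>_cont(2) lims(2)]
  have Q: "(Q \<longlongrightarrow> 0) F"
    if "((\<lambda>y. sqrt (\<kappa> (V y)) * Q y) \<longlongrightarrow> 0) F" "(V \<longlongrightarrow> v) F" "v > 0" for F v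
  proof -
    have "((\<lambda>y. (sqrt (\<kappa> (V y)) * Q y) / sqrt (\<kappa> (V y))) \<longlongrightarrow> 0 / sqrt (\<kappa> v)) F"
      using \<kappa>_pos[OF that(3)]
      by (intro tendsto_intros that(1) isCont_tendsto_compose[OF DERIV_isCont[OF \<kappa>_deriv[OF that(3)]] that(2)]) auto
    moreover have "sqrt (\<kappa> (V y)) \<noteq> 0" for y
      using \<kappa>_pos[OF profile_solD(1)[OF S, of y]] by simp
    ultimately show ?thesis
      by simp
  qed
  show "(Q \<longlongrightarrow> 0) at_bot"
    by (rule Q[OF sol_limit_at_bot(2)[OF sol W_lims(1)] lims(1) Vm_pos])
  show "(Q \<longlongrightarrow> 0) at_top"
    by (rule Q[OF sol_limit_at_top(2)[OF sol W_lims(2)] lims(2) Vp_pos])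
  show "V y \<noteq> Vp \<or> Q y \<noteq> 0"
  proof (rule ccontr)
    assume "\<not> (V y \<noteq> Vp \<or> Q y \<noteq> 0)"
    then have "\<Phi> (V t) = \<Phi> Vp" for t
      using sol_unique(1)[OF sol sol_const[OF g_q], of y t] by simp
    then have "V t = Vp" for t
      by (metis \<Psi>_\<Phi>)
    then have "V = (\<lambda>_. Vp)"
      by auto
    then have "((\<lambda>_::real. Vp) \<longlongrightarrow> Vm) at_bot"
      using lims(1) by simp
    then have "Vp = Vm"
      by (simp add: tendsto_const_iff)
    then show False
      using Vm_less_Vp by simp
  qed
qed

end

section \<open>Oscillation\<close>

text \<open>In this form limits and derivatives of planar curves follow from the rules for sums and
  scalar multiples.\<close>

lemma vector_2_eq: "(vector [a, b] :: real^2) = a *\<^sub>R axis 1 1 + b *\<^sub>R axis 2 1"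
  by (simp add: vec_eq_iff forall_2 axis_def)

lemma tendsto_vector_2:
  "(f \<longlongrightarrow> a) F \<Longrightarrow> (g \<longlongrightarrow> b) F \<Longrightarrow> ((\<lambda>x. vector [f x, g x] :: real^2) \<longlongrightarrow> vector [a, b]) F"
  unfolding vector_2_eq by (intro tendsto_intros)

lemma has_derivative_vector_2:
  "(f has_derivative f') F \<Longrightarrow> (g has_derivative g') F \<Longrightarrow>
    ((\<lambda>x. vector [f x, g x] :: real^2) has_derivative (\<lambda>h. vector [f' h, g' h])) F"
  unfolding vector_2_eq by (intro derivative_intros)

lemma has_vector_derivative_vector_2:
  assumes "(f has_real_derivative f') (at x)" "(g has_real_derivative g') (at x)"
  shows "((\<lambda>x. vector [f x, g x] :: real^2) has_vector_derivative vector [f', g']) (at x)"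
  unfolding has_vector_derivative_def
  by (rule has_derivative_eq_rhs[OF has_derivative_vector_2[OF assms[unfolded has_field_derivative_def]]])
    (simp add: fun_eq_iff vec_eq_iff forall_2)

text \<open>The constant is determinant over trace of the matrix of the form, a lower bound for its
  smaller eigenvalue.\<close>

lemma quadratic_form_coercive:
  fixes b c x y :: real
  assumes "b\<^sup>2 < 4 * c"
  shows "(c - b\<^sup>2 / 4) / (1 + c) * (x\<^sup>2 + y\<^sup>2) \<le> y\<^sup>2 + b * x * y + c * x\<^sup>2"
proof -
  have c: "c > 0"
    using assms zero_le_power2[of b] by linarith
  define d where "d = (c - b\<^sup>2 / 4) / (1 + c)"
  have "d * (1 + c) = c - b\<^sup>2 / 4"
    using c by (simp add: d_def)
  then have b2: "b\<^sup>2 / 4 = c - d * (1 + c)"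
    by simp
  have "c - b\<^sup>2 / 4 < 1 + c"
    using zero_le_power2[of b] by linarith
  then have d: "d < 1"
    using c by (simp add: d_def)
  \<comment> \<open>Multiplying by \<open>1 - d\<close>, the coefficient of
    \<open>y\<^sup>2\<close>, completes the square; the choice of \<open>d\<close> turns the
    remaining coefficient of \<open>x\<^sup>2\<close> into \<open>d\<^sup>2\<close>.\<close>
  have "(1 - d) * (y\<^sup>2 + b * x * y + c * x\<^sup>2 - d * (x\<^sup>2 + y\<^sup>2))
      = ((1 - d) * y + b / 2 * x)\<^sup>2 + ((1 - d) * (c - d) - b\<^sup>2 / 4) * x\<^sup>2"
    by (simp add: power2_eq_square algebra_simps)
  also have "(1 - d) * (c - d) - b\<^sup>2 / 4 = d\<^sup>2"
    unfolding b2 by (simp add: power2_eq_square algebra_simps)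
  finally have "0 \<le> (1 - d) * (y\<^sup>2 + b * x * y + c * x\<^sup>2 - d * (x\<^sup>2 + y\<^sup>2))"
    by simp
  then show ?thesis
    using d by (simp add: zero_le_mult_iff flip: d_def)
qed

text \<open>An antiderivative \<open>H\<close> of \<open>z' / z\<close> is a logarithm of
  \<open>z\<close> up to a constant, because \<open>z * exp (- H)\<close> has derivative 0.
  \<open>Ln\<close> is taken only at \<open>z 0\<close>, so no branch cut interferes with
  continuity.\<close>

lemma continuous_polar_angle:
  fixes z z' :: "real \<Rightarrow> complex"
  assumes z: "\<And>t. (z has_vector_derivative z' t) (at t)" and z': "continuous_on UNIV z'"
    and nz: "\<And>t. z t \<noteq> 0"
  shows "\<exists>\<theta>. (\<forall>t. z t = cmod (z t) *\<^sub>R cis (\<theta> t)) \<and>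
    (\<forall>t. (\<theta> has_real_derivative Im (z' t / z t)) (at t))"
proof -
  have "continuous_on UNIV z"
    using z by (intro continuous_at_imp_continuous_on) (auto intro: has_vector_derivative_continuous)
  then have "continuous_on UNIV (\<lambda>t. z' t / z t)"
    using nz by (intro continuous_intros z') auto
  then obtain H where H: "H 0 = 0" "\<And>t. (H has_vector_derivative z' t / z t) (at t)"
    using antiderivative_exists by blast
  have "((\<lambda>t. z t * exp (- H t)) has_vector_derivative 0) (at t)" for t
  proof -
    have "((\<lambda>t. exp (- H t)) has_vector_derivative (- (z' t / z t)) * exp (- H t)) (at t)"
      using field_vector_diff_chain_at[OF has_vector_derivative_minus[OF H(2)] DERIV_exp] by (simp add: o_def)
    from has_vector_derivative_mult[OF z this] show ?thesis
      using nz[of t] by simp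
  qed
  then have const: "z t * exp (- H t) = z 0 * exp (- H 0)" for t
    using has_vector_derivative_zero_constant[of UNIV "\<lambda>t. z t * exp (- H t)"]
    by (metis UNIV_I at_within_open convex_UNIV open_UNIV)
  have "z t = exp (Ln (z 0) + H t)" for t
  proof -
    have "z t = (z t * exp (- H t)) * exp (H t)"
      by (simp add: exp_minus)
    then show ?thesis
      using nz[of 0] by (simp add: const H(1) exp_add)
  qed
  then have "z t = cmod (z t) *\<^sub>R cis (Im (Ln (z 0) + H t))" for t
    by (metis cis_conv_exp exp_eq_polar norm_exp_eq_Re scaleR_conv_of_real)
  moreover have "((\<lambda>t. Im (Ln (z 0) + H t)) has_real_derivative Im (z' t / z t)) (at t)" for t
    unfolding has_real_derivative_iff_has_vector_derivative
    by (intro bounded_linear.has_vector_derivative[OF bounded_linear_Im])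
      (auto intro!: derivative_eq_intros H(2))
  ultimately show ?thesis
    by (intro exI[of _ "\<lambda>t. Im (Ln (z 0) + H t)"]) blast
qed

lemma filterlim_at_bot_of_deriv_le:
  fixes \<theta> \<theta>' :: "real \<Rightarrow> real"
  assumes \<theta>: "\<And>t. (\<theta> has_real_derivative \<theta>' t) (at t)"
    and le: "eventually (\<lambda>t. \<theta>' t \<le> - d) at_top" and "d > 0"
  shows "filterlim \<theta> at_bot at_top"
proof -
  obtain T where T: "\<And>t. t \<ge> T \<Longrightarrow> \<theta>' t \<le> - d"
    using le by (auto simp: eventually_at_top_linorder)
  have "\<theta> t \<le> \<theta> T - d * (t - T)" if "t \<ge> T" for t
  proof -
    have "\<theta> t + d * t \<le> \<theta> T + d * T"
    proof (rule DERIV_nonpos_imp_nonincreasing[OF that])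
      fix x assume "T \<le> x"
      then show "\<exists>y. ((\<lambda>t. \<theta> t + d * t) has_real_derivative y) (at x) \<and> y \<le> 0"
        using T[of x] by (intro exI[of _ "\<theta>' x + d"]) (auto intro!: derivative_eq_intros \<theta>)
    qed
    then show ?thesis
      by (simp add: algebra_simps)
  qed
  then have ev: "eventually (\<lambda>t. \<theta> t \<le> \<theta> T - d * (t - T)) at_top"
    by (auto simp: eventually_at_top_linorder)
  show ?thesis
    unfolding filterlim_at_bot
  proof
    fix Z
    show "eventually (\<lambda>t. \<theta> t \<le> Z) at_top"
      using ev eventually_ge_at_top[of "T + (\<theta> T - Z) / d"]
    proof eventually_elim
      case (elim t)
      have "(\<theta> T - Z) / d \<le> t - T"
        using elim(2) by simp
      then have "\<theta> T - Z \<le> d * (t - T)"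
        using \<open>d > 0\<close> by (simp add: pos_divide_le_eq mult.commute)
      then show ?case
        using elim(1) by linarith
    qed
  qed
qed

text \<open>The angle passes through some multiple of \<open>2 * pi\<close>, where the orbit lies on
  the positive horizontal axis, that is to the right of its centre.\<close>

lemma clockwise_angle_hits_zero:
  fixes \<theta> :: "real \<Rightarrow> real"
  assumes cont: "continuous_on UNIV \<theta>" and lim: "filterlim \<theta> at_bot at_top"
  shows "\<exists>t. cos (\<theta> t) = 1 \<and> sin (\<theta> t) = 0"
proof -
  obtain n :: nat where "- \<theta> 0 < real n * (2 * pi)"
    using ex_less_of_nat_mult[of "2 * pi" "- \<theta> 0"] by auto
  then have "- (2 * real n * pi) < \<theta> 0"
    by (simp add: mult_ac)
  moreover obtain T where "T \<ge> 0" "\<theta> T \<le> - (2 * real n * pi)"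
  proof -
    have "eventually (\<lambda>t. \<theta> t \<le> - (2 * real n * pi) \<and> 0 \<le> t) at_top"
      using lim eventually_ge_at_top[of 0] by (auto simp: filterlim_at_bot intro: eventually_conj)
    from eventually_happens'[OF trivial_limit_at_top_linorder this] show ?thesis
      using that by blast
  qed
  ultimately obtain t where "\<theta> t = - (2 * real n * pi)"
    using IVT2'[of \<theta> T "- (2 * real n * pi)" 0] continuous_on_subset[OF cont subset_UNIV] by auto
  then show ?thesis
    by (intro exI[of _ t]) (simp add: sin_2npi cos_2npi)
qed

section \<open>Linearisation at the right equilibrium and rotation around it\<close>

context compressive_shock begin

text \<open>With \<open>stiffness\<close> these are minus the trace and the determinant of the
  linearisation at \<open>(Vp, 0)\<close>, which reads
  \<open>x'' + damping * x' + stiffness * x = 0\<close>.\<close>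

definition damping :: real where
  "damping = s * \<mu> Vp / (Vp * \<kappa> Vp)"

definition stiffness :: real where
  "stiffness = (deriv p Vp + s\<^sup>2) / \<kappa> Vp"

lemma damping_pos: "damping > 0" and stiffness_pos: "stiffness > 0"
  using s_pos \<mu>_pos \<kappa>_pos Vp_pos Lax(1) by (auto simp: damping_def stiffness_def)

text \<open>Multiplied by \<open>\<bar>s\<bar> * sqrt (\<kappa> Vp)\<close>, squared and divided by
  \<open>(Vp * \<kappa> Vp)\<^sup>2\<close>, the bound on \<open>eta\<close> becomes the negativity
  of the discriminant.\<close>

lemma underdamped:
  assumes "eta \<mu> \<kappa> Vp < 2 * Vp * sqrt (deriv (profile_f p s Vp) Vp) / \<bar>s\<bar>"
  shows "damping\<^sup>2 < 4 * stiffness"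
proof -
  have f': "deriv f Vp = deriv p Vp + s\<^sup>2" "deriv p Vp + s\<^sup>2 > 0"
    using f_deriv[OF Vp_pos] Lax(1) by (auto intro: DERIV_imp_deriv)
  have \<kappa>: "\<kappa> Vp > 0" and \<mu>: "\<mu> Vp > 0"
    using \<kappa>_pos \<mu>_pos Vp_pos by auto
  have "s * \<mu> Vp < 2 * Vp * sqrt (deriv p Vp + s\<^sup>2) * sqrt (\<kappa> Vp)"
    using assms s_pos \<kappa> unfolding eta_def f' by (simp add: field_simps)
  then have "(s * \<mu> Vp)\<^sup>2 < (2 * Vp * sqrt (deriv p Vp + s\<^sup>2) * sqrt (\<kappa> Vp))\<^sup>2"
    using s_pos \<mu> by (intro power_strict_mono) auto
  also have "\<dots> = 4 * Vp\<^sup>2 * (deriv p Vp + s\<^sup>2) * \<kappa> Vp"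
    using f' \<kappa> by (simp add: power_mult_distrib)
  finally show ?thesis
    using \<kappa> Vp_pos by (simp add: damping_def stiffness_def power_divide divide_simps power2_eq_square mult_ac)
qed

lemma profile_field_eq: "profile_field p \<mu> \<kappa> s Vp x = vector [x $ 2, rhs (x $ 1) (x $ 2)]"
  by (simp add: profile_field_def rhs_def)

lemma profile_field_equilibria:
  "profile_field p \<mu> \<kappa> s Vp (vector [Vm, 0]) = 0" "profile_field p \<mu> \<kappa> s Vp (vector [Vp, 0]) = 0"
  by (simp_all add: profile_field_eq rhs_def f_Vm f_Vp vec_eq_iff forall_2)

lemma profile_field_has_derivative:
  "(profile_field p \<mu> \<kappa> s Vp has_derivative
     (\<lambda>h. vector [h $ 2, - stiffness * h $ 1 - damping * h $ 2])) (at (vector [Vp, 0]))"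
proof -
  let ?a = "vector [Vp, 0] :: real^2"
  have \<kappa>: "\<kappa> Vp \<noteq> 0"
    using \<kappa>_pos[OF Vp_pos] by simp
  have c: "((\<lambda>x::real^2. x $ 1) has_derivative (\<lambda>h. h $ 1)) (at ?a)"
      "((\<lambda>x::real^2. x $ 2) has_derivative (\<lambda>h. h $ 2)) (at ?a)"
    by (intro bounded_linear_imp_has_derivative bounded_linear_vec_nth)+
  have comp: "((\<lambda>x::real^2. u (x $ 1)) has_derivative (\<lambda>h. h $ 1 * u')) (at ?a)"
    if "(u has_real_derivative u') (at Vp)" for u u'
    using that by (intro DERIV_compose_FDERIV[OF _ c(1)]) simp
  have \<kappa>'': "(deriv \<kappa> has_real_derivative deriv (deriv \<kappa>) Vp) (at Vp)"
    using smooth_on_has_derivative[OF smooth_on_deriv[OF smooth(3)]] Vp_pos by auto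
  \<comment> \<open>The values of \<open>k'\<close> and \<open>m'\<close> never matter: they
    multiply the bracket and the speed, both of which vanish at the equilibrium.\<close>
  obtain k' where k': "((\<lambda>v. - (1 / \<kappa> v)) has_real_derivative k') (at Vp)"
    using DERIV_minus[OF DERIV_divide[OF DERIV_const \<kappa>_deriv[OF Vp_pos] \<kappa>]] by blast
  obtain m' where m': "((\<lambda>v. s * (\<mu> v / v)) has_real_derivative m') (at Vp)"
    using DERIV_cmult[OF DERIV_divide[OF \<mu>_deriv[OF Vp_pos] DERIV_ident]] Vp_pos by blast
  have "((\<lambda>x::real^2. rhs (x $ 1) (x $ 2)) has_derivative
      (\<lambda>h. - stiffness * h $ 1 - damping * h $ 2)) (at ?a)"
    unfolding rhs_def
    by (rule has_derivative_eq_rhs[OF has_derivative_mult[OF comp[OF k']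
          has_derivative_add[OF has_derivative_add[OF comp[OF f_deriv[OF Vp_pos]]
            has_derivative_mult[OF comp[OF m'] c(2)]]
          has_derivative_mult[OF comp[OF DERIV_cmult[OF \<kappa>'']] has_derivative_power[OF c(2)]]]]])
      (simp add: fun_eq_iff f_Vp stiffness_def damping_def algebra_simps add_divide_distrib)
  then show ?thesis
    unfolding profile_field_eq[abs_def] by (intro has_derivative_vector_2 c)
qed

text \<open>Eigenvalues solve \<open>l * l + damping * l + stiffness = 0\<close>. The negative
  discriminant excludes real ones, and then the imaginary part of the equation gives
  \<open>Re l = - damping / 2\<close>.\<close>

lemma focus_Vp:
  assumes "damping\<^sup>2 < 4 * stiffness"
  shows "focus (profile_field p \<mu> \<kappa> s Vp) (vector [Vp, 0])"
proof -
  let ?F = "profile_field p \<mu> \<kappa> s Vp" and ?a = "vector [Vp, 0] :: real^2"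
  have J: "jacobian ?F (at ?a) = matrix (\<lambda>h. vector [h $ 2, - stiffness * h $ 1 - damping * h $ 2])"
    unfolding jacobian_def frechet_derivative_at[OF profile_field_has_derivative, symmetric] ..
  have "Im l \<noteq> 0 \<and> Re l \<noteq> 0" if l: "complex_eigenvalue (jacobian ?F (at ?a)) l" for l
  proof -
    obtain w :: "complex^2" where w: "w \<noteq> 0" "map_matrix of_real (jacobian ?F (at ?a)) *v w = l *s w"
      using l unfolding complex_eigenvalue_def by (elim exE conjE) (rule that)
    have comp: "(map_matrix of_real (jacobian ?F (at ?a)) *v w) $ 1 = w $ 2"
        "(map_matrix of_real (jacobian ?F (at ?a)) *v w) $ 2
          = - of_real stiffness * w $ 1 - of_real damping * w $ 2"
      unfolding J by (simp_all add: matrix_def map_matrix_def matrix_vector_mult_def sum_2 axis_def)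
    have w2: "w $ 2 = l * w $ 1"
      using comp(1) unfolding w(2) by simp
    have w1: "- of_real stiffness * w $ 1 - of_real damping * w $ 2 = l * w $ 2"
      using comp(2) unfolding w(2) by simp
    have "w $ 1 \<noteq> 0"
      using w(1) w2 by (auto simp: vec_eq_iff forall_2)
    moreover have "(l * l + of_real damping * l + of_real stiffness) * w $ 1
        = l * w $ 2 - (- of_real stiffness * w $ 1 - of_real damping * w $ 2)"
      unfolding w2 by (simp add: algebra_simps)
    ultimately have l: "l * l + of_real damping * l + of_real stiffness = 0"
      unfolding w1 by simp
    have re: "(Re l)\<^sup>2 - (Im l)\<^sup>2 + damping * Re l + stiffness = 0" and im: "Im l * (2 * Re l + damping) = 0"
      using arg_cong[OF l, of Re] arg_cong[OF l, of Im] by (simp_all add: power2_eq_square algebra_simps)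
    have "Im l \<noteq> 0"
    proof
      assume "Im l = 0"
      then have "(Re l + damping / 2)\<^sup>2 + (stiffness - damping\<^sup>2 / 4) = 0"
        using re by (simp add: power2_eq_square algebra_simps)
      then show False
        using assms zero_le_power2[of "Re l + damping / 2"] by linarith
    qed
    then show ?thesis
      using im damping_pos by auto
  qed
  then show ?thesis
    using profile_field_equilibria(2) profile_field_has_derivative
    by (auto simp: focus_def differentiable_def)
qed

text \<open>Near \<open>(Vp, 0)\<close> the system is \<open>x'' = - c x - b x'\<close> with coefficients that converge to the
  stiffness and the damping, so \<open>arg (x + \<i> x')\<close> decreases at a uniform rate.\<close>

lemma angular_speed:
  assumes S: "profile_sol V Q" and lims: "(V \<longlongrightarrow> Vm) at_bot" "(V \<longlongrightarrow> Vp) at_top"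
    and disc: "damping\<^sup>2 < 4 * stiffness"
  shows "\<exists>d>0. eventually (\<lambda>y. Im (Complex (Q y) (rhs (V y) (Q y)) / Complex (V y - Vp) (Q y)) \<le> - d) at_top"
proof -
  note Q_lim = profile_sol_asymptotics(2)[OF S lims]
  \<comment> \<open>Caratheodory's slope function: it is defined and continuous at \<open>Vp\<close>
    too, so \<open>f\<close> can be written as \<open>e * (V - Vp)\<close> even when the profile
    crosses \<open>Vp\<close>.\<close>
  obtain e where e: "\<And>v. f v = e v * (v - Vp)" "isCont e Vp" "e Vp = deriv p Vp + s\<^sup>2"
    using f_deriv[OF Vp_pos] by (auto simp: CARAT_DERIV f_Vp)
  define c where "c y = e (V y) / \<kappa> (V y)" for y
  \<comment> \<open>The quadratic term is absorbed as a speed-dependent damping, whose extra part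
    vanishes in the limit because \<open>Q\<close> does.\<close>
  define b where "b y = s * (\<mu> (V y) / V y) / \<kappa> (V y) + 1/2 * deriv \<kappa> (V y) / \<kappa> (V y) * Q y" for y
  have conts: "isCont \<kappa> Vp" "isCont \<mu> Vp" "isCont (deriv \<kappa>) Vp"
    using \<kappa>_deriv[OF Vp_pos] \<mu>_deriv[OF Vp_pos]
      smooth_on_has_derivative[OF smooth_on_deriv[OF smooth(3)], of Vp] Vp_pos
    by (auto intro: DERIV_isCont)
  note tends = conts[THEN isCont_tendsto_compose, OF lims(2)] isCont_tendsto_compose[OF e(2) lims(2)]
  have \<kappa>: "\<kappa> Vp \<noteq> 0"
    using \<kappa>_pos[OF Vp_pos] by simp
  have "(c \<longlongrightarrow> e Vp / \<kappa> Vp) at_top"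
    unfolding c_def[abs_def] by (intro tendsto_intros tends \<kappa>)
  then have c: "(c \<longlongrightarrow> stiffness) at_top"
    by (simp add: e(3) stiffness_def)
  have "(b \<longlongrightarrow> s * (\<mu> Vp / Vp) / \<kappa> Vp + 1/2 * deriv \<kappa> Vp / \<kappa> Vp * 0) at_top"
    unfolding b_def[abs_def] using Vp_pos by (intro tendsto_intros tends \<kappa> Q_lim lims) auto
  then have b: "(b \<longlongrightarrow> damping) at_top"
    by (simp add: damping_def)
  have rhs_eq: "rhs (V y) (Q y) = - c y * (V y - Vp) - b y * Q y" for y
    using \<kappa>_pos[OF profile_solD(1)[OF S, of y]]
    by (simp add: rhs_def e(1) c_def b_def field_simps power2_eq_square)
  \<comment> \<open>Coercivity constant of the limiting quadratic form. Errors in \<open>b\<close>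
    and \<open>c\<close> adding up to less than \<open>d / 2\<close> leave half of it.\<close>
  define d where "d = (stiffness - damping\<^sup>2 / 4) / (1 + stiffness)"
  have d: "d > 0"
    using disc stiffness_pos by (simp add: d_def)
  have "((\<lambda>y. \<bar>b y - damping\<bar> + \<bar>c y - stiffness\<bar>) \<longlongrightarrow> \<bar>damping - damping\<bar> + \<bar>stiffness - stiffness\<bar>) at_top"
    by (intro tendsto_intros b c)
  then have "eventually (\<lambda>y. \<bar>b y - damping\<bar> + \<bar>c y - stiffness\<bar> < d / 2) at_top"
    using d by (intro order_tendstoD(2)) auto
  then have "eventually (\<lambda>y. Im (Complex (Q y) (rhs (V y) (Q y)) / Complex (V y - Vp) (Q y)) \<le> - (d / 2)) at_top"
  proof eventually_elim
    case (elim y)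
    define x where "x = V y - Vp"
    define q where "q = Q y"
    have pos: "x\<^sup>2 + q\<^sup>2 > 0"
      using profile_sol_asymptotics(3)[OF S lims, of y] by (simp add: x_def q_def sum_power2_gt_zero_iff)
    have rq: "rhs (V y) q = - c y * x - b y * q"
      unfolding x_def q_def by (rule rhs_eq)
    have "2 * (\<bar>x\<bar> * \<bar>q\<bar>) \<le> x\<^sup>2 + q\<^sup>2" "0 \<le> \<bar>x\<bar> * \<bar>q\<bar>"
      using sum_squares_bound[of "\<bar>x\<bar>" "\<bar>q\<bar>"] by (simp_all add: mult.assoc)
    then have xq: "\<bar>x * q\<bar> \<le> x\<^sup>2 + q\<^sup>2" "x\<^sup>2 \<le> x\<^sup>2 + q\<^sup>2"
      unfolding abs_mult by (linarith, simp)
    have "q\<^sup>2 + damping * x * q + stiffness * x\<^sup>2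
        \<le> (q\<^sup>2 + b y * x * q + c y * x\<^sup>2) + (\<bar>(b y - damping) * (x * q)\<bar> + \<bar>(c y - stiffness) * x\<^sup>2\<bar>)"
      by (simp add: algebra_simps)
    also have "\<bar>(b y - damping) * (x * q)\<bar> + \<bar>(c y - stiffness) * x\<^sup>2\<bar>
        \<le> \<bar>b y - damping\<bar> * (x\<^sup>2 + q\<^sup>2) + \<bar>c y - stiffness\<bar> * (x\<^sup>2 + q\<^sup>2)"
      unfolding abs_mult using xq by (intro add_mono mult_left_mono) (auto simp: abs_mult)
    also have "\<dots> \<le> d / 2 * (x\<^sup>2 + q\<^sup>2)"
      unfolding distrib_right[symmetric] using elim pos by (intro mult_right_mono) auto
    finally have "d * (x\<^sup>2 + q\<^sup>2) \<le> (q\<^sup>2 + b y * x * q + c y * x\<^sup>2) + d / 2 * (x\<^sup>2 + q\<^sup>2)"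
      using quadratic_form_coercive[OF disc, of x q] by (simp add: d_def)
    then have "d / 2 * (x\<^sup>2 + q\<^sup>2) \<le> q\<^sup>2 + b y * x * q + c y * x\<^sup>2"
      by linarith
    then have "d / 2 \<le> (q\<^sup>2 + b y * x * q + c y * x\<^sup>2) / (x\<^sup>2 + q\<^sup>2)"
      using pos by (simp only: pos_le_divide_eq)
    \<comment> \<open>For \<open>z = x + \<i> q\<close> with \<open>x' = q\<close> the angular speed
      is \<open>(q' * x - q\<^sup>2) / (x\<^sup>2 + q\<^sup>2)\<close>; inserting
      \<open>q' = - c * x - b * q\<close> gives minus the quadratic form.\<close>
    moreover have "Im (Complex (Q y) (rhs (V y) (Q y)) / Complex (V y - Vp) (Q y))
        = - ((q\<^sup>2 + b y * x * q + c y * x\<^sup>2) / (x\<^sup>2 + q\<^sup>2))"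
      unfolding x_def[symmetric] q_def[symmetric] rq minus_divide_left
      by (simp add: Im_divide power2_eq_square algebra_simps)
    ultimately show ?case
      by linarith
  qed
  then show ?thesis
    using d by (intro exI[of _ "d / 2"]) auto
qed

lemma profile_sol_oscillating:
  assumes S: "profile_sol V (deriv V)" and lims: "(V \<longlongrightarrow> Vm) at_bot" "(V \<longlongrightarrow> Vp) at_top"
    and disc: "damping\<^sup>2 < 4 * stiffness"
  shows "oscillating p \<mu> \<kappa> Vm Vp s V"
proof -
  note P = profile_solD[OF S] and asym = profile_sol_asymptotics[OF S lims]
  let ?F = "profile_field p \<mu> \<kappa> s Vp"
  define X where "X y = (vector [V y, deriv V y] :: real^2)" for y
  have X_deriv: "(X has_vector_derivative ?F (X y)) (at y)" for y
    unfolding X_def[abs_def] profile_field_eq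
    using has_vector_derivative_vector_2[OF P(2,3)] by simp
  have het: "heteroclinic_orbit ?F (vector [Vm, 0]) (vector [Vp, 0]) X"
    unfolding heteroclinic_orbit_def
  proof (intro conjI allI)
    show "(vector [Vm, 0] :: real^2) \<noteq> vector [Vp, 0]"
      using Vm_less_Vp by (auto simp: vec_eq_iff forall_2)
  qed (use profile_field_equilibria X_deriv lims asym(1,2) in \<open>auto simp: X_def[abs_def] intro!: tendsto_vector_2\<close>)
  define z where "z y = Complex (V y - Vp) (deriv V y)" for y
  define z' where "z' y = Complex (deriv V y) (rhs (V y) (deriv V y))" for y
  have z: "(z has_vector_derivative z' y) (at y)" for y
    unfolding z_def[abs_def] z'_def Complex_eq
    by (auto intro!: derivative_eq_intros has_vector_derivative_of_real P(2,3)
        simp: has_real_derivative_iff_has_vector_derivative[symmetric])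
  have td: "times_differentiable n (deriv V)" for n
    using profile_sol_times_differentiable[OF S] by blast
  have "continuous_on UNIV (deriv V)" "continuous_on UNIV (deriv (deriv V))"
    by (intro continuous_at_imp_continuous_on ballI;
        rule DERIV_isCont[OF times_differentiable_Suc_D(1)[OF td[of "Suc 0"]]]
          DERIV_isCont[OF times_differentiable_Suc_D(1)[OF times_differentiable_Suc_D(2)[OF td[of "Suc (Suc 0)"]]]])+
  moreover have "deriv (deriv V) = (\<lambda>y. rhs (V y) (deriv V y))"
    using DERIV_imp_deriv[OF P(3)] by auto
  ultimately have z'_cont: "continuous_on UNIV z'"
    unfolding z'_def[abs_def] by (auto intro!: continuous_on_Complex)
  have nz: "z y \<noteq> 0" for y
    using asym(3)[of y] by (auto simp: z_def complex_eq_iff)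
  obtain \<theta> where \<theta>: "\<And>y. z y = cmod (z y) *\<^sub>R cis (\<theta> y)"
      "\<And>y. (\<theta> has_real_derivative Im (z' y / z y)) (at y)"
    using continuous_polar_angle[OF z z'_cont nz] by blast
  obtain d where "d > 0" "eventually (\<lambda>y. Im (z' y / z y) \<le> - d) at_top"
    using angular_speed[OF S lims disc] by (auto simp: z_def z'_def)
  then have \<theta>_bot: "filterlim \<theta> at_bot at_top"
    by (intro filterlim_at_bot_of_deriv_le[OF \<theta>(2)])
  have \<theta>_cont: "continuous_on T \<theta>" for T
    using \<theta>(2) by (intro continuous_at_imp_continuous_on) (auto intro: DERIV_isCont)
  have z_cont: "continuous_on T z" for T
    using z by (intro continuous_at_imp_continuous_on) (auto intro: has_vector_derivative_continuous)
  have parts: "V y - Vp = cmod (z y) * cos (\<theta> y)" "deriv V y = cmod (z y) * sin (\<theta> y)" for y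
    using arg_cong[OF \<theta>(1)[of y], of Re] arg_cong[OF \<theta>(1)[of y], of Im] by (simp_all add: z_def)
  have "((\<lambda>y. sqrt ((V y - Vp)\<^sup>2 + (deriv V y)\<^sup>2)) \<longlongrightarrow> sqrt ((Vp - Vp)\<^sup>2 + 0\<^sup>2)) at_top"
    by (intro tendsto_intros lims asym)
  then have r_lim: "((\<lambda>y. cmod (z y)) \<longlongrightarrow> 0) at_top"
    by (simp add: z_def cmod_def)
  have "spirals_into X (vector [Vp, 0])"
    unfolding spirals_into_def
  proof (rule exI[of _ 0], rule exI[of _ "\<lambda>y. cmod (z y)"], rule exI[of _ \<theta>], intro conjI allI impI)
    show "continuous_on {0..} (\<lambda>y. cmod (z y))"
      by (intro continuous_intros z_cont)
    show "cmod (z y) > 0" for y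
      using nz by simp
    show "X y - vector [Vp, 0] = cmod (z y) *\<^sub>R vector [cos (\<theta> y), sin (\<theta> y)]" for y
      using parts[of y] by (simp add: X_def vec_eq_iff forall_2)
    show "filterlim \<theta> at_infinity at_top"
      by (rule filterlim_mono[OF \<theta>_bot at_bot_le_at_infinity order_refl])
  qed (use \<theta>_cont r_lim in auto)
  \<comment> \<open>Every turn brings the orbit to the positive axis, that is to a value
    \<open>V y > Vp\<close>, which an increasing \<open>V\<close> with limit \<open>Vp\<close>
    cannot take.\<close>
  moreover have "\<not> mono V"
  proof
    assume V: "mono V"
    obtain y where "cos (\<theta> y) = 1"
      using clockwise_angle_hits_zero[OF \<theta>_cont \<theta>_bot] by blast
    then have "Vp < V y"
      using parts(1)[of y] nz[of y] by (simp add: algebra_simps)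
    moreover have "V y \<le> Vp"
      by (rule tendsto_lowerbound[OF lims(2)])
        (auto intro!: eventually_at_top_linorderI[of y] monoD[OF V])
    ultimately show False
      by simp
  qed
  moreover have "\<not> antimono V"
  proof
    assume V: "antimono V"
    have "V 0 \<le> Vm"
      by (rule tendsto_lowerbound[OF lims(1)])
        (auto intro!: eventually_at_bot_linorderI[of 0] antimonoD[OF V])
    moreover have "Vp \<le> V 0"
      by (rule tendsto_upperbound[OF lims(2)])
        (auto intro!: eventually_at_top_linorderI[of 0] antimonoD[OF V])
    ultimately show False
      using Vm_less_Vp by simp
  qed
  ultimately show ?thesis
    using het focus_Vp[OF disc] by (simp add: oscillating_def X_def[abs_def])
qed

end

theorem theorem5:
  fixes p \<mu> \<kappa> :: "real \<Rightarrow> real" and Vm Um Vp Up s :: real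
  assumes "smooth_on {0<..} p" and "smooth_on {0<..} \<mu>" and "smooth_on {0<..} \<kappa>"
    and "\<And>v. v > 0 \<Longrightarrow> \<mu> v > 0"
    and "\<And>v. v > 0 \<Longrightarrow> \<kappa> v > 0"
    and "\<And>v. v > 0 \<Longrightarrow> deriv p v < 0"
    and "\<And>v. v > 0 \<Longrightarrow> deriv (deriv p) v > 0"
    and "Vm > 0" and "Vp > 0"
    and "compressive_2_shock p Vm Um Vp Up s"
  shows "(\<exists>V U. traveling_profile p \<mu> \<kappa> Vm Um Vp Up s V U) \<and>
    (\<forall>V1 U1 V2 U2.
       traveling_profile p \<mu> \<kappa> Vm Um Vp Up s V1 U1 \<longrightarrow>
       traveling_profile p \<mu> \<kappa> Vm Um Vp Up s V2 U2 \<longrightarrow>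
       (\<exists>c. \<forall>y. V2 y = V1 (y + c) \<and> U2 y = U1 (y + c))) \<and>
    (0 < eta \<mu> \<kappa> Vp \<and>
       eta \<mu> \<kappa> Vp < 2 * Vp * sqrt (deriv (profile_f p s Vp) Vp) / \<bar>s\<bar> \<longrightarrow>
     (\<forall>V U. traveling_profile p \<mu> \<kappa> Vm Um Vp Up s V U \<longrightarrow>
        oscillating p \<mu> \<kappa> Vm Vp s V))"
proof -
  interpret compressive_shock p \<mu> \<kappa> Vm Um Vp Up s
    using assms by unfold_locales
  let ?T = "traveling_profile p \<mu> \<kappa> Vm Um Vp Up s"
  have lims: "(V \<longlongrightarrow> Vm) at_bot" "(V \<longlongrightarrow> Vp) at_top" if "?T V U" for V U
    using that by (auto simp: traveling_profile_def)
  show ?thesis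
  proof (intro conjI allI impI)
    show "\<exists>V U. ?T V U"
      using profile_sol_exists traveling_profile_of_sol by blast
  next
    fix V1 U1 V2 U2 assume T1: "?T V1 U1" and T2: "?T V2 U2"
    obtain c where c: "\<And>y. V2 y = V1 (y + c)"
      using profile_sol_unique[OF traveling_profile_sol[OF T1] traveling_profile_sol[OF T2]
          lims(1)[OF T1] lims(1)[OF T2] lims(2)[OF T1] lims(2)[OF T2]] by blast
    \<comment> \<open>Both velocities are the same affine function of their specific volumes, so the
      shift found for \<open>V\<close> serves \<open>U\<close> as well.\<close>
    then show "\<exists>c. \<forall>y. V2 y = V1 (y + c) \<and> U2 y = U1 (y + c)"
      using traveling_profile_integrated(1)[OF T1] traveling_profile_integrated(1)[OF T2]
      by (intro exI[of _ c]) simp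
  next
    fix V U
    assume eta: "0 < eta \<mu> \<kappa> Vp \<and> eta \<mu> \<kappa> Vp < 2 * Vp * sqrt (deriv (profile_f p s Vp) Vp) / \<bar>s\<bar>"
      and T: "?T V U"
    show "oscillating p \<mu> \<kappa> Vm Vp s V"
      using profile_sol_oscillating[OF traveling_profile_sol[OF T] lims[OF T]] underdamped eta by blast
  qed
qed

end
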